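(* Let $(\Omega,\mathscr{H},\widehat{\mathbb E})$ be a sub-linear expectation space with upper capacity $\mathbb V$. Let $\{X_n;n\ge 1\}$ be a sequence of independent random variables in $(\Omega,\mathscr{H},\widehat{\mathbb E})$ and $S_n=\sum_{k=1}^n X_k$. For a constant $c>0$ write $X_n^c=(-c)\vee(X_n\wedge c)$ and consider the three conditions (S1) $\sum_{n=1}^\infty \mathbb V(|X_n|>c)<\infty$; (S2) $\sum_{n=1}^\infty\widehat{\mathbb E}[X_n^c]$ and $\sum_{n=1}^\infty\widehat{\mathbb E}[-X_n^c]$ are both convergent; (S3) $\sum_{n=1}^\infty\widehat{\mathbb E}\big[(X_n^c-\widehat{\mathbb E}[X_n^c])^2\big]<\infty$ or/and $\sum_{n=1}^\infty\widehat{\mathbb E}\big[(X_n^c+\widehat{\mathbb E}[-X_n^c])^2\big]<\infty$ (that is, at least one of the two series is finite). If (S1), (S2) and (S3) hold for some $c>0$, then $S_n$ is a Cauchy sequence in capacity $\mathbb V$, i.e. $\mathbb V(|S_n-S_m|\ge\epsilon)\to0$ as $n,m\to\infty$ for all $\epsilon>0$. Conversely, if $S_n$ is a Cauchy sequence in capacity $\mathbb V$, then (S1), (S2) and (S3) hold for all $c>0$.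
   Context: Framework. $(\Omega,\mathcal F)$ is a measurable space and $\mathscr{H}$ is a linear space of real ($\mathcal F$-measurable) functions on $\Omega$ such that $X_1,\dots,X_n\in\mathscr{H}$ implies $\varphi(X_1,\dots,X_n)\in\mathscr{H}$ for every $\varphi\in C_{l,Lip}(\mathbb R^n)$, where $C_{l,Lip}(\mathbb R^n)$ is the space of functions $\varphi$ with $|\varphi(x)-\varphi(y)|\le C(1+|x|^m+|y|^m)|x-y|$ for all $x,y\in\mathbb R^n$, for some $C>0$, $m\in\mathbb N$ depending on $\varphi$. Elements of $\mathscr{H}$ are the random variables in the space. A sub-linear expectation on $\mathscr{H}$ is a function $\widehat{\mathbb E}:\mathscr{H}\to[-\infty,\infty]$ such that for all $X,Y\in\mathscr{H}$: (a) $X\ge Y$ implies $\widehat{\mathbb E}[X]\ge\widehat{\mathbb E}[Y]$; (b) $\widehat{\mathbb E}[c]=c$ for constants $c$; (c) $\widehat{\mathbb E}[X+Y]\le\widehat{\mathbb E}[X]+\widehat{\mathbb E}[Y]$ whenever the right side is not of the form $+\infty-\infty$ or $-\infty+\infty$; (d) $\widehat{\mathbb E}[\lambda X]=\lambda\widehat{\mathbb E}[X]$ for $\lambda\ge 0$. The triple $(\Omega,\mathscr{H},\widehat{\mathbb E})$ is called a sub-linear expectation space. Capacity. $\mathbb V(A):=\inf\{\widehat{\mathbb E}[\xi]: I_A\le\xi,\ \xi\in\mathscr{H}\}$ for $A\in\mathcal F$. Independence. Let $C_{b,Lip}$ denote bounded Lipschitz functions. A random vector $Y=(Y_1,\dots,Y_n)$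 ($Y_i\in\mathscr{H}$) is independent to $X=(X_1,\dots,X_m)$ ($X_i\in\mathscr{H}$) if $\widehat{\mathbb E}[\varphi(X,Y)]=\widehat{\mathbb E}\big[\widehat{\mathbb E}[\varphi(x,Y)]|_{x=X}\big]$ for all $\varphi\in C_{b,Lip}(\mathbb R^m\times\mathbb R^n)$. Random variables $\{X_n;n\ge1\}$ are independent if $X_{i+1}$ is independent to $(X_1,\dots,X_i)$ for each $i\ge1$. *)

theory Defs
  imports "HOL-Analysis.Analysis"
begin

text \<open>
  Vectors of \<open>\<real>\<^sup>n\<close> are represented by functions \<open>nat \<Rightarrow> real\<close>, of which only the coordinates
  \<open>i < n\<close> count, since the dimension has to be quantified over inside the definitions below.
\<close>

definition eucl_norm :: "nat \<Rightarrow> (nat \<Rightarrow> real) \<Rightarrow> real" where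
  "eucl_norm n x = L2_set x {..<n}"

text \<open>
  The growth condition forces every member of \<open>C_l_Lip n\<close> to depend on the first \<open>n\<close> coordinates
  only: the right-hand side vanishes when \<open>x\<close> and \<open>y\<close> agree there. The same holds for \<open>C_b_Lip n\<close>.
\<close>

definition C_l_Lip :: "nat \<Rightarrow> ((nat \<Rightarrow> real) \<Rightarrow> real) set" where
  "C_l_Lip n = {\<phi>. \<exists>C>0. \<exists>m::nat. \<forall>x y.
     \<bar>\<phi> x - \<phi> y\<bar> \<le> C * (1 + eucl_norm n x ^ m + eucl_norm n y ^ m) * eucl_norm n (\<lambda>i. x i - y i)}"

definition C_b_Lip :: "nat \<Rightarrow> ((nat \<Rightarrow> real) \<Rightarrow> real) set" where
  "C_b_Lip n = {\<phi>. (\<exists>B. \<forall>x. \<bar>\<phi> x\<bar> \<le> B) \<and>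
     (\<exists>L. \<forall>x y. \<bar>\<phi> x - \<phi> y\<bar> \<le> L * eucl_norm n (\<lambda>i. x i - y i))}"

text \<open>
  The measure \<open>M\<close> only serves to provide the measurable space \<open>(space M, sets M)\<close>. The functional
  \<open>E\<close> is total, but nothing is assumed about it outside \<open>H\<close>. In \<open>E_scale\<close> the product
  \<open>0 * \<infinity>\<close> is \<open>0\<close>.
\<close>

locale sublinear_expectation_space =
  fixes M :: "'a measure"
    and H :: "('a \<Rightarrow> real) set"
    and E :: "('a \<Rightarrow> real) \<Rightarrow> ereal"
  assumes H_measurable: "H \<subseteq> borel_measurable M"
    and H_zero: "(\<lambda>_. 0) \<in> H"
    and H_add: "\<And>X Y. X \<in> H \<Longrightarrow> Y \<in> H \<Longrightarrow> (\<lambda>\<omega>. X \<omega> + Y \<omega>) \<in> H"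
    and H_scale: "\<And>a X. X \<in> H \<Longrightarrow> (\<lambda>\<omega>. a * X \<omega>) \<in> H"
    and H_Lip: "\<And>n \<phi> X. \<phi> \<in> C_l_Lip n \<Longrightarrow> (\<And>i. i < n \<Longrightarrow> X i \<in> H) \<Longrightarrow> (\<lambda>\<omega>. \<phi> (\<lambda>i. X i \<omega>)) \<in> H"
    and E_mono: "\<And>X Y. X \<in> H \<Longrightarrow> Y \<in> H \<Longrightarrow> (\<And>\<omega>. \<omega> \<in> space M \<Longrightarrow> Y \<omega> \<le> X \<omega>) \<Longrightarrow> E Y \<le> E X"
    and E_const: "\<And>c. E (\<lambda>_. c) = ereal c"
    and E_subadd: "\<And>X Y. X \<in> H \<Longrightarrow> Y \<in> H \<Longrightarrow>
          \<not> (E X = \<infinity> \<and> E Y = -\<infinity>) \<Longrightarrow> \<not> (E X = -\<infinity> \<and> E Y = \<infinity>) \<Longrightarrow>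
          E (\<lambda>\<omega>. X \<omega> + Y \<omega>) \<le> E X + E Y"
    and E_scale: "\<And>a X. X \<in> H \<Longrightarrow> 0 \<le> a \<Longrightarrow> E (\<lambda>\<omega>. a * X \<omega>) = ereal a * E X"

definition upper_capacity ::
  "'a measure \<Rightarrow> ('a \<Rightarrow> real) set \<Rightarrow> (('a \<Rightarrow> real) \<Rightarrow> ereal) \<Rightarrow> 'a set \<Rightarrow> ereal" where
  "upper_capacity M H E A = Inf {E \<xi> |\<xi>. \<xi> \<in> H \<and> (\<forall>\<omega>\<in>space M. indicator A \<omega> \<le> \<xi> \<omega>)}"

definition vec_append :: "nat \<Rightarrow> (nat \<Rightarrow> real) \<Rightarrow> (nat \<Rightarrow> real) \<Rightarrow> nat \<Rightarrow> real" where
  "vec_append m x y = (\<lambda>i. if i < m then x i else y (i - m))"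

text \<open>
  \<open>indep_to E n Y m X\<close>: the vector \<open>(Y 0, \<dots>, Y (n - 1))\<close> is independent to
  \<open>(X 0, \<dots>, X (m - 1))\<close>; the space \<open>\<real>\<^sup>m \<times> \<real>\<^sup>n\<close> is identified with \<open>\<real>\<^bsup>m + n\<^esup>\<close>. The inner
  expectation is that of a bounded element of \<open>H\<close>, hence finite, so that \<open>real_of_ereal\<close> only changes
  its type.
\<close>

definition indep_to ::
  "(('a \<Rightarrow> real) \<Rightarrow> ereal) \<Rightarrow> nat \<Rightarrow> (nat \<Rightarrow> 'a \<Rightarrow> real) \<Rightarrow> nat \<Rightarrow> (nat \<Rightarrow> 'a \<Rightarrow> real) \<Rightarrow> bool" where
  "indep_to E n Y m X \<longleftrightarrow> (\<forall>\<phi>\<in>C_b_Lip (m + n).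
     E (\<lambda>\<omega>. \<phi> (vec_append m (\<lambda>i. X i \<omega>) (\<lambda>j. Y j \<omega>))) =
     E (\<lambda>\<omega>. real_of_ereal (E (\<lambda>\<omega>'. \<phi> (vec_append m (\<lambda>i. X i \<omega>) (\<lambda>j. Y j \<omega>'))))))"

text \<open>Sequences start at index \<open>1\<close>; \<open>X 0\<close> is ignored here and below.\<close>

definition indep_seq :: "(('a \<Rightarrow> real) \<Rightarrow> ereal) \<Rightarrow> (nat \<Rightarrow> 'a \<Rightarrow> real) \<Rightarrow> bool" where
  "indep_seq E X \<longleftrightarrow> (\<forall>i\<ge>1. indep_to E 1 (\<lambda>_. X (i + 1)) i (\<lambda>j. X (j + 1)))"

definition trunc :: "real \<Rightarrow> ('a \<Rightarrow> real) \<Rightarrow> 'a \<Rightarrow> real" where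
  "trunc c Y = (\<lambda>\<omega>. max (- c) (min (Y \<omega>) c))"

text \<open>
  The series in \<open>cond_S1\<close> and \<open>cond_S3\<close> have nonnegative terms and are summed in \<open>ereal\<close>. In
  \<open>cond_S2\<close> the terms have absolute value at most \<open>c\<close> but no fixed sign, and convergence is meant
  in the reals: in \<open>ereal\<close>, \<open>summable\<close> would also allow an infinite sum. Likewise
  \<open>real_of_ereal\<close> in \<open>cond_S3\<close> is only applied to finite values.
\<close>

definition cond_S1 ::
  "'a measure \<Rightarrow> ('a \<Rightarrow> real) set \<Rightarrow> (('a \<Rightarrow> real) \<Rightarrow> ereal) \<Rightarrow> (nat \<Rightarrow> 'a \<Rightarrow> real) \<Rightarrow> real \<Rightarrow> bool" where
  "cond_S1 M H E X c \<longleftrightarrow>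
     (\<Sum>n. upper_capacity M H E {\<omega> \<in> space M. \<bar>X (Suc n) \<omega>\<bar> > c}) < \<infinity>"

definition cond_S2 :: "(('a \<Rightarrow> real) \<Rightarrow> ereal) \<Rightarrow> (nat \<Rightarrow> 'a \<Rightarrow> real) \<Rightarrow> real \<Rightarrow> bool" where
  "cond_S2 E X c \<longleftrightarrow>
     summable (\<lambda>n. real_of_ereal (E (trunc c (X (Suc n))))) \<and>
     summable (\<lambda>n. real_of_ereal (E (\<lambda>\<omega>. - trunc c (X (Suc n)) \<omega>)))"

definition cond_S3 :: "(('a \<Rightarrow> real) \<Rightarrow> ereal) \<Rightarrow> (nat \<Rightarrow> 'a \<Rightarrow> real) \<Rightarrow> real \<Rightarrow> bool" where
  "cond_S3 E X c \<longleftrightarrow>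
     (\<Sum>n. E (\<lambda>\<omega>. (trunc c (X (Suc n)) \<omega> - real_of_ereal (E (trunc c (X (Suc n)))))\<^sup>2)) < \<infinity> \<or>
     (\<Sum>n. E (\<lambda>\<omega>. (trunc c (X (Suc n)) \<omega>
                 + real_of_ereal (E (\<lambda>\<omega>'. - trunc c (X (Suc n)) \<omega>')))\<^sup>2)) < \<infinity>"

definition Cauchy_in_capacity ::
  "'a measure \<Rightarrow> ('a \<Rightarrow> real) set \<Rightarrow> (('a \<Rightarrow> real) \<Rightarrow> ereal) \<Rightarrow> (nat \<Rightarrow> 'a \<Rightarrow> real) \<Rightarrow> bool" where
  "Cauchy_in_capacity M H E S \<longleftrightarrow> (\<forall>\<epsilon>>0.
     ((\<lambda>(n, m). upper_capacity M H E {\<omega> \<in> space M. \<bar>S n \<omega> - S m \<omega>\<bar> \<ge> \<epsilon>})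
        \<longlongrightarrow> 0) (sequentially \<times>\<^sub>F sequentially))"

end

theory Submission
  imports Defs
begin

text \<open>
  Write \<open>R f\<close> for the sub-linear expectation of a bounded random variable, as a real number, and
  \<open>\<xi> i = X (Suc i)\<close>. Independence is only ever used by integrating out the last variable with the
  past frozen (\<open>integrate_last\<close>).

  Sufficiency. By the first series the \<open>\<xi> i\<close> may be replaced by their truncations
  (\<open>sums_Cauchy_cong\<close>). The upper tail of a sum is controlled after centring each summand at its
  upper mean: in the expansion of \<open>((s + z)\<^sup>+)\<^sup>2\<close> the mixed term then has nonpositive expectation
  (\<open>pos_part_square_sum_le\<close>). The lower tail is the upper tail of the negated summands, centred at
  their own upper means. So both centred second moments are wanted, but the second series makes the
  two centrings differ by a square summable amount, and one of them gives the other.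

  Necessity. The first series follows from Ottaviani's maximal inequality (\<open>ottaviani\<close>), because the
  capacity of the event that some \<open>\<bar>\<xi> i\<bar>\<close> is large is governed by a product over \<open>i\<close>
  (\<open>R_uminus_prod\<close>). For the truncated variables it is not possible to centre in advance, since their
  means are ambiguous. Instead every summand is replaced by a functional that is dominated by \<open>R\<close>,
  is linear on the few functions of \<open>\<xi> i\<close> that occur, and attains a chosen value of \<open>R\<close>; a finite
  form of the Hahn-Banach theorem provides it (\<open>extremal_functional\<close>). The modulus of its
  characteristic function is at most \<open>1\<close> minus a multiple of its variance, whatever its mean is, and
  the moduli multiply along the sequence (\<open>one_minus_cos_sum_ge\<close>). Hence the variances are summable
  for every choice of the functionals. Choosing them to attain the upper means, the sums
  concentrate at the sums of the upper means (\<open>centred_square_sum_ge\<close>), which must converge; the same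
  holds for \<open>- \<xi> i\<close>, and the second series follows. Choosing them to attain the upper centred second
  moments gives the third series.
\<close>

section \<open>Bounded Lipschitz functions\<close>

text \<open>
  Lipschitz functions of one real variable and of finitely many coordinates obey the same closure
  rules; a general function \<open>d\<close> in the place of the distance covers both.
\<close>

definition bounded_lipschitz :: "('b \<Rightarrow> 'b \<Rightarrow> real) \<Rightarrow> ('b \<Rightarrow> real) \<Rightarrow> bool" where
  "bounded_lipschitz d f \<longleftrightarrow>
     (\<exists>B. \<forall>x. \<bar>f x\<bar> \<le> B) \<and> (\<exists>L\<ge>0. \<forall>x y. \<bar>f x - f y\<bar> \<le> L * d x y)"

abbreviation real_BL :: "(real \<Rightarrow> real) \<Rightarrow> bool" where
  "real_BL \<equiv> bounded_lipschitz (\<lambda>x y. \<bar>x - y\<bar>)"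

lemma bounded_lipschitzI:
  assumes "\<And>x. \<bar>f x\<bar> \<le> B" and "0 \<le> L" and "\<And>x y. \<bar>f x - f y\<bar> \<le> L * d x y"
  shows "bounded_lipschitz d f"
  using assms unfolding bounded_lipschitz_def by blast

lemma bounded_lipschitzE:
  assumes "bounded_lipschitz d f"
  obtains B L where "0 \<le> B" and "0 \<le> L" and "\<And>x. \<bar>f x\<bar> \<le> B"
    and "\<And>x y. \<bar>f x - f y\<bar> \<le> L * d x y"
proof -
  obtain B L where "\<And>x. \<bar>f x\<bar> \<le> B" and "L \<ge> 0" and "\<And>x y. \<bar>f x - f y\<bar> \<le> L * d x y"
    using assms unfolding bounded_lipschitz_def by blast
  moreover have "0 \<le> B"
    using calculation(1) abs_ge_zero order_trans by blast
  ultimately show thesis using that by blast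
qed

lemma bounded_lipschitz_const: "bounded_lipschitz d (\<lambda>_. c)"
  by (rule bounded_lipschitzI[where B = "\<bar>c\<bar>" and L = 0]) auto

lemma bounded_lipschitz_add:
  assumes "bounded_lipschitz d f" and "bounded_lipschitz d g"
  shows "bounded_lipschitz d (\<lambda>x. f x + g x)"
proof -
  obtain B L where f: "0 \<le> L" "\<And>x. \<bar>f x\<bar> \<le> B" "\<And>x y. \<bar>f x - f y\<bar> \<le> L * d x y"
    using bounded_lipschitzE[OF assms(1)] by metis
  obtain B' L' where g: "0 \<le> L'" "\<And>x. \<bar>g x\<bar> \<le> B'" "\<And>x y. \<bar>g x - g y\<bar> \<le> L' * d x y"
    using bounded_lipschitzE[OF assms(2)] by metis
  show ?thesis
  proof (rule bounded_lipschitzI)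
    show "\<bar>f x + g x\<bar> \<le> B + B'" for x
      using f(2)[of x] g(2)[of x] by linarith
    show "\<bar>(f x + g x) - (f y + g y)\<bar> \<le> (L + L') * d x y" for x y
      using f(3)[of x y] g(3)[of x y] unfolding distrib_right by linarith
  qed (use f g in auto)
qed

lemma bounded_lipschitz_mult:
  assumes "bounded_lipschitz d f" and "bounded_lipschitz d g"
  shows "bounded_lipschitz d (\<lambda>x. f x * g x)"
proof -
  obtain B L where f: "0 \<le> B" "0 \<le> L" "\<And>x. \<bar>f x\<bar> \<le> B" "\<And>x y. \<bar>f x - f y\<bar> \<le> L * d x y"
    using bounded_lipschitzE[OF assms(1)] by metis
  obtain B' L' where g: "0 \<le> B'" "0 \<le> L'" "\<And>x. \<bar>g x\<bar> \<le> B'"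
      "\<And>x y. \<bar>g x - g y\<bar> \<le> L' * d x y"
    using bounded_lipschitzE[OF assms(2)] by metis
  show ?thesis
  proof (rule bounded_lipschitzI)
    show "\<bar>f x * g x\<bar> \<le> B * B'" for x
      using f(1) f(3)[of x] g(3)[of x] by (simp add: abs_mult mult_mono)
    show "\<bar>f x * g x - f y * g y\<bar> \<le> (B * L' + B' * L) * d x y" for x y
    proof -
      have "f x * g x - f y * g y = f x * (g x - g y) + g y * (f x - f y)"
        by (simp add: algebra_simps)
      then have "\<bar>f x * g x - f y * g y\<bar> \<le> \<bar>f x\<bar> * \<bar>g x - g y\<bar> + \<bar>g y\<bar> * \<bar>f x - f y\<bar>"
        by (metis abs_mult abs_triangle_ineq)
      also have "\<dots> \<le> B * (L' * d x y) + B' * (L * d x y)"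
        by (intro add_mono mult_mono f g) (use f(1) g(1) in auto)
      finally show ?thesis by (simp add: algebra_simps)
    qed
  qed (use f g in auto)
qed

lemma bounded_lipschitz_uminus:
  assumes "bounded_lipschitz d f"
  shows "bounded_lipschitz d (\<lambda>x. - f x)"
  using bounded_lipschitz_mult[OF bounded_lipschitz_const[of d "- 1"] assms] by simp

lemma bounded_lipschitz_diff:
  assumes "bounded_lipschitz d f" and "bounded_lipschitz d g"
  shows "bounded_lipschitz d (\<lambda>x. f x - g x)"
  using bounded_lipschitz_add[OF assms(1) bounded_lipschitz_uminus[OF assms(2)]] by simp

lemma bounded_lipschitz_power:
  assumes "bounded_lipschitz d f"
  shows "bounded_lipschitz d (\<lambda>x. f x ^ n)"
  by (induction n) (auto intro: bounded_lipschitz_const bounded_lipschitz_mult assms)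

lemma bounded_lipschitz_pos_part:
  assumes "bounded_lipschitz d f"
  shows "bounded_lipschitz d (\<lambda>x. max 0 (f x))"
proof -
  obtain B L where f: "0 \<le> L" "\<And>x. \<bar>f x\<bar> \<le> B" "\<And>x y. \<bar>f x - f y\<bar> \<le> L * d x y"
    using bounded_lipschitzE[OF assms] by metis
  show ?thesis
  proof (rule bounded_lipschitzI)
    show "\<bar>max 0 (f x)\<bar> \<le> B" for x using f(2)[of x] by linarith
    show "\<bar>max 0 (f x) - max 0 (f y)\<bar> \<le> L * d x y" for x y
      using f(3)[of x y] by linarith
  qed (rule f)
qed

lemma bounded_lipschitz_compose:
  assumes "real_BL g" and "0 \<le> K" and "\<And>x y. \<bar>s x - s y\<bar> \<le> K * d x y"
  shows "bounded_lipschitz d (\<lambda>x. g (s x))"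
proof -
  obtain B L where g: "0 \<le> L" "\<And>x. \<bar>g x\<bar> \<le> B" "\<And>x y. \<bar>g x - g y\<bar> \<le> L * \<bar>x - y\<bar>"
    using bounded_lipschitzE[OF assms(1)] by metis
  show ?thesis
  proof (rule bounded_lipschitzI)
    show "\<bar>g (s x)\<bar> \<le> B" for x by (rule g)
    show "\<bar>g (s x) - g (s y)\<bar> \<le> (L * K) * d x y" for x y
      using g(3)[of "s x" "s y"] mult_left_mono[OF assms(3)[of x y] g(1)]
      by (simp add: mult.assoc)
  qed (use g assms in auto)
qed

lemma real_BL_shift: "real_BL g \<Longrightarrow> real_BL (\<lambda>x. g (x + a))"
  by (rule bounded_lipschitz_compose[where K = 1]) auto

text \<open>
  Squares are Lipschitz on bounded sets only. For a bounded variable, clamping its argument at a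
  level that is never exceeded makes the square a bounded Lipschitz function without changing the
  values that occur.
\<close>

definition clamp :: "real \<Rightarrow> real \<Rightarrow> real" where
  "clamp K x = max (- K) (min x K)"

lemma clamp_lipschitz: "\<bar>clamp K x - clamp K y\<bar> \<le> \<bar>x - y\<bar>"
  unfolding clamp_def by linarith

lemma abs_clamp_le: "0 \<le> K \<Longrightarrow> \<bar>clamp K x\<bar> \<le> K"
  unfolding clamp_def by linarith

lemma clamp_id: "\<bar>x\<bar> \<le> K \<Longrightarrow> clamp K x = x"
  unfolding clamp_def by linarith

lemma real_BL_clamp: "real_BL (clamp K)"
proof (rule bounded_lipschitzI[where B = "\<bar>K\<bar>" and L = 1])
  show "\<bar>clamp K x\<bar> \<le> \<bar>K\<bar>" for x
    unfolding clamp_def by linarith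
qed (use clamp_lipschitz in auto)

text \<open>A Lipschitz substitute for the indicator of \<open>{x. \<bar>x\<bar> \<ge> b}\<close>, equal to \<open>0\<close> for \<open>\<bar>x\<bar> \<le> a\<close>.\<close>

definition ramp :: "real \<Rightarrow> real \<Rightarrow> real \<Rightarrow> real" where
  "ramp a b x = max 0 (min 1 ((\<bar>x\<bar> - a) / (b - a)))"

lemma ramp_ge_0: "0 \<le> ramp a b x" and ramp_le_1: "ramp a b x \<le> 1"
  unfolding ramp_def by auto

lemma ramp_eq_0: "a < b \<Longrightarrow> \<bar>x\<bar> \<le> a \<Longrightarrow> ramp a b x = 0"
  unfolding ramp_def using divide_nonpos_pos[of "\<bar>x\<bar> - a" "b - a"] by linarith

lemma ramp_eq_1: "a < b \<Longrightarrow> b \<le> \<bar>x\<bar> \<Longrightarrow> ramp a b x = 1"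
  unfolding ramp_def by (simp add: max_def min_def)

lemma real_BL_ramp:
  assumes "a < b"
  shows "real_BL (ramp a b)"
proof (rule bounded_lipschitzI[where B = 1 and L = "1 / (b - a)"])
  show "\<bar>ramp a b x\<bar> \<le> 1" for x
    using ramp_ge_0[of a b x] ramp_le_1[of a b x] by simp
  show "\<bar>ramp a b x - ramp a b y\<bar> \<le> 1 / (b - a) * \<bar>x - y\<bar>" for x y
  proof -
    have "\<bar>max 0 (min 1 u) - max 0 (min 1 v)\<bar> \<le> \<bar>u - v\<bar>" for u v :: real
      by linarith
    then have "\<bar>ramp a b x - ramp a b y\<bar> \<le> \<bar>(\<bar>x\<bar> - a) / (b - a) - (\<bar>y\<bar> - a) / (b - a)\<bar>"
      unfolding ramp_def .
    also have "\<dots> = \<bar>\<bar>x\<bar> - \<bar>y\<bar>\<bar> / (b - a)"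
      using assms by (simp add: diff_divide_distrib[symmetric])
    also have "\<dots> \<le> \<bar>x - y\<bar> / (b - a)"
      using assms by (intro divide_right_mono abs_triangle_ineq3) auto
    finally show ?thesis by simp
  qed
qed (use assms in auto)

lemma abs_cos_diff_le: "\<bar>cos x - cos y\<bar> \<le> \<bar>x - y\<bar>" for x y :: real
proof -
  have "\<bar>cos x - cos y\<bar> = 2 * \<bar>sin ((x + y) / 2)\<bar> * \<bar>sin ((y - x) / 2)\<bar>"
    by (simp add: cos_diff_cos abs_mult)
  also have "\<dots> \<le> 2 * 1 * \<bar>(y - x) / 2\<bar>"
    by (intro mult_mono abs_sin_x_le_abs_x abs_sin_le_one) auto
  finally show ?thesis by simp
qed

lemma real_BL_cos: "real_BL (\<lambda>x. cos (\<theta> + t * x))"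
proof (rule bounded_lipschitzI[where B = 1 and L = "\<bar>t\<bar>"])
  show "\<bar>cos (\<theta> + t * x) - cos (\<theta> + t * y)\<bar> \<le> \<bar>t\<bar> * \<bar>x - y\<bar>" for x y
    using abs_cos_diff_le[of "\<theta> + t * x" "\<theta> + t * y"]
    by (simp add: abs_mult[symmetric] right_diff_distrib)
qed auto

lemma real_BL_sin: "real_BL (\<lambda>x. sin (t * x))"
proof -
  have "sin (t * x) = cos (- (pi / 2) + t * x)" for x
    by (simp add: cos_diff)
  then show ?thesis using real_BL_cos[of "- (pi / 2)" t] by presburger
qed

abbreviation coord_dist :: "nat \<Rightarrow> (nat \<Rightarrow> real) \<Rightarrow> (nat \<Rightarrow> real) \<Rightarrow> real" where
  "coord_dist n x y \<equiv> (\<Sum>i<n. \<bar>x i - y i\<bar>)"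

text \<open>The sum norm is equivalent to the Euclidean norm and easier to handle coordinatewise.\<close>

lemma C_b_Lip_iff: "\<phi> \<in> C_b_Lip n \<longleftrightarrow> bounded_lipschitz (coord_dist n) \<phi>"
proof
  assume "\<phi> \<in> C_b_Lip n"
  then obtain B L where B: "\<And>x. \<bar>\<phi> x\<bar> \<le> B"
    and L: "\<And>x y. \<bar>\<phi> x - \<phi> y\<bar> \<le> L * eucl_norm n (\<lambda>i. x i - y i)"
    unfolding C_b_Lip_def by blast
  show "bounded_lipschitz (coord_dist n) \<phi>"
  proof (rule bounded_lipschitzI[where B = B and L = "\<bar>L\<bar>"])
    show "\<bar>\<phi> x - \<phi> y\<bar> \<le> \<bar>L\<bar> * coord_dist n x y" for x y
    proof -
      have "L * eucl_norm n (\<lambda>i. x i - y i) \<le> \<bar>L\<bar> * eucl_norm n (\<lambda>i. x i - y i)"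
        by (intro mult_right_mono) (auto simp: eucl_norm_def L2_set_nonneg)
      also have "\<dots> \<le> \<bar>L\<bar> * coord_dist n x y"
        unfolding eucl_norm_def by (intro mult_left_mono L2_set_le_sum_abs) auto
      finally show ?thesis using L[of x y] by linarith
    qed
  qed (use B in auto)
next
  assume *: "bounded_lipschitz (coord_dist n) \<phi>"
  obtain B L where B: "\<And>x. \<bar>\<phi> x\<bar> \<le> B" and "0 \<le> L"
    and L: "\<And>x y. \<bar>\<phi> x - \<phi> y\<bar> \<le> L * coord_dist n x y"
    using bounded_lipschitzE[OF *] by metis
  have "\<bar>\<phi> x - \<phi> y\<bar> \<le> (L * n) * eucl_norm n (\<lambda>i. x i - y i)" for x y
  proof -
    have "\<bar>x i - y i\<bar> \<le> eucl_norm n (\<lambda>i. x i - y i)" if "i < n" for i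
      using member_le_L2_set[of "{..<n}" i "\<lambda>i. \<bar>x i - y i\<bar>"] that
      unfolding eucl_norm_def L2_set_def by simp
    then have "coord_dist n x y \<le> (\<Sum>i<n. eucl_norm n (\<lambda>i. x i - y i))"
      by (intro sum_mono) auto
    then have "L * coord_dist n x y \<le> L * (n * eucl_norm n (\<lambda>i. x i - y i))"
      using \<open>0 \<le> L\<close> by (intro mult_left_mono) auto
    then show ?thesis using L[of x y] by simp
  qed
  then show "\<phi> \<in> C_b_Lip n" using B unfolding C_b_Lip_def by blast
qed

lemma coord_dist_mono: "m \<le> n \<Longrightarrow> coord_dist m x y \<le> coord_dist n x y"
  by (intro sum_mono2) auto

lemma bounded_lipschitz_coord_mono:
  assumes "bounded_lipschitz (coord_dist m) \<phi>" and "m \<le> n"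
  shows "bounded_lipschitz (coord_dist n) \<phi>"
proof -
  obtain B L where B: "\<And>x. \<bar>\<phi> x\<bar> \<le> B" and "0 \<le> L"
    and L: "\<And>x y. \<bar>\<phi> x - \<phi> y\<bar> \<le> L * coord_dist m x y"
    using bounded_lipschitzE[OF assms(1)] by metis
  show ?thesis
  proof (rule bounded_lipschitzI[OF B \<open>0 \<le> L\<close>])
    show "\<bar>\<phi> x - \<phi> y\<bar> \<le> L * coord_dist n x y" for x y
      using L[of x y] mult_left_mono[OF coord_dist_mono[OF assms(2), of x y] \<open>0 \<le> L\<close>] by linarith
  qed
qed

lemma bounded_lipschitz_coord_sum:
  assumes "real_BL g" and "I \<subseteq> {..<n}"
  shows "bounded_lipschitz (coord_dist n) (\<lambda>x. g (\<Sum>i\<in>I. x i))"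
proof (rule bounded_lipschitz_compose[OF assms(1), where K = 1])
  show "\<bar>(\<Sum>i\<in>I. x i) - (\<Sum>i\<in>I. y i)\<bar> \<le> 1 * coord_dist n x y" for x y :: "nat \<Rightarrow> real"
  proof -
    have "\<bar>(\<Sum>i\<in>I. x i) - (\<Sum>i\<in>I. y i)\<bar> \<le> (\<Sum>i\<in>I. \<bar>x i - y i\<bar>)"
      by (simp add: sum_subtractf[symmetric])
    also have "\<dots> \<le> coord_dist n x y"
      using assms(2) by (intro sum_mono2) auto
    finally show ?thesis by simp
  qed
qed simp

lemma bounded_lipschitz_coord_local:
  assumes "bounded_lipschitz (coord_dist n) \<phi>" and "\<And>i. i < n \<Longrightarrow> x i = y i"
  shows "\<phi> x = \<phi> y"
proof -
  obtain L where "\<bar>\<phi> x - \<phi> y\<bar> \<le> L * coord_dist n x y"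
    using bounded_lipschitzE[OF assms(1)] by metis
  then show ?thesis using assms(2) by simp
qed

lemma C_b_Lip_imp_C_l_Lip:
  assumes "bounded_lipschitz (coord_dist n) \<phi>"
  shows "\<phi> \<in> C_l_Lip n"
proof -
  obtain L where L: "\<And>x y. \<bar>\<phi> x - \<phi> y\<bar> \<le> L * eucl_norm n (\<lambda>i. x i - y i)"
    using assms unfolding C_b_Lip_iff[symmetric] C_b_Lip_def by blast
  have bound: "\<bar>\<phi> x - \<phi> y\<bar>
      \<le> (\<bar>L\<bar> + 1) * (1 + eucl_norm n x ^ 0 + eucl_norm n y ^ 0) * eucl_norm n (\<lambda>i. x i - y i)"
    for x y
  proof -
    have "L * eucl_norm n (\<lambda>i. x i - y i) \<le> ((\<bar>L\<bar> + 1) * 3) * eucl_norm n (\<lambda>i. x i - y i)"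
      by (intro mult_right_mono) (auto simp: eucl_norm_def L2_set_nonneg)
    then show ?thesis using L[of x y] by simp
  qed
  moreover have "0 < \<bar>L\<bar> + 1" by simp
  ultimately show ?thesis
    unfolding C_l_Lip_def mem_Collect_eq by blast
qed

lemma lipschitz_coord_C_l_Lip:
  fixes h :: "real \<Rightarrow> real"
  assumes "\<And>x y. \<bar>h x - h y\<bar> \<le> K * \<bar>x - y\<bar>"
  shows "(\<lambda>v. h (v 0)) \<in> C_l_Lip 1"
proof -
  have norm: "eucl_norm 1 (\<lambda>i. x i - y i) = \<bar>x 0 - y 0\<bar>" for x y :: "nat \<Rightarrow> real"
  proof -
    have "{..<1 :: nat} = {0}" by auto
    then show ?thesis by (simp only: eucl_norm_def L2_set_def sum.insert) simp
  qed
  have bound: "\<bar>h (x 0) - h (y 0)\<bar>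
      \<le> (\<bar>K\<bar> + 1) * (1 + eucl_norm 1 x ^ 0 + eucl_norm 1 y ^ 0) * eucl_norm 1 (\<lambda>i. x i - y i)"
    for x y :: "nat \<Rightarrow> real"
  proof -
    have "K * \<bar>x 0 - y 0\<bar> \<le> ((\<bar>K\<bar> + 1) * (1 + 1 + 1)) * \<bar>x 0 - y 0\<bar>"
      by (intro mult_right_mono) auto
    then show ?thesis
      using assms[of "x 0" "y 0"] unfolding norm power_0 by linarith
  qed
  moreover have "0 < \<bar>K\<bar> + 1" by simp
  ultimately show ?thesis
    unfolding C_l_Lip_def mem_Collect_eq by blast
qed

section \<open>Bounded random variables and the capacity\<close>

context sublinear_expectation_space
begin

abbreviation R :: "('a \<Rightarrow> real) \<Rightarrow> real" where
  "R f \<equiv> real_of_ereal (E f)"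

abbreviation V :: "'a set \<Rightarrow> ereal" where
  "V \<equiv> upper_capacity M H E"

text \<open>On these variables \<open>E\<close> is finite, so that \<open>R\<close> loses no information.\<close>

definition bounded_rv :: "('a \<Rightarrow> real) set" where
  "bounded_rv = {f \<in> H. \<exists>K. \<forall>\<omega>. \<bar>f \<omega>\<bar> \<le> K}"

lemma H_bounded_lipschitz:
  assumes "bounded_lipschitz (coord_dist n) \<phi>" and "\<And>i. i < n \<Longrightarrow> X i \<in> H"
  shows "(\<lambda>\<omega>. \<phi> (\<lambda>i. X i \<omega>)) \<in> bounded_rv"
proof -
  obtain B where "\<And>x. \<bar>\<phi> x\<bar> \<le> B" using bounded_lipschitzE[OF assms(1)] by metis
  moreover have "(\<lambda>\<omega>. \<phi> (\<lambda>i. X i \<omega>)) \<in> H"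
    by (rule H_Lip[where X = X, OF C_b_Lip_imp_C_l_Lip[OF assms(1)] assms(2)])
  ultimately show ?thesis unfolding bounded_rv_def by blast
qed

lemma H_const: "(\<lambda>_. c) \<in> H"
  using H_bounded_lipschitz[of 0 "\<lambda>_. c" "\<lambda>_. undefined"] bounded_lipschitz_const
  unfolding bounded_rv_def by blast

lemma H_lipschitz_comp:
  assumes "f \<in> H" and "\<And>x y. \<bar>h x - h y\<bar> \<le> K * \<bar>x - y\<bar>"
  shows "(\<lambda>\<omega>. h (f \<omega>)) \<in> H"
  using H_Lip[OF lipschitz_coord_C_l_Lip[OF assms(2)], of "\<lambda>_. f"] assms(1) by simp

lemma bounded_rv_H: "f \<in> bounded_rv \<Longrightarrow> f \<in> H"
  unfolding bounded_rv_def by simp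

lemma bounded_rvI: "f \<in> H \<Longrightarrow> (\<And>\<omega>. \<bar>f \<omega>\<bar> \<le> K) \<Longrightarrow> f \<in> bounded_rv"
  unfolding bounded_rv_def by blast

lemma bounded_rvE:
  assumes "f \<in> bounded_rv"
  obtains K where "f \<in> H" and "0 \<le> K" and "\<And>\<omega>. \<bar>f \<omega>\<bar> \<le> K"
proof -
  obtain K where K: "f \<in> H" "\<And>\<omega>. \<bar>f \<omega>\<bar> \<le> K"
    using assms unfolding bounded_rv_def by blast
  moreover have "0 \<le> K" using K(2) abs_ge_zero order_trans by blast
  ultimately show thesis using that by blast
qed

lemma bounded_rv_const: "(\<lambda>_. c) \<in> bounded_rv"
  by (rule bounded_rvI[where K = "\<bar>c\<bar>"]) (auto simp: H_const)

lemma bounded_rv_add: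
  assumes "f \<in> bounded_rv" and "g \<in> bounded_rv"
  shows "(\<lambda>\<omega>. f \<omega> + g \<omega>) \<in> bounded_rv"
proof -
  obtain K where f: "f \<in> H" "\<And>\<omega>. \<bar>f \<omega>\<bar> \<le> K" using bounded_rvE[OF assms(1)] by metis
  obtain L where g: "g \<in> H" "\<And>\<omega>. \<bar>g \<omega>\<bar> \<le> L" using bounded_rvE[OF assms(2)] by metis
  show ?thesis
  proof (rule bounded_rvI)
    show "\<bar>f \<omega> + g \<omega>\<bar> \<le> K + L" for \<omega> using f(2)[of \<omega>] g(2)[of \<omega>] by linarith
  qed (rule H_add[OF f(1) g(1)])
qed

lemma bounded_rv_scale:
  assumes "f \<in> bounded_rv"
  shows "(\<lambda>\<omega>. a * f \<omega>) \<in> bounded_rv"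
proof -
  obtain K where f: "f \<in> H" "\<And>\<omega>. \<bar>f \<omega>\<bar> \<le> K" using bounded_rvE[OF assms] by metis
  show ?thesis
  proof (rule bounded_rvI)
    show "\<bar>a * f \<omega>\<bar> \<le> \<bar>a\<bar> * K" for \<omega> unfolding abs_mult by (intro mult_left_mono f) auto
  qed (rule H_scale[OF f(1)])
qed

lemma bounded_rv_uminus: "f \<in> bounded_rv \<Longrightarrow> (\<lambda>\<omega>. - f \<omega>) \<in> bounded_rv"
  using bounded_rv_scale[of f "- 1"] by simp

lemma bounded_rv_diff:
  "f \<in> bounded_rv \<Longrightarrow> g \<in> bounded_rv \<Longrightarrow> (\<lambda>\<omega>. f \<omega> - g \<omega>) \<in> bounded_rv"
  using bounded_rv_add[OF _ bounded_rv_uminus, of f g] by simp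

lemma bounded_rv_sum:
  "(\<And>i. i \<in> I \<Longrightarrow> f i \<in> bounded_rv) \<Longrightarrow> (\<lambda>\<omega>. \<Sum>i\<in>I. f i \<omega>) \<in> bounded_rv"
  by (induction I rule: infinite_finite_induct) (auto intro: bounded_rv_const bounded_rv_add)

lemma bounded_rv_real_BL:
  assumes "real_BL g" and "f \<in> H"
  shows "(\<lambda>\<omega>. g (f \<omega>)) \<in> bounded_rv"
proof -
  have "bounded_lipschitz (coord_dist 1) (\<lambda>v. g (\<Sum>i\<in>{0}. v i))"
    by (rule bounded_lipschitz_coord_sum[OF assms(1)]) auto
  from H_bounded_lipschitz[OF this, of "\<lambda>_. f"] assms(2) show ?thesis by simp
qed

lemma E_eq_R:
  assumes "f \<in> bounded_rv"
  shows "E f = ereal (R f)"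
proof -
  obtain K where f: "f \<in> H" "\<And>\<omega>. \<bar>f \<omega>\<bar> \<le> K" using bounded_rvE[OF assms] by metis
  have "E f \<le> E (\<lambda>_. K)" and "E (\<lambda>_. - K) \<le> E f"
    using f by (auto intro!: E_mono H_const simp: abs_le_iff minus_le_iff)
  then show ?thesis
    unfolding E_const by (cases "E f") auto
qed

lemma R_const: "R (\<lambda>_. c) = c"
  by (simp add: E_const)

lemma R_mono:
  assumes "f \<in> bounded_rv" and "g \<in> bounded_rv" and "\<And>\<omega>. \<omega> \<in> space M \<Longrightarrow> f \<omega> \<le> g \<omega>"
  shows "R f \<le> R g"
  using E_mono[OF bounded_rv_H[OF assms(2)] bounded_rv_H[OF assms(1)] assms(3)]
    E_eq_R[OF assms(1)] E_eq_R[OF assms(2)] by (metis ereal_less_eq(3))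

lemma R_le_const: "f \<in> bounded_rv \<Longrightarrow> (\<And>\<omega>. \<omega> \<in> space M \<Longrightarrow> f \<omega> \<le> c) \<Longrightarrow> R f \<le> c"
  using R_mono[of f "\<lambda>_. c"] R_const bounded_rv_const by simp

lemma const_le_R: "f \<in> bounded_rv \<Longrightarrow> (\<And>\<omega>. \<omega> \<in> space M \<Longrightarrow> c \<le> f \<omega>) \<Longrightarrow> c \<le> R f"
  using R_mono[of "\<lambda>_. c" f] R_const bounded_rv_const by simp

lemma R_add:
  assumes "f \<in> bounded_rv" and "g \<in> bounded_rv"
  shows "R (\<lambda>\<omega>. f \<omega> + g \<omega>) \<le> R f + R g"
proof -
  obtain a b c where abc: "E f = ereal a" "E g = ereal b" "E (\<lambda>\<omega>. f \<omega> + g \<omega>) = ereal c"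
    using E_eq_R assms bounded_rv_add by blast
  then show ?thesis
    using E_subadd[OF bounded_rv_H[OF assms(1)] bounded_rv_H[OF assms(2)]] by simp
qed

lemma R_scale:
  assumes "f \<in> bounded_rv" and "0 \<le> a"
  shows "R (\<lambda>\<omega>. a * f \<omega>) = a * R f"
  using E_scale[OF bounded_rv_H[OF assms(1)] assms(2)] by simp

lemma R_uminus_le:
  assumes "f \<in> bounded_rv"
  shows "- R (\<lambda>\<omega>. - f \<omega>) \<le> R f"
  using R_add[OF assms bounded_rv_uminus[OF assms]] R_const[of 0] by simp

lemma R_translate:
  assumes "f \<in> bounded_rv"
  shows "R (\<lambda>\<omega>. c + f \<omega>) = c + R f"
proof (rule antisym)
  show "R (\<lambda>\<omega>. c + f \<omega>) \<le> c + R f"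
    using R_add[OF bounded_rv_const assms, of c] by (simp add: R_const)
  show "c + R f \<le> R (\<lambda>\<omega>. c + f \<omega>)"
    using R_add[OF bounded_rv_const bounded_rv_add[OF bounded_rv_const assms], of "- c" c]
    by (simp add: R_const)
qed

lemma R_sum_le:
  assumes "\<And>i. i \<in> I \<Longrightarrow> f i \<in> bounded_rv"
  shows "R (\<lambda>\<omega>. \<Sum>i\<in>I. f i \<omega>) \<le> (\<Sum>i\<in>I. R (f i))"
  using assms
proof (induction I rule: infinite_finite_induct)
  case (insert j I)
  have "R (\<lambda>\<omega>. f j \<omega> + (\<Sum>i\<in>I. f i \<omega>)) \<le> R (f j) + R (\<lambda>\<omega>. \<Sum>i\<in>I. f i \<omega>)"
    using insert by (intro R_add bounded_rv_sum) auto
  then show ?case using insert by (auto intro: order_trans)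
qed (auto simp: R_const)

lemma capacity_le_E:
  assumes "\<xi> \<in> H" and "\<And>\<omega>. \<omega> \<in> space M \<Longrightarrow> indicator A \<omega> \<le> \<xi> \<omega>"
  shows "V A \<le> E \<xi>"
  unfolding upper_capacity_def using assms by (intro Inf_lower) auto

lemma capacity_le_R:
  assumes "\<xi> \<in> bounded_rv" and "\<And>\<omega>. \<omega> \<in> space M \<Longrightarrow> indicator A \<omega> \<le> \<xi> \<omega>"
  shows "V A \<le> ereal (R \<xi>)"
  using capacity_le_E[OF bounded_rv_H[OF assms(1)] assms(2)] E_eq_R[OF assms(1)] by metis

lemma capacity_nonneg: "0 \<le> V A"
  unfolding upper_capacity_def
proof (rule Inf_greatest, clarify)
  fix \<xi> assume "\<xi> \<in> H" and "\<forall>\<omega>\<in>space M. indicator A \<omega> \<le> \<xi> \<omega>"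
  then have "E (\<lambda>_. 0) \<le> E \<xi>"
    by (intro E_mono H_const) (auto intro: order_trans[OF indicator_pos_le])
  then show "0 \<le> E \<xi>" by (simp add: E_const zero_ereal_def)
qed

lemma capacity_le_1: "V A \<le> 1"
  using capacity_le_E[OF H_const, of A 1] by (simp add: E_const one_ereal_def indicator_le_1)

lemma capacity_real: "V A = ereal (real_of_ereal (V A))"
  using capacity_nonneg[of A] capacity_le_1[of A] by (cases "V A") auto

lemma capacity_less_obtain:
  assumes "V A < x"
  obtains \<xi> where "\<xi> \<in> H" and "\<And>\<omega>. \<omega> \<in> space M \<Longrightarrow> indicator A \<omega> \<le> \<xi> \<omega>" and "E \<xi> < x"
  using assms unfolding upper_capacity_def Inf_less_iff by blast

lemma capacity_empty: "V {} = 0"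
  using capacity_le_E[OF H_const, of "{}" 0] capacity_nonneg[of "{}"]
  by (simp add: E_const zero_ereal_def)

lemma capacity_subadd:
  assumes "\<And>\<omega>. \<omega> \<in> space M \<Longrightarrow> \<omega> \<in> A \<Longrightarrow> \<omega> \<in> B \<or> \<omega> \<in> C"
  shows "V A \<le> V B + V C"
proof (rule ereal_le_epsilon2)
  fix e :: real assume "0 < e"
  define b where "b = real_of_ereal (V B)"
  define c where "c = real_of_ereal (V C)"
  have b: "V B = ereal b" and c: "V C = ereal c"
    unfolding b_def c_def by (rule capacity_real)+
  obtain \<xi> where \<xi>: "\<xi> \<in> H" "\<And>\<omega>. \<omega> \<in> space M \<Longrightarrow> indicator B \<omega> \<le> \<xi> \<omega>" "E \<xi> < ereal (b + e / 2)"
    using capacity_less_obtain[of B "ereal (b + e / 2)"] b \<open>0 < e\<close> by auto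
  obtain \<eta> where \<eta>: "\<eta> \<in> H" "\<And>\<omega>. \<omega> \<in> space M \<Longrightarrow> indicator C \<omega> \<le> \<eta> \<omega>" "E \<eta> < ereal (c + e / 2)"
    using capacity_less_obtain[of C "ereal (c + e / 2)"] c \<open>0 < e\<close> by auto
  have nonneg: "0 \<le> E \<xi>" "0 \<le> E \<eta>"
    using capacity_le_E[OF \<xi>(1,2)] capacity_le_E[OF \<eta>(1,2)] capacity_nonneg order_trans by blast+
  have "indicator A \<omega> \<le> \<xi> \<omega> + \<eta> \<omega>" if "\<omega> \<in> space M" for \<omega>
  proof -
    have "indicator A \<omega> \<le> (indicator B \<omega> + indicator C \<omega> :: real)"
      using assms[OF that] by (auto simp: indicator_def)
    then show ?thesis using \<xi>(2)[OF that] \<eta>(2)[OF that] by linarith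
  qed
  then have "V A \<le> E (\<lambda>\<omega>. \<xi> \<omega> + \<eta> \<omega>)"
    by (intro capacity_le_E H_add \<xi> \<eta>)
  also have "\<dots> \<le> E \<xi> + E \<eta>"
    using nonneg by (intro E_subadd \<xi> \<eta>) auto
  also have "\<dots> \<le> ereal (b + e / 2) + ereal (c + e / 2)"
    using \<xi>(3) \<eta>(3) by (intro add_mono) auto
  finally show "V A \<le> V B + V C + ereal e" unfolding b c by (simp add: ac_simps)
qed

lemma capacity_UN_le:
  assumes "finite I"
  shows "V (\<Union>i\<in>I. A i) \<le> (\<Sum>i\<in>I. V (A i))"
  using assms
proof (induction I)
  case (insert j I)
  have "V (\<Union>i\<in>insert j I. A i) \<le> V (A j) + V (\<Union>i\<in>I. A i)"
    by (rule capacity_subadd) auto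
  also have "\<dots> \<le> V (A j) + (\<Sum>i\<in>I. V (A i))"
    by (intro add_left_mono insert.IH)
  finally show ?case using insert by simp
qed (simp add: capacity_empty)

text \<open>
  The converse direction of \<open>capacity_le_R\<close>: smallness in capacity bounds expectations. The strict
  bound on the capacity provides one dominating variable, which replaces the indicator of \<open>A\<close>.
\<close>

lemma R_le_capacity:
  assumes "f \<in> bounded_rv" and "0 \<le> b" and "V A < ereal \<delta>"
    and "\<And>\<omega>. \<omega> \<in> space M \<Longrightarrow> f \<omega> \<le> a + b * indicator A \<omega>"
  shows "R f \<le> a + b * \<delta>"
proof -
  obtain \<xi> where \<xi>: "\<xi> \<in> H" "\<And>\<omega>. \<omega> \<in> space M \<Longrightarrow> indicator A \<omega> \<le> \<xi> \<omega>" "E \<xi> < ereal \<delta>"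
    using capacity_less_obtain[OF assms(3)] by metis
  have nonneg: "0 \<le> E \<xi>"
    using capacity_le_E[OF \<xi>(1,2)] capacity_nonneg order_trans by blast
  have "f \<omega> \<le> a + b * \<xi> \<omega>" if "\<omega> \<in> space M" for \<omega>
    using assms(4)[OF that] mult_left_mono[OF \<xi>(2)[OF that] assms(2)] by linarith
  then have "E f \<le> E (\<lambda>\<omega>. a + b * \<xi> \<omega>)"
    by (intro E_mono H_add[OF H_const H_scale] \<xi> bounded_rv_H[OF assms(1)])
  also have "\<dots> \<le> E (\<lambda>_. a) + E (\<lambda>\<omega>. b * \<xi> \<omega>)"
    by (rule E_subadd[OF H_const H_scale[OF \<xi>(1)]])
       (use nonneg assms(2) in \<open>auto simp: E_const E_scale[OF \<xi>(1)]\<close>)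
  also have "\<dots> = ereal a + ereal b * E \<xi>"
    using assms(2) by (simp add: E_const E_scale[OF \<xi>(1)])
  also have "\<dots> \<le> ereal a + ereal b * ereal \<delta>"
    using \<xi>(3) assms(2) by (intro add_left_mono ereal_mult_left_mono) auto
  finally have "E f \<le> ereal (a + b * \<delta>)" by simp
  then show ?thesis using E_eq_R[OF assms(1)] by (metis ereal_less_eq(3))
qed

end

section \<open>Functionals dominated by a sub-linear expectation\<close>

lemma cos_le_quadratic:
  fixes u :: real
  assumes "\<bar>u\<bar> \<le> 3"
  shows "cos u \<le> 1 - u\<^sup>2 / 8"
proof -
  define x where "x = \<bar>u\<bar> / 2"
  have x: "0 \<le> x" "x \<le> 3 / 2" using assms by (auto simp: x_def)
  have "\<bar>sin x - (\<Sum>m<3. sin_coeff m * x ^ m)\<bar> \<le> inverse (fact 3) * \<bar>x\<bar> ^ 3"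
    by (rule Maclaurin_sin_bound)
  then have "\<bar>sin x - x\<bar> \<le> x * x\<^sup>2 / 6"
    using x by (simp add: sin_coeff_def eval_nat_numeral fact_numeral)
  moreover have "x * x\<^sup>2 \<le> x * (3 / 2)\<^sup>2"
    using x by (intro mult_left_mono power_mono) auto
  moreover have "x * (3 / 2)\<^sup>2 = x * 9 / 4"
    by (simp add: power2_eq_square)
  ultimately have "x / 2 \<le> sin x"
    using x by linarith
  then have "(x / 2)\<^sup>2 \<le> (sin x)\<^sup>2"
    using x by (intro power_mono) auto
  moreover have "cos u = 1 - 2 * (sin x)\<^sup>2"
  proof -
    have "cos u = cos (2 * x)" unfolding x_def by simp
    then show ?thesis unfolding cos_double sin_squared_eq by simp
  qed
  ultimately show ?thesis by (simp add: x_def power2_eq_square)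
qed

context sublinear_expectation_space
begin

definition dominated_sublinear :: "(('a \<Rightarrow> real) \<Rightarrow> real) \<Rightarrow> bool" where
  "dominated_sublinear q \<longleftrightarrow>
     (\<forall>f\<in>bounded_rv. q f \<le> R f) \<and>
     (\<forall>f\<in>bounded_rv. \<forall>g\<in>bounded_rv. q (\<lambda>\<omega>. f \<omega> + g \<omega>) \<le> q f + q g) \<and>
     (\<forall>f\<in>bounded_rv. \<forall>a\<ge>0. q (\<lambda>\<omega>. a * f \<omega>) = a * q f)"

abbreviation linear_at :: "(('a \<Rightarrow> real) \<Rightarrow> real) \<Rightarrow> ('a \<Rightarrow> real) \<Rightarrow> bool" where
  "linear_at q v \<equiv> q (\<lambda>\<omega>. - v \<omega>) = - q v"

lemma dominated_sublinear_R: "dominated_sublinear R"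
  unfolding dominated_sublinear_def using R_add R_scale by auto

context
  fixes q
  assumes q: "dominated_sublinear q"
begin

lemma dominated_le_R: "f \<in> bounded_rv \<Longrightarrow> q f \<le> R f"
  using q unfolding dominated_sublinear_def by blast

lemma dominated_add:
  "f \<in> bounded_rv \<Longrightarrow> g \<in> bounded_rv \<Longrightarrow> q (\<lambda>\<omega>. f \<omega> + g \<omega>) \<le> q f + q g"
  using q unfolding dominated_sublinear_def by blast

lemma dominated_scale: "f \<in> bounded_rv \<Longrightarrow> 0 \<le> a \<Longrightarrow> q (\<lambda>\<omega>. a * f \<omega>) = a * q f"
  using q unfolding dominated_sublinear_def by blast

lemma dominated_zero: "q (\<lambda>_. 0) = 0"
  using dominated_scale[OF bounded_rv_const, of 0 0] by simp

lemma dominated_uminus_ge: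
  assumes "f \<in> bounded_rv"
  shows "- q f \<le> q (\<lambda>\<omega>. - f \<omega>)"
  using dominated_add[OF assms bounded_rv_uminus[OF assms]] dominated_zero by simp

lemma dominated_const: "q (\<lambda>_. c) = c"
  using dominated_le_R[OF bounded_rv_const, of c] dominated_le_R[OF bounded_rv_const, of "- c"]
    dominated_uminus_ge[OF bounded_rv_const, of c]
  by (simp add: R_const)

lemma dominated_mono:
  assumes "f \<in> bounded_rv" and "g \<in> bounded_rv" and "\<And>\<omega>. f \<omega> \<le> g \<omega>"
  shows "q f \<le> q g"
proof -
  have "q (\<lambda>\<omega>. g \<omega> + (f \<omega> - g \<omega>)) \<le> q g + q (\<lambda>\<omega>. f \<omega> - g \<omega>)"
    by (intro dominated_add bounded_rv_diff assms)
  moreover have "q (\<lambda>\<omega>. f \<omega> - g \<omega>) \<le> 0"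
    by (rule order_trans[OF dominated_le_R R_le_const]) (use assms bounded_rv_diff in auto)
  ultimately show ?thesis by simp
qed

lemma linear_at_add_scaled:
  assumes "v \<in> bounded_rv" and "linear_at q v" and "f \<in> bounded_rv"
  shows "q (\<lambda>\<omega>. f \<omega> + a * v \<omega>) = q f + a * q v"
proof -
  have scale: "q (\<lambda>\<omega>. b * v \<omega>) = b * q v" for b
  proof (cases "0 \<le> b")
    case False
    have "q (\<lambda>\<omega>. (- b) * (- v \<omega>)) = (- b) * q (\<lambda>\<omega>. - v \<omega>)"
      using False by (intro dominated_scale bounded_rv_uminus assms) auto
    then show ?thesis using assms(2) by simp
  qed (use dominated_scale assms in auto)
  have "q (\<lambda>\<omega>. f \<omega> + a * v \<omega>) \<le> q f + q (\<lambda>\<omega>. a * v \<omega>)"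
    by (intro dominated_add bounded_rv_scale assms)
  moreover have "q (\<lambda>\<omega>. (f \<omega> + a * v \<omega>) + (- a) * v \<omega>) \<le> q (\<lambda>\<omega>. f \<omega> + a * v \<omega>) + q (\<lambda>\<omega>. (- a) * v \<omega>)"
    by (intro dominated_add bounded_rv_add bounded_rv_scale assms)
  ultimately show ?thesis using scale[of a] scale[of "- a"] by simp
qed

text \<open>
  This is the one-dimensional step of the Hahn-Banach theorem. Minimising over the nonnegative
  multiples of \<open>v\<close> that are added to \<open>f\<close>, at the price \<open>q v\<close> each, keeps the functional sub-linear and
  makes it linear along \<open>v\<close>.
\<close>

lemma dominated_linearize_at:
  assumes v: "v \<in> bounded_rv"
  obtains q' where "dominated_sublinear q'" and "\<And>f. f \<in> bounded_rv \<Longrightarrow> q' f \<le> q f"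
    and "q' v = q v" and "linear_at q' v"
proof -
  \<comment> \<open>The correction \<open>- t * q v\<close> makes \<open>T v\<close> constant in \<open>t\<close>, while \<open>t = 1\<close> gives \<open>- q v\<close> at \<open>- v\<close>.\<close>
  define T where "T f t = q (\<lambda>\<omega>. f \<omega> + t * v \<omega>) - t * q v" for f and t :: real
  define q' where "q' f = (INF t\<in>{0..}. T f t)" for f
  have T_ge: "- q (\<lambda>\<omega>. - f \<omega>) \<le> T f t" if f: "f \<in> bounded_rv" and "0 \<le> t" for f t
  proof -
    have "q (\<lambda>\<omega>. (f \<omega> + t * v \<omega>) + - f \<omega>) \<le> q (\<lambda>\<omega>. f \<omega> + t * v \<omega>) + q (\<lambda>\<omega>. - f \<omega>)"
      by (intro dominated_add bounded_rv_add bounded_rv_scale bounded_rv_uminus f v)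
    then show ?thesis
      using dominated_scale[OF v \<open>0 \<le> t\<close>] by (simp add: T_def)
  qed
  then have bdd: "bdd_below (T f ` {0..})" if "f \<in> bounded_rv" for f
    using that by (intro bdd_belowI2) auto
  have le_T: "q' f \<le> T f t" if "f \<in> bounded_rv" and "0 \<le> t" for f t
    unfolding q'_def using that by (intro cINF_lower bdd) auto
  have q'_greatest: "x \<le> q' f" if "\<And>t. 0 \<le> t \<Longrightarrow> x \<le> T f t" for x f
    unfolding q'_def using that by (intro cINF_greatest) auto
  have le_q: "q' f \<le> q f" if "f \<in> bounded_rv" for f
    using le_T[OF that, of 0] by (simp add: T_def)
  have add: "q' (\<lambda>\<omega>. f \<omega> + g \<omega>) \<le> q' f + q' g"
    if f: "f \<in> bounded_rv" and g: "g \<in> bounded_rv" for f g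
  proof -
    have *: "q' (\<lambda>\<omega>. f \<omega> + g \<omega>) \<le> T f s + T g t" if "0 \<le> s" and "0 \<le> t" for s t
    proof -
      have "q (\<lambda>\<omega>. (f \<omega> + s * v \<omega>) + (g \<omega> + t * v \<omega>))
          \<le> q (\<lambda>\<omega>. f \<omega> + s * v \<omega>) + q (\<lambda>\<omega>. g \<omega> + t * v \<omega>)"
        by (intro dominated_add bounded_rv_add bounded_rv_scale f g v)
      then have "T (\<lambda>\<omega>. f \<omega> + g \<omega>) (s + t) \<le> T f s + T g t"
        by (simp add: T_def algebra_simps)
      then show ?thesis
        using le_T[OF bounded_rv_add[OF f g], of "s + t"] that by simp
    qed
    have "q' (\<lambda>\<omega>. f \<omega> + g \<omega>) - T f s \<le> q' g" if "0 \<le> s" for s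
      using *[OF that] by (intro q'_greatest) (simp add: algebra_simps)
    then have "q' (\<lambda>\<omega>. f \<omega> + g \<omega>) - q' g \<le> q' f"
      by (intro q'_greatest) (simp add: algebra_simps)
    then show ?thesis by simp
  qed
  have scale_ge: "a * q' f \<le> q' (\<lambda>\<omega>. a * f \<omega>)" if f: "f \<in> bounded_rv" and "0 < a" for f a
  proof (rule q'_greatest)
    fix t :: real assume "0 \<le> t"
    have "q (\<lambda>\<omega>. a * (f \<omega> + t / a * v \<omega>)) = a * q (\<lambda>\<omega>. f \<omega> + t / a * v \<omega>)"
      using \<open>0 < a\<close> by (intro dominated_scale bounded_rv_add bounded_rv_scale f v) auto
    then have "T (\<lambda>\<omega>. a * f \<omega>) t = a * T f (t / a)"
      using \<open>0 < a\<close> by (simp add: T_def algebra_simps)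
    moreover have "q' f \<le> T f (t / a)"
      using \<open>0 \<le> t\<close> \<open>0 < a\<close> by (intro le_T f) auto
    ultimately show "a * q' f \<le> T (\<lambda>\<omega>. a * f \<omega>) t"
      using \<open>0 < a\<close> by simp
  qed
  have "T (\<lambda>_. 0) t = 0" if "0 \<le> t" for t
    using dominated_scale[OF v that] by (simp add: T_def)
  then have zero: "q' (\<lambda>_. 0) = 0"
    using le_T[OF bounded_rv_const, of 0 0] by (intro antisym q'_greatest) auto
  have scale: "q' (\<lambda>\<omega>. a * f \<omega>) = a * q' f" if f: "f \<in> bounded_rv" and "0 \<le> a" for f a
  proof (cases "a = 0")
    case False
    then have "0 < a" using \<open>0 \<le> a\<close> by simp
    have "(1 / a) * q' (\<lambda>\<omega>. a * f \<omega>) \<le> q' (\<lambda>\<omega>. (1 / a) * (a * f \<omega>))"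
      using \<open>0 < a\<close> by (intro scale_ge bounded_rv_scale f) auto
    then have "q' (\<lambda>\<omega>. a * f \<omega>) \<le> a * q' f"
      using \<open>0 < a\<close> by (simp add: field_simps)
    then show ?thesis using scale_ge[OF f \<open>0 < a\<close>] by simp
  qed (simp add: zero)
  have "T v t = q v" if "0 \<le> t" for t
  proof -
    have "q (\<lambda>\<omega>. v \<omega> + t * v \<omega>) = q (\<lambda>\<omega>. (1 + t) * v \<omega>)" by (simp add: algebra_simps)
    then show ?thesis
      using dominated_scale[OF v, of "1 + t"] that by (simp add: T_def algebra_simps)
  qed
  then have at_v: "q' v = q v"
    using le_q[OF v] by (intro antisym q'_greatest) auto
  have "q' (\<lambda>\<omega>. - v \<omega>) \<le> - q' v"
    using le_T[OF bounded_rv_uminus[OF v], of 1] dominated_zero at_v by (simp add: T_def)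
  moreover have "- q' v \<le> q' (\<lambda>\<omega>. - v \<omega>)"
    using add[OF v bounded_rv_uminus[OF v]] zero by simp
  ultimately have linear: "linear_at q' v" by simp
  have "dominated_sublinear q'"
    unfolding dominated_sublinear_def
    using le_q dominated_le_R add scale by (blast intro: order_trans)
  then show thesis using that le_q at_v linear by blast
qed

end

lemma linear_at_dominated:
  assumes "dominated_sublinear q'" and "\<And>f. f \<in> bounded_rv \<Longrightarrow> q' f \<le> q f"
    and "v \<in> bounded_rv" and "linear_at q v"
  shows "q' v = q v" and "linear_at q' v"
  using assms(2)[OF assms(3)] assms(2)[OF bounded_rv_uminus[OF assms(3)]] assms(4)
    dominated_uminus_ge[OF assms(1,3)] by auto

lemma dominated_linearize_list:
  assumes "dominated_sublinear q" and "set vs \<subseteq> bounded_rv"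
  shows "\<exists>q'. dominated_sublinear q' \<and> (\<forall>f\<in>bounded_rv. q' f \<le> q f) \<and> (\<forall>v\<in>set vs. linear_at q' v)"
  using assms
proof (induction vs arbitrary: q)
  case (Cons v vs)
  obtain q1 where q1: "dominated_sublinear q1" "\<And>f. f \<in> bounded_rv \<Longrightarrow> q1 f \<le> q f" "linear_at q1 v"
  proof -
    have "v \<in> bounded_rv" using Cons.prems(2) by simp
    from dominated_linearize_at[OF Cons.prems(1) this] that show thesis by metis
  qed
  obtain q2 where q2: "dominated_sublinear q2" "\<And>f. f \<in> bounded_rv \<Longrightarrow> q2 f \<le> q1 f"
      "\<And>w. w \<in> set vs \<Longrightarrow> linear_at q2 w"
    using Cons.IH[OF q1(1)] Cons.prems(2) by auto
  have "linear_at q2 v"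
    using linear_at_dominated(2)[OF q2(1,2) _ q1(3)] Cons.prems(2) by simp
  then show ?case
    using q1(2) q2 by (intro exI[of _ q2]) (auto intro: order_trans)
qed auto

text \<open>
  Linearising along finitely many directions replaces the Hahn-Banach theorem: a sub-linear
  expectation acts at \<open>v\<close> like some functional that is linear on a prescribed finite set.
\<close>

lemma extremal_functional:
  assumes "v \<in> bounded_rv" and "set vs \<subseteq> bounded_rv"
  obtains q where "dominated_sublinear q" and "q v = R v" and "\<forall>w\<in>set vs. linear_at q w"
proof -
  obtain q1 where q1: "dominated_sublinear q1" "q1 v = R v" "linear_at q1 v"
    using dominated_linearize_at[OF dominated_sublinear_R assms(1)] by metis
  obtain q2 where q2: "dominated_sublinear q2" "\<forall>f\<in>bounded_rv. q2 f \<le> q1 f" "\<forall>w\<in>set vs. linear_at q2 w"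
    using dominated_linearize_list[OF q1(1) assms(2)] by blast
  then have "q2 v = R v"
    using linear_at_dominated(1)[OF q2(1) _ assms(1) q1(3)] q1(2) by simp
  then show thesis using that q2 by blast
qed

text \<open>
  For such a functional \<open>q\<close> with mean \<open>\<mu> = q Y\<close> and variance \<open>\<sigma>\<close>, the number
  \<open>q (cos (t * Y)) + \<i> * q (sin (t * Y)) = \<rho> * exp (\<i> * \<alpha>)\<close> is its characteristic function at
  \<open>t\<close>. Its modulus is \<open>\<rho> = q (cos (t * Y - \<alpha>))\<close>, and the quadratic bound for the cosine gives
  \<open>\<rho> \<le> 1 - t\<^sup>2 * q ((Y - \<alpha> / t)\<^sup>2) / 8\<close>, where the second moment about any point is at least the
  variance. The bound \<open>t * c \<le> 1 / 2\<close> keeps \<open>t * Y - \<alpha>\<close> in the range of the quadratic bound.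
\<close>

lemma extremal_moments:
  assumes Y: "Y \<in> H" "\<And>\<omega>. \<bar>Y \<omega>\<bar> \<le> c" and t: "0 < t" "t * c \<le> 1 / 2"
  obtains \<mu> \<sigma> \<rho> \<alpha> where "R (\<lambda>\<omega>. a * (Y \<omega>)\<^sup>2 + b * Y \<omega>) = a * (\<sigma> + \<mu>\<^sup>2) + b * \<mu>"
    and "0 \<le> \<sigma>" and "0 \<le> \<rho>" and "\<rho> \<le> 1 - t\<^sup>2 * \<sigma> / 8"
    and "- R (\<lambda>\<omega>. - Y \<omega>) \<le> \<mu>" and "\<mu> \<le> R Y"
    and "\<And>\<theta>. 1 - \<rho> * cos (\<theta> + \<alpha>) \<le> R (\<lambda>\<omega>. 1 - cos (\<theta> + t * Y \<omega>))"
    and "\<And>s. - s\<^sup>2 - \<sigma> \<le> R (\<lambda>\<omega>. - (s + Y \<omega> - \<mu>)\<^sup>2)"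
proof -
  have Y1: "Y \<in> bounded_rv" by (rule bounded_rvI[OF Y])
  have "(\<lambda>\<omega>. (clamp c (Y \<omega>))\<^sup>2) \<in> bounded_rv"
    by (rule bounded_rv_real_BL[OF bounded_lipschitz_power[OF real_BL_clamp] Y(1)])
  then have Y2: "(\<lambda>\<omega>. (Y \<omega>)\<^sup>2) \<in> bounded_rv"
    using Y(2) by (simp add: clamp_id)
  have cosY: "(\<lambda>\<omega>. cos (\<theta> + t * Y \<omega>)) \<in> bounded_rv" for \<theta>
    by (rule bounded_rv_real_BL[OF real_BL_cos Y(1)])
  have cosY0: "(\<lambda>\<omega>. cos (t * Y \<omega>)) \<in> bounded_rv"
    using cosY[of 0] by simp
  have sinY: "(\<lambda>\<omega>. sin (t * Y \<omega>)) \<in> bounded_rv"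
    by (rule bounded_rv_real_BL[OF real_BL_sin Y(1)])
  have quad: "(\<lambda>\<omega>. k + a * (Y \<omega>)\<^sup>2 + b * Y \<omega>) \<in> bounded_rv" for k a b
    by (intro bounded_rv_add bounded_rv_scale bounded_rv_const Y1 Y2)
  have quad0: "(\<lambda>\<omega>. a * (Y \<omega>)\<^sup>2 + b * Y \<omega>) \<in> bounded_rv"
    by (intro bounded_rv_add bounded_rv_scale Y1 Y2)
  define vs where "vs = [Y, \<lambda>\<omega>. (Y \<omega>)\<^sup>2, \<lambda>\<omega>. cos (t * Y \<omega>), \<lambda>\<omega>. sin (t * Y \<omega>)]"
  have "set vs \<subseteq> bounded_rv"
    using Y1 Y2 cosY0 sinY by (simp add: vs_def)
  then obtain q where q: "dominated_sublinear q"
      "q (\<lambda>\<omega>. a * (Y \<omega>)\<^sup>2 + b * Y \<omega>) = R (\<lambda>\<omega>. a * (Y \<omega>)\<^sup>2 + b * Y \<omega>)"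
    and "\<forall>w\<in>set vs. linear_at q w"
    by (rule extremal_functional[OF quad0])
  then have lin: "linear_at q Y" "linear_at q (\<lambda>\<omega>. (Y \<omega>)\<^sup>2)"
      "linear_at q (\<lambda>\<omega>. cos (t * Y \<omega>))" "linear_at q (\<lambda>\<omega>. sin (t * Y \<omega>))"
    by (auto simp: vs_def)
  define \<mu> where "\<mu> = q Y"
  define w where "w = q (\<lambda>\<omega>. (Y \<omega>)\<^sup>2)"
  define \<sigma> where "\<sigma> = w - \<mu>\<^sup>2"
  define C where "C = q (\<lambda>\<omega>. cos (t * Y \<omega>))"
  define S where "S = q (\<lambda>\<omega>. sin (t * Y \<omega>))"
  define \<alpha> where "\<alpha> = arctan (S / C)"
  define \<rho> where "\<rho> = C / cos \<alpha>"
  have q_quad: "q (\<lambda>\<omega>. k + a * (Y \<omega>)\<^sup>2 + b * Y \<omega>) = k + a * w + b * \<mu>" for k a b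
  proof -
    have "q (\<lambda>\<omega>. k + a * (Y \<omega>)\<^sup>2 + b * Y \<omega>) = q (\<lambda>\<omega>. k + a * (Y \<omega>)\<^sup>2) + b * \<mu>"
      unfolding \<mu>_def
      by (intro linear_at_add_scaled q lin bounded_rv_add bounded_rv_scale bounded_rv_const Y1 Y2)
    also have "q (\<lambda>\<omega>. k + a * (Y \<omega>)\<^sup>2) = q (\<lambda>_. k) + a * w"
      unfolding w_def by (intro linear_at_add_scaled q lin bounded_rv_const Y2)
    finally show ?thesis by (simp add: dominated_const[OF q(1)])
  qed
  have q_cos: "q (\<lambda>\<omega>. k + l * cos (\<theta> + t * Y \<omega>)) = k + l * (cos \<theta> * C - sin \<theta> * S)" for k l \<theta>
  proof -
    have "q (\<lambda>\<omega>. k + l * cos (\<theta> + t * Y \<omega>))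
        = q (\<lambda>\<omega>. (k + (l * cos \<theta>) * cos (t * Y \<omega>)) + (- l * sin \<theta>) * sin (t * Y \<omega>))"
      by (simp add: cos_add algebra_simps)
    also have "\<dots> = q (\<lambda>\<omega>. k + (l * cos \<theta>) * cos (t * Y \<omega>)) + (- l * sin \<theta>) * S"
      unfolding S_def
      by (intro linear_at_add_scaled q lin bounded_rv_add bounded_rv_scale bounded_rv_const cosY0 sinY)
    also have "q (\<lambda>\<omega>. k + (l * cos \<theta>) * cos (t * Y \<omega>)) = q (\<lambda>_. k) + (l * cos \<theta>) * C"
      unfolding C_def by (intro linear_at_add_scaled q lin bounded_rv_const cosY0)
    finally show ?thesis by (simp add: dominated_const[OF q(1)] algebra_simps)
  qed
  have tY: "\<bar>t * Y \<omega>\<bar> \<le> 1 / 2" for \<omega>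
  proof -
    have "\<bar>t * Y \<omega>\<bar> = t * \<bar>Y \<omega>\<bar>" using t by (simp add: abs_mult)
    also have "\<dots> \<le> t * c" using t by (intro mult_left_mono Y) auto
    finally show ?thesis using t by linarith
  qed
  have "0 < cos (1 / 2 :: real)"
    using pi_ge_two by (intro cos_gt_zero_pi) auto
  also have "\<dots> \<le> C"
  proof -
    have "cos (1 / 2) \<le> cos (t * Y \<omega>)" for \<omega>
    proof -
      have "cos (1 / 2) \<le> cos \<bar>t * Y \<omega>\<bar>"
        using tY[of \<omega>] pi_ge_two by (intro cos_monotone_0_pi_le) auto
      then show ?thesis by simp
    qed
    then have "q (\<lambda>_. cos (1 / 2)) \<le> C"
      unfolding C_def by (rule dominated_mono[OF q(1) bounded_rv_const cosY0])
    then show ?thesis by (simp add: dominated_const[OF q(1)])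
  qed
  finally have "0 < C" .
  \<comment> \<open>Since \<open>C > 0\<close>, the phase lies within \<open>pi / 2\<close> of \<open>0\<close> and is given by the arctangent.\<close>
  have "\<bar>\<alpha>\<bar> < pi / 2"
    unfolding \<alpha>_def using arctan_lbound[of "S / C"] arctan_ubound[of "S / C"] by (simp add: abs_less_iff)
  then have "0 < cos \<alpha>" by (intro cos_gt_zero_pi) (auto simp: abs_less_iff)
  have "sin \<alpha> / cos \<alpha> = S / C"
    using tan_arctan[of "S / C"] unfolding \<alpha>_def tan_def by simp
  then have polar: "\<rho> * cos \<alpha> = C" "\<rho> * sin \<alpha> = S"
    using \<open>0 < cos \<alpha>\<close> \<open>0 < C\<close> by (auto simp: \<rho>_def field_simps)
  have rotate: "cos \<theta> * C - sin \<theta> * S = \<rho> * cos (\<theta> + \<alpha>)" for \<theta>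
    unfolding polar[symmetric] cos_add by (simp add: algebra_simps)
  have "\<rho> = q (\<lambda>\<omega>. cos (- \<alpha> + t * Y \<omega>))"
    using q_cos[of 0 1 "- \<alpha>"] rotate[of "- \<alpha>"] by simp
  also have "\<dots> \<le> q (\<lambda>\<omega>. (1 - \<alpha>\<^sup>2 / 8) + (- t\<^sup>2 / 8) * (Y \<omega>)\<^sup>2 + (t * \<alpha> / 4) * Y \<omega>)"
  proof (rule dominated_mono[OF q(1) cosY quad])
    fix \<omega>
    have "\<bar>- \<alpha> + t * Y \<omega>\<bar> \<le> 3"
      using tY[of \<omega>] \<open>\<bar>\<alpha>\<bar> < pi / 2\<close> pi_less_4 by linarith
    from cos_le_quadratic[OF this]
    have "cos (- \<alpha> + t * Y \<omega>) \<le> 1 - (- \<alpha> + t * Y \<omega>)\<^sup>2 / 8" .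
    also have "\<dots> = (1 - \<alpha>\<^sup>2 / 8) + (- t\<^sup>2 / 8) * (Y \<omega>)\<^sup>2 + (t * \<alpha> / 4) * Y \<omega>"
      by (simp add: power2_eq_square field_simps)
    finally show "cos (- \<alpha> + t * Y \<omega>) \<le> (1 - \<alpha>\<^sup>2 / 8) + (- t\<^sup>2 / 8) * (Y \<omega>)\<^sup>2 + (t * \<alpha> / 4) * Y \<omega>" .
  qed
  also have "\<dots> = 1 - t\<^sup>2 * \<sigma> / 8 - (t * \<mu> - \<alpha>)\<^sup>2 / 8"
    unfolding q_quad \<sigma>_def by (simp add: power2_eq_square field_simps)
  also have "\<dots> \<le> 1 - t\<^sup>2 * \<sigma> / 8" by simp
  finally have \<rho>_le: "\<rho> \<le> 1 - t\<^sup>2 * \<sigma> / 8" .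
  have "q (\<lambda>_. 0) \<le> q (\<lambda>\<omega>. \<mu>\<^sup>2 + 1 * (Y \<omega>)\<^sup>2 + (- 2 * \<mu>) * Y \<omega>)"
  proof (rule dominated_mono[OF q(1) bounded_rv_const quad])
    fix \<omega>
    have "0 \<le> (Y \<omega> - \<mu>)\<^sup>2" by simp
    then show "0 \<le> \<mu>\<^sup>2 + 1 * (Y \<omega>)\<^sup>2 + (- 2 * \<mu>) * Y \<omega>"
      by (simp add: power2_eq_square algebra_simps)
  qed
  then have \<sigma>_nonneg: "0 \<le> \<sigma>"
    unfolding q_quad dominated_const[OF q(1)] \<sigma>_def by (simp add: power2_eq_square)
  show thesis
  proof (rule that)
    show "R (\<lambda>\<omega>. a * (Y \<omega>)\<^sup>2 + b * Y \<omega>) = a * (\<sigma> + \<mu>\<^sup>2) + b * \<mu>"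
      using q_quad[of 0 a b] q(2) by (simp add: \<sigma>_def)
    show "0 \<le> \<rho>"
      unfolding \<rho>_def using \<open>0 < cos \<alpha>\<close> \<open>0 < C\<close> by simp
    show "\<mu> \<le> R Y"
      unfolding \<mu>_def by (rule dominated_le_R[OF q(1) Y1])
    show "- R (\<lambda>\<omega>. - Y \<omega>) \<le> \<mu>"
      using dominated_le_R[OF q(1) bounded_rv_uminus[OF Y1]] lin(1) by (simp add: \<mu>_def)
    show "1 - \<rho> * cos (\<theta> + \<alpha>) \<le> R (\<lambda>\<omega>. 1 - cos (\<theta> + t * Y \<omega>))" for \<theta>
    proof -
      have "1 - \<rho> * cos (\<theta> + \<alpha>) = q (\<lambda>\<omega>. 1 - cos (\<theta> + t * Y \<omega>))"
        using q_cos[of 1 "- 1" \<theta>] rotate[of \<theta>] by simp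
      also have "\<dots> \<le> R (\<lambda>\<omega>. 1 - cos (\<theta> + t * Y \<omega>))"
        by (rule dominated_le_R[OF q(1) bounded_rv_diff[OF bounded_rv_const cosY]])
      finally show ?thesis .
    qed
    show "- s\<^sup>2 - \<sigma> \<le> R (\<lambda>\<omega>. - (s + Y \<omega> - \<mu>)\<^sup>2)" for s
    proof -
      define d where "d = s - \<mu>"
      have eq: "(\<lambda>\<omega>. - (s + Y \<omega> - \<mu>)\<^sup>2) = (\<lambda>\<omega>. - d\<^sup>2 + (- 1) * (Y \<omega>)\<^sup>2 + (- 2 * d) * Y \<omega>)"
        by (simp add: fun_eq_iff d_def power2_eq_square algebra_simps)
      have "- s\<^sup>2 - \<sigma> = - d\<^sup>2 + (- 1) * w + (- 2 * d) * \<mu>"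
        by (simp add: \<sigma>_def d_def power2_eq_square algebra_simps)
      then show ?thesis
        unfolding eq using dominated_le_R[OF q(1) quad, of "- d\<^sup>2" "- 1" "- 2 * d"]
        unfolding q_quad by linarith
    qed
  qed (use \<rho>_le \<sigma>_nonneg in auto)
qed

end

section \<open>Independent sequences\<close>

context sublinear_expectation_space
begin

lemma abs_R_diff_le:
  assumes "f \<in> bounded_rv" and "g \<in> bounded_rv" and "\<And>\<omega>. \<bar>f \<omega> - g \<omega>\<bar> \<le> d"
  shows "\<bar>R f - R g\<bar> \<le> d"
proof -
  have "R f' \<le> d + R g'"
    if "f' \<in> bounded_rv" "g' \<in> bounded_rv" "\<And>\<omega>. \<bar>f' \<omega> - g' \<omega>\<bar> \<le> d" for f' g'
  proof -
    have "R f' \<le> R (\<lambda>\<omega>. d + g' \<omega>)"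
    proof (rule R_mono[OF that(1) bounded_rv_add[OF bounded_rv_const that(2)]])
      show "f' \<omega> \<le> d + g' \<omega>" for \<omega> using that(3)[of \<omega>] by linarith
    qed
    then show ?thesis by (simp add: R_translate[OF that(2)])
  qed
  from this[OF assms] this[OF assms(2,1)] assms(3) show ?thesis
    by (simp add: abs_minus_commute abs_le_iff)
qed

lemma abs_R_le:
  assumes "f \<in> bounded_rv" and "\<And>\<omega>. \<bar>f \<omega>\<bar> \<le> d"
  shows "\<bar>R f\<bar> \<le> d"
  using abs_R_diff_le[OF assms(1) bounded_rv_const, of 0 d] assms(2) by (simp add: R_const)

end

locale independent_sequence = sublinear_expectation_space +
  fixes \<xi> :: "nat \<Rightarrow> 'a \<Rightarrow> real"
  assumes \<xi>_H: "\<xi> i \<in> H"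
    and indep: "indep_to E 1 (\<lambda>_. \<xi> m) m \<xi>"
begin

abbreviation T :: "nat \<Rightarrow> nat \<Rightarrow> 'a \<Rightarrow> real" where
  "T m n \<omega> \<equiv> (\<Sum>i\<in>{m..<n}. \<xi> i \<omega>)"

text \<open>The variables that may play the role of a constant when \<open>\<xi> m\<close> is integrated out.\<close>

definition past :: "nat \<Rightarrow> ('a \<Rightarrow> real) set" where
  "past m = {\<lambda>\<omega>. \<phi> (\<lambda>i. \<xi> i \<omega>) |\<phi>. bounded_lipschitz (coord_dist m) \<phi>}"

lemma pastI: "bounded_lipschitz (coord_dist m) \<phi> \<Longrightarrow> (\<lambda>\<omega>. \<phi> (\<lambda>i. \<xi> i \<omega>)) \<in> past m"
  unfolding past_def by blast

lemma pastE:
  assumes "f \<in> past m"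
  obtains \<phi> where "bounded_lipschitz (coord_dist m) \<phi>" and "f = (\<lambda>\<omega>. \<phi> (\<lambda>i. \<xi> i \<omega>))"
  using assms unfolding past_def by blast

lemma past_bounded_rv: "f \<in> past m \<Longrightarrow> f \<in> bounded_rv"
  by (elim pastE) (auto intro: H_bounded_lipschitz \<xi>_H)

lemma past_mono: "f \<in> past m \<Longrightarrow> m \<le> n \<Longrightarrow> f \<in> past n"
  by (elim pastE) (auto intro: pastI bounded_lipschitz_coord_mono)

lemma past_const: "(\<lambda>_. c) \<in> past m"
  using pastI[OF bounded_lipschitz_const] .

lemma past_sum: "real_BL g \<Longrightarrow> I \<subseteq> {..<m} \<Longrightarrow> (\<lambda>\<omega>. g (\<Sum>i\<in>I. \<xi> i \<omega>)) \<in> past m"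
  using pastI[OF bounded_lipschitz_coord_sum] .

lemma past_T: "real_BL g \<Longrightarrow> n \<le> k \<Longrightarrow> (\<lambda>\<omega>. g (T m n \<omega>)) \<in> past k"
  by (rule past_sum) auto

lemma past_mult:
  assumes "f \<in> past m" and "g \<in> past m"
  shows "(\<lambda>\<omega>. f \<omega> * g \<omega>) \<in> past m"
proof -
  obtain \<phi> \<psi> where "bounded_lipschitz (coord_dist m) \<phi>" "f = (\<lambda>\<omega>. \<phi> (\<lambda>i. \<xi> i \<omega>))"
    and "bounded_lipschitz (coord_dist m) \<psi>" "g = (\<lambda>\<omega>. \<psi> (\<lambda>i. \<xi> i \<omega>))"
    using assms by (elim pastE) blast
  then show ?thesis
    using pastI[OF bounded_lipschitz_mult[of "coord_dist m" \<phi> \<psi>]] by simp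
qed

lemma past_prod: "(\<And>i. i \<in> I \<Longrightarrow> f i \<in> past m) \<Longrightarrow> (\<lambda>\<omega>. \<Prod>i\<in>I. f i \<omega>) \<in> past m"
  by (induction I rule: infinite_finite_induct) (auto intro: past_const past_mult)

lemma T_bounded_rv: "real_BL g \<Longrightarrow> (\<lambda>\<omega>. g (T m n \<omega>)) \<in> bounded_rv"
  using past_bounded_rv[OF past_T[OF _ order_refl]] .

lemma shifted_bounded_rv: "real_BL g \<Longrightarrow> (\<lambda>\<omega>. g (s + \<xi> n \<omega>)) \<in> bounded_rv"
  using bounded_rv_real_BL[OF real_BL_shift \<xi>_H, of g n s] by (simp add: add.commute)

lemma real_BL_R_shift:
  assumes "real_BL g"
  shows "real_BL (\<lambda>s. R (\<lambda>\<omega>. g (s + \<xi> n \<omega>)))"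
proof -
  obtain B L where g: "0 \<le> L" "\<And>x. \<bar>g x\<bar> \<le> B" "\<And>x y. \<bar>g x - g y\<bar> \<le> L * \<bar>x - y\<bar>"
    using bounded_lipschitzE[OF assms] by metis
  show ?thesis
  proof (rule bounded_lipschitzI)
    show "\<bar>R (\<lambda>\<omega>. g (s + \<xi> n \<omega>))\<bar> \<le> B" for s
      by (rule abs_R_le[OF shifted_bounded_rv[OF assms] g(2)])
    show "\<bar>R (\<lambda>\<omega>. g (s + \<xi> n \<omega>)) - R (\<lambda>\<omega>. g (s' + \<xi> n \<omega>))\<bar> \<le> L * \<bar>s - s'\<bar>" for s s'
    proof (rule abs_R_diff_le[OF shifted_bounded_rv[OF assms] shifted_bounded_rv[OF assms]])
      show "\<bar>g (s + \<xi> n \<omega>) - g (s' + \<xi> n \<omega>)\<bar> \<le> L * \<bar>s - s'\<bar>" for \<omega>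
        using g(3)[of "s + \<xi> n \<omega>" "s' + \<xi> n \<omega>"] by simp
    qed
  qed (rule g)
qed

text \<open>
  All uses of independence have this shape: the last variable is integrated out first, with the
  past frozen. The factor \<open>p\<close> must be nonnegative to be moved out of the inner expectation.
\<close>

lemma integrate_last:
  assumes p: "p \<in> past m" "\<And>\<omega>. 0 \<le> p \<omega>" and g: "real_BL g" and I: "I \<subseteq> {..<m}"
  shows "R (\<lambda>\<omega>. p \<omega> * g ((\<Sum>i\<in>I. \<xi> i \<omega>) + \<xi> m \<omega>))
       = R (\<lambda>\<omega>. p \<omega> * R (\<lambda>\<omega>'. g ((\<Sum>i\<in>I. \<xi> i \<omega>) + \<xi> m \<omega>')))"
proof -
  obtain \<phi> where \<phi>: "bounded_lipschitz (coord_dist m) \<phi>" "p = (\<lambda>\<omega>. \<phi> (\<lambda>i. \<xi> i \<omega>))"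
    using p(1) by (rule pastE)
  define \<Phi> where "\<Phi> v = \<phi> v * g (\<Sum>i\<in>insert m I. v i)" for v
  have "finite I" "m \<notin> I" using I finite_subset by auto
  have "bounded_lipschitz (coord_dist (m + 1)) \<Phi>"
    unfolding \<Phi>_def using I
    by (intro bounded_lipschitz_mult bounded_lipschitz_coord_mono[OF \<phi>(1)]
        bounded_lipschitz_coord_sum g) auto
  then have "\<Phi> \<in> C_b_Lip (m + 1)" unfolding C_b_Lip_iff .
  then have "E (\<lambda>\<omega>. \<Phi> (vec_append m (\<lambda>i. \<xi> i \<omega>) (\<lambda>_. \<xi> m \<omega>)))
      = E (\<lambda>\<omega>. R (\<lambda>\<omega>'. \<Phi> (vec_append m (\<lambda>i. \<xi> i \<omega>) (\<lambda>_. \<xi> m \<omega>'))))"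
    by (rule bspec[OF indep[of m, unfolded indep_to_def]])
  moreover have "\<Phi> (vec_append m x (\<lambda>_. y)) = \<phi> x * g ((\<Sum>i\<in>I. x i) + y)" for x y
  proof -
    have "\<phi> (vec_append m x (\<lambda>_. y)) = \<phi> x"
      by (rule bounded_lipschitz_coord_local[OF \<phi>(1)]) (simp add: vec_append_def)
    moreover have "(\<Sum>i\<in>insert m I. vec_append m x (\<lambda>_. y) i) = y + (\<Sum>i\<in>I. x i)"
      using \<open>finite I\<close> \<open>m \<notin> I\<close> I by (auto simp: vec_append_def intro!: sum.cong)
    ultimately show ?thesis by (simp add: \<Phi>_def add.commute)
  qed
  ultimately have "R (\<lambda>\<omega>. p \<omega> * g ((\<Sum>i\<in>I. \<xi> i \<omega>) + \<xi> m \<omega>))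
      = R (\<lambda>\<omega>. R (\<lambda>\<omega>'. p \<omega> * g ((\<Sum>i\<in>I. \<xi> i \<omega>) + \<xi> m \<omega>')))"
    by (simp add: \<phi>(2))
  also have "\<dots> = R (\<lambda>\<omega>. p \<omega> * R (\<lambda>\<omega>'. g ((\<Sum>i\<in>I. \<xi> i \<omega>) + \<xi> m \<omega>')))"
    using R_scale[OF shifted_bounded_rv[OF g] p(2)] by simp
  finally show ?thesis .
qed

lemma integrate_last_T:
  assumes "m \<le> n" and "real_BL g"
  shows "R (\<lambda>\<omega>. g (T m (Suc n) \<omega>)) = R (\<lambda>\<omega>. R (\<lambda>\<omega>'. g (T m n \<omega> + \<xi> n \<omega>')))"
proof -
  have "{m..<n} \<subseteq> {..<n}" by auto
  from integrate_last[OF past_const[of 1] _ assms(2) this] show ?thesis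
    using assms(1) by simp
qed

lemma integrate_last_mult:
  assumes "p \<in> past m" and "\<And>\<omega>. 0 \<le> p \<omega>" and "real_BL g"
  shows "R (\<lambda>\<omega>. p \<omega> * g (\<xi> m \<omega>)) = R (\<lambda>\<omega>. p \<omega> * R (\<lambda>\<omega>'. g (\<xi> m \<omega>')))"
  using integrate_last[OF assms, of "{}"] by simp

text \<open>
  A sum of later variables is independent of the past. Integrating out its last summand gives a
  bounded Lipschitz function of the shorter sum, with the same factor \<open>p\<close>, so that one real
  argument is carried through the induction instead of a vector.
\<close>

lemma integrate_future_sum:
  assumes p: "p \<in> past j" "\<And>\<omega>. 0 \<le> p \<omega>" and "real_BL g" and "j \<le> n"
  shows "R (\<lambda>\<omega>. p \<omega> * g (T j n \<omega>)) = R (\<lambda>\<omega>. p \<omega> * R (\<lambda>\<omega>'. g (T j n \<omega>')))"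
  using \<open>j \<le> n\<close> \<open>real_BL g\<close>
proof (induction n arbitrary: g rule: dec_induct)
  case base
  then show ?case by (simp add: R_const)
next
  case (step n)
  define g' where "g' s = R (\<lambda>\<omega>. g (s + \<xi> n \<omega>))" for s
  have g': "real_BL g'" unfolding g'_def by (rule real_BL_R_shift[OF step.prems])
  have "{j..<n} \<subseteq> {..<n}" by auto
  from integrate_last[OF past_mono[OF p(1) step.hyps(1)] p(2) step.prems this]
  have "R (\<lambda>\<omega>. p \<omega> * g (T j (Suc n) \<omega>)) = R (\<lambda>\<omega>. p \<omega> * g' (T j n \<omega>))"
    using step.hyps by (simp add: g'_def)
  also have "\<dots> = R (\<lambda>\<omega>. p \<omega> * R (\<lambda>\<omega>'. g' (T j n \<omega>')))"
    by (rule step.IH[OF g'])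
  finally show ?case
    using integrate_last_T[OF step.hyps(1) step.prems] by (simp add: g'_def)
qed

lemma independent_sequence_lipschitz:
  assumes "\<And>i x y. \<bar>h i x - h i y\<bar> \<le> \<bar>x - y\<bar>"
  shows "independent_sequence M H E (\<lambda>i \<omega>. h i (\<xi> i \<omega>))"
proof unfold_locales
  show "(\<lambda>\<omega>. h i (\<xi> i \<omega>)) \<in> H" for i
    by (rule H_lipschitz_comp[OF \<xi>_H, where K = 1]) (use assms in simp)
  show "indep_to E 1 (\<lambda>_ \<omega>. h m (\<xi> m \<omega>)) m (\<lambda>i \<omega>. h i (\<xi> i \<omega>))" for m
    unfolding indep_to_def
  proof
    fix \<phi> assume "\<phi> \<in> C_b_Lip (m + 1)"
    then have \<phi>: "bounded_lipschitz (coord_dist (m + 1)) \<phi>" unfolding C_b_Lip_iff .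
    then obtain B L where B: "\<And>x. \<bar>\<phi> x\<bar> \<le> B" and L: "0 \<le> L"
        "\<And>x y. \<bar>\<phi> x - \<phi> y\<bar> \<le> L * coord_dist (m + 1) x y"
      using bounded_lipschitzE[OF \<phi>] by metis
    define \<phi>' where "\<phi>' v = \<phi> (\<lambda>i. h i (v i))" for v
    have "bounded_lipschitz (coord_dist (m + 1)) \<phi>'"
    proof (rule bounded_lipschitzI)
      show "\<bar>\<phi>' x\<bar> \<le> B" for x unfolding \<phi>'_def by (rule B)
      show "\<bar>\<phi>' x - \<phi>' y\<bar> \<le> L * coord_dist (m + 1) x y" for x y
      proof -
        have "coord_dist (m + 1) (\<lambda>i. h i (x i)) (\<lambda>i. h i (y i)) \<le> coord_dist (m + 1) x y"
          by (intro sum_mono assms)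
        from mult_left_mono[OF this L(1)] show ?thesis
          unfolding \<phi>'_def by (rule order_trans[OF L(2)])
      qed
    qed (rule L)
    then have "\<phi>' \<in> C_b_Lip (m + 1)" unfolding C_b_Lip_iff .
    then have "E (\<lambda>\<omega>. \<phi>' (vec_append m (\<lambda>i. \<xi> i \<omega>) (\<lambda>_. \<xi> m \<omega>)))
        = E (\<lambda>\<omega>. R (\<lambda>\<omega>'. \<phi>' (vec_append m (\<lambda>i. \<xi> i \<omega>) (\<lambda>_. \<xi> m \<omega>'))))"
      by (rule bspec[OF indep[of m, unfolded indep_to_def]])
    moreover have "\<phi>' (vec_append m x (\<lambda>_. y))
        = \<phi> (vec_append m (\<lambda>i. h i (x i)) (\<lambda>_. h m y))" for x y
      unfolding \<phi>'_def
      by (rule bounded_lipschitz_coord_local[OF \<phi>]) (auto simp: vec_append_def less_Suc_eq)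
    ultimately show "E (\<lambda>\<omega>. \<phi> (vec_append m (\<lambda>i. h i (\<xi> i \<omega>)) (\<lambda>j. h m (\<xi> m \<omega>))))
        = E (\<lambda>\<omega>. R (\<lambda>\<omega>'. \<phi> (vec_append m (\<lambda>i. h i (\<xi> i \<omega>)) (\<lambda>j. h m (\<xi> m \<omega>')))))"
      by simp
  qed
qed

end

lemma (in sublinear_expectation_space) independent_sequence_of_indep_seq:
  assumes "\<And>n. n \<ge> 1 \<Longrightarrow> X n \<in> H" and "indep_seq E X"
  shows "independent_sequence M H E (\<lambda>i. X (Suc i))"
proof unfold_locales
  show "X (Suc i) \<in> H" for i using assms(1) by simp
  show "indep_to E 1 (\<lambda>_. X (Suc m)) m (\<lambda>i. X (Suc i))" for m
  proof (cases "m = 0")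
    case True
    have "E (\<lambda>\<omega>. \<phi> (\<lambda>_. X 1 \<omega>)) = E (\<lambda>_. R (\<lambda>\<omega>. \<phi> (\<lambda>_. X 1 \<omega>)))" if "\<phi> \<in> C_b_Lip 1" for \<phi>
    proof -
      have "X 1 \<in> H" using assms(1) by simp
      then have "(\<lambda>\<omega>. \<phi> (\<lambda>i. X 1 \<omega>)) \<in> bounded_rv"
        using H_bounded_lipschitz[of 1 \<phi> "\<lambda>_. X 1"] that unfolding C_b_Lip_iff by simp
      from E_eq_R[OF this] show ?thesis unfolding E_const .
    qed
    then show ?thesis
      unfolding True indep_to_def by (simp add: vec_append_def)
  next
    case False
    then show ?thesis using assms(2) unfolding indep_seq_def by simp
  qed
qed

section \<open>Estimates for sums of independent variables\<close>

context independent_sequence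
begin

lemma abs_T_le:
  assumes "\<And>i \<omega>. \<bar>\<xi> i \<omega>\<bar> \<le> K"
  shows "\<bar>T m n \<omega>\<bar> \<le> real (n - m) * K"
proof -
  have "\<bar>T m n \<omega>\<bar> \<le> (\<Sum>i\<in>{m..<n}. \<bar>\<xi> i \<omega>\<bar>)" by (rule sum_abs)
  also have "\<dots> \<le> real (card {m..<n}) * K" by (intro sum_bounded_above assms)
  finally show ?thesis by simp
qed

text \<open>
  Expanding \<open>((s + z)\<^sup>+)\<^sup>2 \<le> (s\<^sup>+)\<^sup>2 + 2 s\<^sup>+ z + z\<^sup>2\<close>, the middle term has a nonnegative factor from
  the past, so that \<open>R (\<xi> i) \<le> 0\<close> alone makes its expectation nonpositive. Only the upper tail
  is controlled; the lower one needs the sequence \<open>- \<xi>\<close>, whose upper means are unrelated.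
\<close>

lemma pos_part_square_sum_le:
  assumes K: "\<And>i \<omega>. \<bar>\<xi> i \<omega>\<bar> \<le> K" and mean: "\<And>i. R (\<xi> i) \<le> 0" and "m \<le> n"
  shows "R (\<lambda>\<omega>. (max 0 (T m n \<omega>))\<^sup>2) \<le> (\<Sum>i\<in>{m..<n}. R (\<lambda>\<omega>. (\<xi> i \<omega>)\<^sup>2))"
  using \<open>m \<le> n\<close>
proof (induction n rule: dec_induct)
  case base
  then show ?case by (simp add: R_const)
next
  case (step n)
  define B where "B = real (Suc n - m) * K"
  have "0 \<le> K" using K abs_ge_zero order_trans by blast
  have clamp_T: "clamp B (T m n \<omega>) = T m n \<omega>" "clamp B (T m (Suc n) \<omega>) = T m (Suc n) \<omega>" for \<omega>
  proof -
    have "\<bar>T m n \<omega>\<bar> \<le> real (n - m) * K" by (rule abs_T_le[OF K])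
    also have "\<dots> \<le> B" unfolding B_def using \<open>0 \<le> K\<close> by (intro mult_right_mono) auto
    finally show "clamp B (T m n \<omega>) = T m n \<omega>" by (rule clamp_id)
    show "clamp B (T m (Suc n) \<omega>) = T m (Suc n) \<omega>"
      unfolding B_def by (intro clamp_id abs_T_le[OF K])
  qed
  have BL: "real_BL (\<lambda>x. (max 0 (clamp B x))\<^sup>2)" "real_BL (\<lambda>x. 2 * max 0 (clamp B x))"
    by (intro bounded_lipschitz_power bounded_lipschitz_mult bounded_lipschitz_const
        bounded_lipschitz_pos_part real_BL_clamp)+
  have sq: "(\<lambda>\<omega>. (max 0 (T m n \<omega>))\<^sup>2) \<in> bounded_rv" "(\<lambda>\<omega>. (max 0 (T m (Suc n) \<omega>))\<^sup>2) \<in> bounded_rv"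
    using T_bounded_rv[OF BL(1), of m n] T_bounded_rv[OF BL(1), of m "Suc n"]
    unfolding clamp_T by auto
  have lin: "(\<lambda>\<omega>. 2 * max 0 (T m n \<omega>)) \<in> past n"
    using past_T[OF BL(2) order_refl, of m n] unfolding clamp_T .
  have clamp_\<xi>: "clamp K (\<xi> i \<omega>) = \<xi> i \<omega>" for i \<omega> by (rule clamp_id[OF K])
  have lin_\<xi>: "(\<lambda>\<omega>. 2 * max 0 (T m n \<omega>) * \<xi> n \<omega>) \<in> bounded_rv"
  proof -
    have "(\<lambda>\<omega>. clamp K (\<Sum>i\<in>{n}. \<xi> i \<omega>)) \<in> past (Suc n)"
      by (rule past_sum[OF real_BL_clamp]) auto
    then have "\<xi> n \<in> past (Suc n)" by (simp add: clamp_\<xi>)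
    then show ?thesis
      by (intro past_bounded_rv[of _ "Suc n"] past_mult past_mono[OF lin]) auto
  qed
  have \<xi>_sq: "(\<lambda>\<omega>. (\<xi> n \<omega>)\<^sup>2) \<in> bounded_rv"
    using bounded_rv_real_BL[OF bounded_lipschitz_power[OF real_BL_clamp] \<xi>_H, of K n 2]
    by (simp add: clamp_\<xi>)
  have "R (\<lambda>\<omega>. 2 * max 0 (T m n \<omega>) * \<xi> n \<omega>) = R (\<lambda>\<omega>. 2 * max 0 (T m n \<omega>) * R (\<xi> n))"
    using integrate_last_mult[OF lin _ real_BL_clamp, of K] by (simp add: clamp_\<xi>)
  also have "\<dots> \<le> 0"
  proof (rule R_le_const)
    show "(\<lambda>\<omega>. 2 * max 0 (T m n \<omega>) * R (\<xi> n)) \<in> bounded_rv"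
      by (intro past_bounded_rv[OF past_mult[OF lin past_const]])
    show "2 * max 0 (T m n \<omega>) * R (\<xi> n) \<le> 0" for \<omega>
      using mean[of n] by (intro mult_nonneg_nonpos) auto
  qed
  finally have middle: "R (\<lambda>\<omega>. 2 * max 0 (T m n \<omega>) * \<xi> n \<omega>) \<le> 0" .
  have "(max 0 (s + z))\<^sup>2 \<le> (max 0 s)\<^sup>2 + 2 * max 0 s * z + z\<^sup>2" for s z :: real
  proof -
    have "max 0 (s + z) \<le> \<bar>max 0 s + z\<bar>" by linarith
    then have "(max 0 (s + z))\<^sup>2 \<le> (max 0 s + z)\<^sup>2"
      by (metis abs_ge_zero max.cobounded1 power2_abs power_mono)
    then show ?thesis by (simp add: power2_sum)
  qed
  then have "(max 0 (T m (Suc n) \<omega>))\<^sup>2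
      \<le> ((max 0 (T m n \<omega>))\<^sup>2 + 2 * max 0 (T m n \<omega>) * \<xi> n \<omega>) + (\<xi> n \<omega>)\<^sup>2" for \<omega>
    using step.hyps by simp
  then have "R (\<lambda>\<omega>. (max 0 (T m (Suc n) \<omega>))\<^sup>2)
      \<le> R (\<lambda>\<omega>. ((max 0 (T m n \<omega>))\<^sup>2 + 2 * max 0 (T m n \<omega>) * \<xi> n \<omega>) + (\<xi> n \<omega>)\<^sup>2)"
    by (intro R_mono bounded_rv_add sq lin_\<xi> \<xi>_sq)
  also have "\<dots> \<le> R (\<lambda>\<omega>. (max 0 (T m n \<omega>))\<^sup>2 + 2 * max 0 (T m n \<omega>) * \<xi> n \<omega>) + R (\<lambda>\<omega>. (\<xi> n \<omega>)\<^sup>2)"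
    by (intro R_add bounded_rv_add sq lin_\<xi> \<xi>_sq)
  also have "\<dots> \<le> (R (\<lambda>\<omega>. (max 0 (T m n \<omega>))\<^sup>2) + R (\<lambda>\<omega>. 2 * max 0 (T m n \<omega>) * \<xi> n \<omega>))
      + R (\<lambda>\<omega>. (\<xi> n \<omega>)\<^sup>2)"
    by (intro add_right_mono R_add sq lin_\<xi>)
  also have "\<dots> \<le> (\<Sum>i\<in>{m..<n}. R (\<lambda>\<omega>. (\<xi> i \<omega>)\<^sup>2)) + R (\<lambda>\<omega>. (\<xi> n \<omega>)\<^sup>2)"
    using middle step.IH by linarith
  finally show ?case
    using step.hyps by simp
qed

text \<open>
  The characteristic function of a sum factorises: along functionals that reduce
  \<open>cos (\<theta> + t * \<xi> i)\<close> to \<open>\<rho> i * cos (\<theta> + \<alpha> i)\<close>, every new summand multiplies the modulus by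
  \<open>\<rho> i\<close> and only shifts the phase. The claim for all phases is what the induction needs.
\<close>

lemma one_minus_cos_sum_ge:
  assumes \<rho>: "\<And>i. 0 \<le> \<rho> i"
    and char: "\<And>i \<theta>. 1 - \<rho> i * cos (\<theta> + \<alpha> i) \<le> R (\<lambda>\<omega>. 1 - cos (\<theta> + t * \<xi> i \<omega>))"
    and "m \<le> n"
  shows "1 - (\<Prod>i\<in>{m..<n}. \<rho> i) \<le> R (\<lambda>\<omega>. 1 - cos (\<theta> + t * T m n \<omega>))"
  using \<open>m \<le> n\<close>
proof (induction n arbitrary: \<theta> rule: dec_induct)
  case base
  then show ?case by (simp add: R_const)
next
  case (step n)
  define P where "P = (\<Prod>i\<in>{m..<n}. \<rho> i)"
  have BL: "real_BL (\<lambda>x. 1 - cos (\<theta> + t * x))" for \<theta>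
    by (intro bounded_lipschitz_diff bounded_lipschitz_const real_BL_cos)
  have "1 - \<rho> n * P = (1 - \<rho> n) + \<rho> n * (1 - P)" by (simp add: algebra_simps)
  also have "\<dots> \<le> (1 - \<rho> n) + \<rho> n * R (\<lambda>\<omega>. 1 - cos ((\<theta> + \<alpha> n) + t * T m n \<omega>))"
    unfolding P_def by (intro add_left_mono mult_left_mono step.IH \<rho>)
  also have "\<dots> = R (\<lambda>\<omega>. (1 - \<rho> n) + \<rho> n * (1 - cos ((\<theta> + \<alpha> n) + t * T m n \<omega>)))"
    using R_translate[OF bounded_rv_scale[OF T_bounded_rv[OF BL]]] R_scale[OF T_bounded_rv[OF BL] \<rho>]
    by simp
  also have "\<dots> \<le> R (\<lambda>\<omega>. R (\<lambda>\<omega>'. 1 - cos (\<theta> + t * (T m n \<omega> + \<xi> n \<omega>'))))"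
  proof (rule R_mono)
    show "(\<lambda>\<omega>. (1 - \<rho> n) + \<rho> n * (1 - cos ((\<theta> + \<alpha> n) + t * T m n \<omega>))) \<in> bounded_rv"
      by (intro bounded_rv_add bounded_rv_const bounded_rv_scale T_bounded_rv BL)
    show "(\<lambda>\<omega>. R (\<lambda>\<omega>'. 1 - cos (\<theta> + t * (T m n \<omega> + \<xi> n \<omega>')))) \<in> bounded_rv"
      by (rule T_bounded_rv[OF real_BL_R_shift[OF BL]])
    show "(1 - \<rho> n) + \<rho> n * (1 - cos ((\<theta> + \<alpha> n) + t * T m n \<omega>))
        \<le> R (\<lambda>\<omega>'. 1 - cos (\<theta> + t * (T m n \<omega> + \<xi> n \<omega>')))" for \<omega>
      using char[of n "\<theta> + t * T m n \<omega>"] by (simp add: algebra_simps)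
  qed
  also have "\<dots> = R (\<lambda>\<omega>. 1 - cos (\<theta> + t * T m (Suc n) \<omega>))"
    using integrate_last_T[OF step.hyps(1) BL] by simp
  finally show ?case
    using step.hyps by (simp add: P_def mult.commute)
qed

text \<open>
  The lower bound says that \<open>T m n\<close> may be placed near \<open>\<Sum>\<mu> i\<close>: as in the previous lemma,
  functionals with means \<open>\<mu> i\<close> and variances \<open>\<sigma> i\<close> are composed one after the other.
\<close>

lemma centred_square_sum_ge:
  assumes K: "\<And>i \<omega>. \<bar>\<xi> i \<omega>\<bar> \<le> K"
    and moment: "\<And>i s. - s\<^sup>2 - \<sigma> i \<le> R (\<lambda>\<omega>. - (s + \<xi> i \<omega> - \<mu> i)\<^sup>2)" and "m \<le> n"
  shows "- (\<Sum>i\<in>{m..<n}. \<sigma> i) \<le> R (\<lambda>\<omega>. - (T m n \<omega> - (\<Sum>i\<in>{m..<n}. \<mu> i))\<^sup>2)"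
  using \<open>m \<le> n\<close>
proof (induction n rule: dec_induct)
  case base
  then show ?case by (simp add: R_const)
next
  case (step n)
  define M where "M = (\<Sum>i\<in>{m..<n}. \<mu> i)"
  define B where "B = real (Suc n - m) * K + \<bar>M\<bar> + \<bar>\<mu> n\<bar>"
  define g where "g x = - (clamp B (x - (M + \<mu> n)))\<^sup>2" for x
  have "0 \<le> K" using K abs_ge_zero order_trans by blast
  have "real_BL (\<lambda>x. clamp B (x - a))" for a
    using real_BL_shift[OF real_BL_clamp, of B "- a"] by simp
  then have BL: "real_BL g" "real_BL (\<lambda>x. - (clamp B (x - M))\<^sup>2)"
    unfolding g_def by (intro bounded_lipschitz_uminus bounded_lipschitz_power; simp)+
  have T_le: "\<bar>T m n \<omega>\<bar> + K \<le> B - \<bar>M\<bar> - \<bar>\<mu> n\<bar>" for \<omega>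
    using abs_T_le[where m = m and n = n and \<omega> = \<omega>, OF K] step.hyps by (simp add: B_def Suc_diff_le algebra_simps)
  have g_eq: "g (T m n \<omega> + \<xi> n \<omega>') = - ((T m n \<omega> - M) + \<xi> n \<omega>' - \<mu> n)\<^sup>2" for \<omega> \<omega>'
  proof -
    have "clamp B (T m n \<omega> + \<xi> n \<omega>' - (M + \<mu> n)) = T m n \<omega> + \<xi> n \<omega>' - (M + \<mu> n)"
      using T_le[of \<omega>] K[of n \<omega>'] by (intro clamp_id) linarith
    then show ?thesis unfolding g_def by (simp only:) (simp add: algebra_simps)
  qed
  have sq: "(\<lambda>\<omega>. - (T m n \<omega> - M)\<^sup>2) \<in> bounded_rv"
  proof -
    have "clamp B (T m n \<omega> - M) = T m n \<omega> - M" for \<omega>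
      using T_le[of \<omega>] \<open>0 \<le> K\<close> by (intro clamp_id) linarith
    then show ?thesis using T_bounded_rv[OF BL(2), of m n] by simp
  qed
  have "- \<sigma> n + - (\<Sum>i\<in>{m..<n}. \<sigma> i) \<le> - \<sigma> n + R (\<lambda>\<omega>. - (T m n \<omega> - M)\<^sup>2)"
    unfolding M_def by (intro add_left_mono step.IH)
  also have "\<dots> = R (\<lambda>\<omega>. - \<sigma> n + - (T m n \<omega> - M)\<^sup>2)"
    by (rule R_translate[OF sq, symmetric])
  also have "\<dots> \<le> R (\<lambda>\<omega>. R (\<lambda>\<omega>'. g (T m n \<omega> + \<xi> n \<omega>')))"
  proof (rule R_mono)
    show "(\<lambda>\<omega>. - \<sigma> n + - (T m n \<omega> - M)\<^sup>2) \<in> bounded_rv"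
      by (intro bounded_rv_add bounded_rv_const sq)
    show "(\<lambda>\<omega>. R (\<lambda>\<omega>'. g (T m n \<omega> + \<xi> n \<omega>'))) \<in> bounded_rv"
      by (rule T_bounded_rv[OF real_BL_R_shift[OF BL(1)]])
    show "- \<sigma> n + - (T m n \<omega> - M)\<^sup>2 \<le> R (\<lambda>\<omega>'. g (T m n \<omega> + \<xi> n \<omega>'))" for \<omega>
      unfolding g_eq using moment[of "T m n \<omega> - M" n] by simp
  qed
  also have "\<dots> = R (\<lambda>\<omega>. g (T m (Suc n) \<omega>))"
    using integrate_last_T[OF step.hyps(1) BL(1)] by simp
  also have "\<dots> = R (\<lambda>\<omega>. - (T m (Suc n) \<omega> - (M + \<mu> n))\<^sup>2)"
  proof -
    have "g (T m (Suc n) \<omega>) = - (T m (Suc n) \<omega> - (M + \<mu> n))\<^sup>2" for \<omega>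
      using g_eq[of \<omega> \<omega>] step.hyps by (simp add: algebra_simps)
    then show ?thesis by simp
  qed
  finally show ?case
    using step.hyps by (simp add: M_def)
qed

text \<open>
  With \<open>P\<close> the product over the past and \<open>b\<close> the expectation of the last \<open>g (\<xi> n)\<close>, integrating out
  \<open>\<xi> n\<close> leaves \<open>P * (b - 1) = (1 - b) * (- P)\<close>, and \<open>1 - b \<ge> 0\<close> comes out of \<open>R\<close> in turn.
\<close>

lemma R_uminus_prod:
  assumes g: "real_BL g" "\<And>x. 0 \<le> g x" "\<And>x. g x \<le> 1" and "m \<le> n"
  shows "R (\<lambda>\<omega>. - (\<Prod>i\<in>{m..<n}. 1 - g (\<xi> i \<omega>))) = - (\<Prod>i\<in>{m..<n}. 1 - R (\<lambda>\<omega>. g (\<xi> i \<omega>)))"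
  using \<open>m \<le> n\<close>
proof (induction n rule: dec_induct)
  case base
  then show ?case by (simp add: R_const)
next
  case (step n)
  define P where "P \<omega> = (\<Prod>i\<in>{m..<n}. 1 - g (\<xi> i \<omega>))" for \<omega>
  define b where "b = R (\<lambda>\<omega>. g (\<xi> n \<omega>))"
  have g1: "real_BL (\<lambda>x. - 1 + g x)" "real_BL (\<lambda>x. 1 - g x)"
    by (intro bounded_lipschitz_add bounded_lipschitz_diff bounded_lipschitz_const g)+
  have g\<xi>: "(\<lambda>\<omega>. g (\<xi> n \<omega>)) \<in> bounded_rv" by (rule bounded_rv_real_BL[OF g(1) \<xi>_H])
  have P: "P \<in> past n"
    unfolding P_def
  proof (rule past_prod)
    show "(\<lambda>\<omega>. 1 - g (\<xi> i \<omega>)) \<in> past n" if "i \<in> {m..<n}" for i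
      using past_sum[OF g1(2), of "{i}" n] that by simp
  qed
  have P_nonneg: "0 \<le> P \<omega>" for \<omega>
    unfolding P_def using g(3) by (intro prod_nonneg) simp
  have "b \<le> 1" unfolding b_def by (rule R_le_const[OF g\<xi> g(3)])
  have "R (\<lambda>\<omega>. - (\<Prod>i\<in>{m..<Suc n}. 1 - g (\<xi> i \<omega>))) = R (\<lambda>\<omega>. P \<omega> * (- 1 + g (\<xi> n \<omega>)))"
    using step.hyps by (simp add: P_def algebra_simps)
  also have "\<dots> = R (\<lambda>\<omega>. P \<omega> * (- 1 + b))"
    unfolding integrate_last_mult[OF P P_nonneg g1(1)] R_translate[OF g\<xi>] b_def ..
  also have "\<dots> = R (\<lambda>\<omega>. (1 - b) * - P \<omega>)" by (simp add: algebra_simps)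
  also have "\<dots> = (1 - b) * R (\<lambda>\<omega>. - P \<omega>)"
    using \<open>b \<le> 1\<close> by (intro R_scale bounded_rv_uminus past_bounded_rv[OF P]) auto
  finally show ?case
    using step.IH step.hyps by (simp add: P_def b_def mult.commute)
qed

text \<open>
  This is Ottaviani's maximal inequality. The summand \<open>p k\<close> stands for the event that the partial
  sums first leave the interval of radius about \<open>4 * \<epsilon>\<close> with the summand \<open>\<xi> k\<close>; then \<open>T N n\<close> is
  still large unless the remaining sum \<open>T (Suc k) n\<close> moves back. Since that remaining sum is
  independent of \<open>p k\<close>, the variable \<open>p k * (\<phi> (T (Suc k) n) - \<delta>)\<close> has nonpositive expectation.
  Subtracting \<open>\<delta>\<close> before summing over \<open>k\<close> matters, because \<open>\<Sum>k. R (p k)\<close> need not be bounded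
  although \<open>\<Sum>k. p k \<le> 1\<close>.
\<close>

lemma ottaviani:
  assumes "N \<le> n" and "0 < \<epsilon>" and "0 \<le> \<delta>"
    and tail: "\<And>k. N \<le> k \<Longrightarrow> k \<le> n \<Longrightarrow> R (\<lambda>\<omega>. ramp \<epsilon> (2 * \<epsilon>) (T k n \<omega>)) \<le> \<delta>"
  shows "R (\<lambda>\<omega>. 1 - (\<Prod>k\<in>{N..<n}. 1 - ramp (4 * \<epsilon>) (5 * \<epsilon>) (T N (Suc k) \<omega>))) \<le> 2 * \<delta>"
proof -
  let ?\<phi> = "ramp \<epsilon> (2 * \<epsilon>)" and ?\<psi> = "ramp (4 * \<epsilon>) (5 * \<epsilon>)"
  define Q where "Q k \<omega> = (\<Prod>i\<in>{N..<k}. 1 - ?\<psi> (T N (Suc i) \<omega>))" for k \<omega>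
  define p where "p k \<omega> = ?\<psi> (T N (Suc k) \<omega>) * Q k \<omega>" for k \<omega>
  have BL: "real_BL ?\<phi>" "real_BL ?\<psi>" "real_BL (\<lambda>x. 1 - ?\<psi> x)" "real_BL (\<lambda>x. - \<delta> + ?\<phi> x)"
    using \<open>0 < \<epsilon>\<close>
    by (intro bounded_lipschitz_add bounded_lipschitz_diff bounded_lipschitz_const real_BL_ramp; simp)+
  have Q_past: "Q k \<in> past k" for k
    unfolding Q_def by (intro past_prod past_T[OF BL(3)]) auto
  have p_past: "p k \<in> past (Suc k)" for k
    unfolding p_def by (intro past_mult past_T[OF BL(2)] past_mono[OF Q_past]) auto
  have Q_nonneg: "0 \<le> Q k \<omega>" for k \<omega>
    unfolding Q_def by (intro prod_nonneg) (simp add: ramp_le_1)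
  have p_nonneg: "0 \<le> p k \<omega>" for k \<omega>
    unfolding p_def by (intro mult_nonneg_nonneg ramp_ge_0 Q_nonneg)
  have sum_p: "(\<Sum>k\<in>{N..<n}. p k \<omega>) = 1 - Q n \<omega>" for \<omega>
    using \<open>N \<le> n\<close>
  proof (induction n rule: dec_induct)
    case (step n)
    then show ?case by (simp add: p_def Q_def algebra_simps)
  qed (simp add: Q_def)
  have future: "(\<lambda>\<omega>. p k \<omega> * (- \<delta> + ?\<phi> (T (Suc k) n \<omega>))) \<in> bounded_rv" if "k < n" for k
    using that by (intro past_bounded_rv[of _ n] past_mult past_T[OF BL(4)] past_mono[OF p_past]) auto
  have future_le: "R (\<lambda>\<omega>. p k \<omega> * (- \<delta> + ?\<phi> (T (Suc k) n \<omega>))) \<le> 0" if "k \<in> {N..<n}" for k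
  proof -
    have *: "R (\<lambda>\<omega>. - \<delta> + ?\<phi> (T (Suc k) n \<omega>)) \<le> 0"
      unfolding R_translate[OF T_bounded_rv[OF BL(1)]] using tail[of "Suc k"] that by simp
    have "R (\<lambda>\<omega>. p k \<omega> * (- \<delta> + ?\<phi> (T (Suc k) n \<omega>)))
        = R (\<lambda>\<omega>. p k \<omega> * R (\<lambda>\<omega>'. - \<delta> + ?\<phi> (T (Suc k) n \<omega>')))"
      using that by (intro integrate_future_sum p_past p_nonneg BL) auto
    also have "\<dots> \<le> 0"
    proof (rule R_le_const)
      show "(\<lambda>\<omega>. p k \<omega> * R (\<lambda>\<omega>'. - \<delta> + ?\<phi> (T (Suc k) n \<omega>'))) \<in> bounded_rv"
        by (rule past_bounded_rv[OF past_mult[OF p_past past_const]])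
      show "p k \<omega> * R (\<lambda>\<omega>'. - \<delta> + ?\<phi> (T (Suc k) n \<omega>')) \<le> 0" for \<omega>
        by (rule mult_nonneg_nonpos[OF p_nonneg *])
    qed
    finally show ?thesis .
  qed
  have "1 - Q n \<omega> \<le> (\<delta> + ?\<phi> (T N n \<omega>)) + (\<Sum>k\<in>{N..<n}. p k \<omega> * (- \<delta> + ?\<phi> (T (Suc k) n \<omega>)))"
    for \<omega>
  proof -
    let ?s = "\<Sum>k\<in>{N..<n}. p k \<omega>"
    have s: "?s \<le> 1" unfolding sum_p using Q_nonneg by simp
    have "p k \<omega> \<le> (\<delta> + ?\<phi> (T N n \<omega>)) * p k \<omega> + p k \<omega> * (- \<delta> + ?\<phi> (T (Suc k) n \<omega>))"
      if "k \<in> {N..<n}" for k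
    proof (cases "?\<psi> (T N (Suc k) \<omega>) = 0")
      case False
      have "4 * \<epsilon> < \<bar>T N (Suc k) \<omega>\<bar>"
        using False ramp_eq_0[of "4 * \<epsilon>" "5 * \<epsilon>" "T N (Suc k) \<omega>"] \<open>0 < \<epsilon>\<close> by linarith
      moreover have "T N n \<omega> = T N (Suc k) \<omega> + T (Suc k) n \<omega>"
        using that by (intro sum.atLeastLessThan_concat[symmetric]) auto
      ultimately have "2 * \<epsilon> \<le> \<bar>T N n \<omega>\<bar> \<or> 2 * \<epsilon> \<le> \<bar>T (Suc k) n \<omega>\<bar>" by linarith
      then have "1 \<le> ?\<phi> (T N n \<omega>) + ?\<phi> (T (Suc k) n \<omega>)"
        using ramp_eq_1[of \<epsilon> "2 * \<epsilon>"] ramp_ge_0[of \<epsilon> "2 * \<epsilon>"] \<open>0 < \<epsilon>\<close>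
        by (metis add.commute add_increasing dual_order.refl less_add_same_cancel1 mult_2)
      from mult_left_mono[OF this p_nonneg] show ?thesis by (simp add: algebra_simps)
    qed (simp add: p_def)
    then have "?s \<le> (\<Sum>k\<in>{N..<n}. (\<delta> + ?\<phi> (T N n \<omega>)) * p k \<omega>
        + p k \<omega> * (- \<delta> + ?\<phi> (T (Suc k) n \<omega>)))"
      by (rule sum_mono)
    also have "\<dots> = (\<delta> + ?\<phi> (T N n \<omega>)) * ?s + (\<Sum>k\<in>{N..<n}. p k \<omega> * (- \<delta> + ?\<phi> (T (Suc k) n \<omega>)))"
      by (simp add: sum.distrib sum_distrib_left)
    also have "(\<delta> + ?\<phi> (T N n \<omega>)) * ?s \<le> (\<delta> + ?\<phi> (T N n \<omega>)) * 1"
      using \<open>0 \<le> \<delta>\<close> ramp_ge_0 s by (intro mult_left_mono add_nonneg_nonneg) auto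
    finally show ?thesis unfolding sum_p by simp
  qed
  then have "R (\<lambda>\<omega>. 1 - Q n \<omega>)
      \<le> R (\<lambda>\<omega>. (\<delta> + ?\<phi> (T N n \<omega>)) + (\<Sum>k\<in>{N..<n}. p k \<omega> * (- \<delta> + ?\<phi> (T (Suc k) n \<omega>))))"
    by (intro R_mono bounded_rv_diff bounded_rv_add bounded_rv_const bounded_rv_sum
        T_bounded_rv BL future past_bounded_rv[OF Q_past]) auto
  also have "\<dots> \<le> R (\<lambda>\<omega>. \<delta> + ?\<phi> (T N n \<omega>))
      + R (\<lambda>\<omega>. \<Sum>k\<in>{N..<n}. p k \<omega> * (- \<delta> + ?\<phi> (T (Suc k) n \<omega>)))"
    by (intro R_add bounded_rv_add bounded_rv_const bounded_rv_sum T_bounded_rv BL future) auto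
  also have "R (\<lambda>\<omega>. \<delta> + ?\<phi> (T N n \<omega>)) = \<delta> + R (\<lambda>\<omega>. ?\<phi> (T N n \<omega>))"
    by (rule R_translate[OF T_bounded_rv[OF BL(1)]])
  also have "\<dots> \<le> 2 * \<delta>" using tail[of N] \<open>N \<le> n\<close> by simp
  also have "R (\<lambda>\<omega>. \<Sum>k\<in>{N..<n}. p k \<omega> * (- \<delta> + ?\<phi> (T (Suc k) n \<omega>)))
      \<le> (\<Sum>k\<in>{N..<n}. R (\<lambda>\<omega>. p k \<omega> * (- \<delta> + ?\<phi> (T (Suc k) n \<omega>))))"
    by (intro R_sum_le future) auto
  also have "\<dots> \<le> 0" by (intro sum_nonpos future_le)
  finally show ?thesis unfolding Q_def by simp
qed

end

section \<open>Cauchy sums in capacity\<close>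

lemma sum_le_1_of_prod_ge_half:
  fixes x :: "'i \<Rightarrow> real"
  assumes "finite I" and "\<And>i. i \<in> I \<Longrightarrow> x i \<le> 1" and half: "1 / 2 \<le> (\<Prod>i\<in>I. 1 - x i)"
  shows "(\<Sum>i\<in>I. x i) \<le> 1"
proof (rule ccontr)
  assume "\<not> (\<Sum>i\<in>I. x i) \<le> 1"
  have "(\<Prod>i\<in>I. 1 - x i) \<le> (\<Prod>i\<in>I. exp (- x i))"
  proof (rule prod_mono)
    show "0 \<le> 1 - x i \<and> 1 - x i \<le> exp (- x i)" if "i \<in> I" for i
      using assms(2)[OF that] exp_ge_add_one_self[of "- x i"] by simp
  qed
  also have "\<dots> = exp (- (\<Sum>i\<in>I. x i))"
    using \<open>finite I\<close> by (simp add: exp_sum sum_negf[symmetric])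
  also have "\<dots> < exp (- 1)"
    using \<open>\<not> (\<Sum>i\<in>I. x i) \<le> 1\<close> by simp
  also have "\<dots> \<le> 1 / 2"
    using exp_ge_add_one_self[of 1] by (simp add: exp_minus field_simps)
  finally show False using half by simp
qed

lemma summable_of_bounded_tail_sums:
  fixes a :: "nat \<Rightarrow> real"
  assumes "\<And>i. 0 \<le> a i" and "\<And>n. N \<le> n \<Longrightarrow> (\<Sum>i\<in>{N..<n}. a i) \<le> C"
  shows "summable a"
proof -
  have "summable (\<lambda>i. a (i + N))"
  proof (rule summableI_nonneg_bounded)
    show "(\<Sum>i<n. a (i + N)) \<le> C" for n
      using assms(2)[of "n + N"] sum.shift_bounds_nat_ivl[of a 0 N n]
      by (simp add: atLeast0LessThan)
  qed (rule assms(1))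
  then show ?thesis by (simp add: summable_iff_shift)
qed

lemma summable_tail_small:
  fixes f :: "nat \<Rightarrow> real"
  assumes "summable f" and "0 < e"
  obtains N where "\<And>m n. N \<le> m \<Longrightarrow> \<bar>\<Sum>i\<in>{m..<n}. f i\<bar> < e"
  using assms unfolding summable_Cauchy real_norm_def by blast

context sublinear_expectation_space
begin

definition sums_Cauchy :: "(nat \<Rightarrow> 'a \<Rightarrow> real) \<Rightarrow> bool" where
  "sums_Cauchy \<xi> \<longleftrightarrow> (\<forall>\<epsilon>>0. \<forall>\<delta>>0. \<exists>N. \<forall>m n. N \<le> m \<longrightarrow> m \<le> n \<longrightarrow>
     V {\<omega> \<in> space M. \<epsilon> \<le> \<bar>\<Sum>i\<in>{m..<n}. \<xi> i \<omega>\<bar>} < ereal \<delta>)"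

lemma sums_CauchyD:
  assumes "sums_Cauchy \<xi>" and "0 < \<epsilon>" and "0 < \<delta>"
  obtains N where "\<And>m n. N \<le> m \<Longrightarrow> m \<le> n \<Longrightarrow>
    V {\<omega> \<in> space M. \<epsilon> \<le> \<bar>\<Sum>i\<in>{m..<n}. \<xi> i \<omega>\<bar>} < ereal \<delta>"
  using assms unfolding sums_Cauchy_def by blast

lemma sums_Cauchy_uminus: "sums_Cauchy \<xi> \<Longrightarrow> sums_Cauchy (\<lambda>i \<omega>. - \<xi> i \<omega>)"
  unfolding sums_Cauchy_def by (simp add: sum_negf)

lemma sum_capacity_real: "(\<Sum>i\<in>I. V (A i)) = ereal (\<Sum>i\<in>I. real_of_ereal (V (A i)))"
proof -
  have "(\<Sum>i\<in>I. V (A i)) = (\<Sum>i\<in>I. ereal (real_of_ereal (V (A i))))"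
    by (intro sum.cong refl capacity_real)
  then show ?thesis by simp
qed

text \<open>
  With \<open>B i\<close> the event that \<open>\<bar>\<xi> i\<bar>\<close> exceeds \<open>c\<close>, this passes from a sequence to its truncation
  at \<open>c\<close> and back.
\<close>

lemma sums_Cauchy_cong:
  assumes except: "summable (\<lambda>i. real_of_ereal (V (B i)))"
    and eq: "\<And>i \<omega>. \<omega> \<in> space M \<Longrightarrow> \<omega> \<notin> B i \<Longrightarrow> \<zeta> i \<omega> = \<eta> i \<omega>"
    and \<eta>: "sums_Cauchy \<eta>"
  shows "sums_Cauchy \<zeta>"
  unfolding sums_Cauchy_def
proof (intro allI impI)
  fix \<epsilon> \<delta> :: real assume "0 < \<epsilon>" "0 < \<delta>"
  obtain N1 where N1: "\<And>m n. N1 \<le> m \<Longrightarrow> \<bar>\<Sum>i\<in>{m..<n}. real_of_ereal (V (B i))\<bar> < \<delta> / 2"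
    using summable_tail_small[OF except, of "\<delta> / 2"] \<open>0 < \<delta>\<close> by auto
  obtain N2 where N2: "\<And>m n. N2 \<le> m \<Longrightarrow> m \<le> n \<Longrightarrow>
      V {\<omega> \<in> space M. \<epsilon> \<le> \<bar>\<Sum>i\<in>{m..<n}. \<eta> i \<omega>\<bar>} < ereal (\<delta> / 2)"
    using sums_CauchyD[OF \<eta> \<open>0 < \<epsilon>\<close>, of "\<delta> / 2"] \<open>0 < \<delta>\<close> by auto
  have "V {\<omega> \<in> space M. \<epsilon> \<le> \<bar>\<Sum>i\<in>{m..<n}. \<zeta> i \<omega>\<bar>} < ereal \<delta>"
    if mn: "max N1 N2 \<le> m" "m \<le> n" for m n
  proof -
    have "V {\<omega> \<in> space M. \<epsilon> \<le> \<bar>\<Sum>i\<in>{m..<n}. \<zeta> i \<omega>\<bar>}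
        \<le> V (\<Union>i\<in>{m..<n}. B i) + V {\<omega> \<in> space M. \<epsilon> \<le> \<bar>\<Sum>i\<in>{m..<n}. \<eta> i \<omega>\<bar>}"
    proof (rule capacity_subadd)
      fix \<omega> assume \<omega>: "\<omega> \<in> space M" "\<omega> \<in> {\<omega> \<in> space M. \<epsilon> \<le> \<bar>\<Sum>i\<in>{m..<n}. \<zeta> i \<omega>\<bar>}"
      show "\<omega> \<in> (\<Union>i\<in>{m..<n}. B i) \<or> \<omega> \<in> {\<omega> \<in> space M. \<epsilon> \<le> \<bar>\<Sum>i\<in>{m..<n}. \<eta> i \<omega>\<bar>}"
      proof (cases "\<omega> \<in> (\<Union>i\<in>{m..<n}. B i)")
        case False
        then have "(\<Sum>i\<in>{m..<n}. \<zeta> i \<omega>) = (\<Sum>i\<in>{m..<n}. \<eta> i \<omega>)"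
          using \<omega> by (intro sum.cong eq) auto
        then show ?thesis using \<omega> by simp
      qed simp
    qed
    also have "\<dots> < ereal (\<delta> / 2) + ereal (\<delta> / 2)"
    proof (rule ereal_add_strict_mono2)
      have "V (\<Union>i\<in>{m..<n}. B i) \<le> ereal (\<Sum>i\<in>{m..<n}. real_of_ereal (V (B i)))"
        using capacity_UN_le[of "{m..<n}" B] unfolding sum_capacity_real by simp
      also have "\<dots> < ereal (\<delta> / 2)" using N1[of m n] mn by simp
      finally show "V (\<Union>i\<in>{m..<n}. B i) < ereal (\<delta> / 2)" .
      show "V {\<omega> \<in> space M. \<epsilon> \<le> \<bar>\<Sum>i\<in>{m..<n}. \<eta> i \<omega>\<bar>} < ereal (\<delta> / 2)"
        using N2 mn by simp
    qed
    finally show ?thesis by simp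
  qed
  then show "\<exists>N. \<forall>m n. N \<le> m \<longrightarrow> m \<le> n \<longrightarrow>
      V {\<omega> \<in> space M. \<epsilon> \<le> \<bar>\<Sum>i\<in>{m..<n}. \<zeta> i \<omega>\<bar>} < ereal \<delta>"
    by blast
qed

lemma R_square_shift_le:
  assumes Y: "Y \<in> H" "\<And>\<omega>. \<bar>Y \<omega>\<bar> \<le> c"
  shows "(\<lambda>\<omega>. (Y \<omega> - y)\<^sup>2) \<in> bounded_rv"
    and "R (\<lambda>\<omega>. (Y \<omega> - x)\<^sup>2) \<le> 2 * R (\<lambda>\<omega>. (Y \<omega> - y)\<^sup>2) + 2 * (x - y)\<^sup>2"
proof -
  have "real_BL (\<lambda>u. (clamp (c + \<bar>z\<bar>) (u + - z))\<^sup>2)" for z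
    by (intro bounded_lipschitz_power real_BL_shift real_BL_clamp)
  from bounded_rv_real_BL[OF this Y(1)]
  have "(\<lambda>\<omega>. (clamp (c + \<bar>z\<bar>) (Y \<omega> + - z))\<^sup>2) \<in> bounded_rv" for z .
  moreover have "clamp (c + \<bar>z\<bar>) (Y \<omega> + - z) = Y \<omega> - z" for z \<omega>
  proof -
    have "\<bar>Y \<omega> + - z\<bar> \<le> c + \<bar>z\<bar>" using Y(2)[of \<omega>] by linarith
    from clamp_id[OF this] show ?thesis by simp
  qed
  ultimately have sq: "(\<lambda>\<omega>. (Y \<omega> - z)\<^sup>2) \<in> bounded_rv" for z by simp
  show "(\<lambda>\<omega>. (Y \<omega> - y)\<^sup>2) \<in> bounded_rv" by (rule sq)
  have "R (\<lambda>\<omega>. (Y \<omega> - x)\<^sup>2) \<le> R (\<lambda>\<omega>. 2 * (x - y)\<^sup>2 + 2 * (Y \<omega> - y)\<^sup>2)"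
  proof (rule R_mono[OF sq bounded_rv_add[OF bounded_rv_const bounded_rv_scale[OF sq]]])
    show "(Y \<omega> - x)\<^sup>2 \<le> 2 * (x - y)\<^sup>2 + 2 * (Y \<omega> - y)\<^sup>2" for \<omega>
    proof -
      have "0 \<le> ((Y \<omega> - y) + (x - y))\<^sup>2" by simp
      then show ?thesis by (simp add: power2_eq_square algebra_simps)
    qed
  qed
  also have "\<dots> = 2 * (x - y)\<^sup>2 + 2 * R (\<lambda>\<omega>. (Y \<omega> - y)\<^sup>2)"
    using R_translate[OF bounded_rv_scale[OF sq]] R_scale[OF sq, of 2] by simp
  finally show "R (\<lambda>\<omega>. (Y \<omega> - x)\<^sup>2) \<le> 2 * R (\<lambda>\<omega>. (Y \<omega> - y)\<^sup>2) + 2 * (x - y)\<^sup>2" by simp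
qed

lemma summable_R_square_shift:
  assumes Y: "\<And>i. Y i \<in> H" "\<And>i \<omega>. \<bar>Y i \<omega>\<bar> \<le> c"
    and y: "summable (\<lambda>i. R (\<lambda>\<omega>. (Y i \<omega> - y i)\<^sup>2))" and xy: "summable (\<lambda>i. (x i - y i)\<^sup>2)"
  shows "summable (\<lambda>i. R (\<lambda>\<omega>. (Y i \<omega> - x i)\<^sup>2))"
proof (rule summable_comparison_test')
  show "summable (\<lambda>i. 2 * R (\<lambda>\<omega>. (Y i \<omega> - y i)\<^sup>2) + 2 * (x i - y i)\<^sup>2)"
    by (intro summable_add summable_mult y xy)
  show "norm (R (\<lambda>\<omega>. (Y i \<omega> - x i)\<^sup>2)) \<le> 2 * R (\<lambda>\<omega>. (Y i \<omega> - y i)\<^sup>2) + 2 * (x i - y i)\<^sup>2" for i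
  proof -
    have "0 \<le> R (\<lambda>\<omega>. (Y i \<omega> - x i)\<^sup>2)"
      by (rule const_le_R[OF R_square_shift_le(1)[OF Y]]) simp
    then show ?thesis
      unfolding real_norm_def using R_square_shift_le(2)[OF Y, of i "x i" "y i"] by linarith
  qed
qed

text \<open>
  The gap \<open>R Y + R (- Y)\<close> between the upper and the lower mean is nonnegative and bounded, so
  the squares of a summable family of gaps are summable as well.
\<close>

lemma summable_mean_gap_square:
  assumes Y: "\<And>i. Y i \<in> H" "\<And>i \<omega>. \<bar>Y i \<omega>\<bar> \<le> c"
    and up: "summable (\<lambda>i. R (Y i))" and low: "summable (\<lambda>i. R (\<lambda>\<omega>. - Y i \<omega>))"
  shows "summable (\<lambda>i. (R (Y i) + R (\<lambda>\<omega>. - Y i \<omega>))\<^sup>2)"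
proof (rule summable_comparison_test')
  show "summable (\<lambda>i. 2 * c * (R (Y i) + R (\<lambda>\<omega>. - Y i \<omega>)))"
    by (intro summable_mult summable_add up low)
  show "norm ((R (Y i) + R (\<lambda>\<omega>. - Y i \<omega>))\<^sup>2) \<le> 2 * c * (R (Y i) + R (\<lambda>\<omega>. - Y i \<omega>))" for i
  proof -
    have Yb: "Y i \<in> bounded_rv" by (rule bounded_rvI[OF Y])
    have "0 \<le> R (Y i) + R (\<lambda>\<omega>. - Y i \<omega>)" using R_uminus_le[OF Yb] by simp
    moreover have "R (Y i) + R (\<lambda>\<omega>. - Y i \<omega>) \<le> 2 * c"
    proof -
      have "\<bar>R (Y i)\<bar> \<le> c" by (rule abs_R_le[OF Yb Y(2)])
      moreover have "\<bar>R (\<lambda>\<omega>. - Y i \<omega>)\<bar> \<le> c"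
        by (rule abs_R_le[OF bounded_rv_uminus[OF Yb]]) (simp add: Y(2))
      ultimately show ?thesis by linarith
    qed
    ultimately show ?thesis by (simp add: power2_eq_square mult_right_mono)
  qed
qed

end

context independent_sequence
begin

section \<open>Sufficiency of the three series\<close>

lemma capacity_upper_tail_le:
  assumes K: "\<And>i \<omega>. \<bar>\<xi> i \<omega>\<bar> \<le> K" and mean: "\<And>i. R (\<xi> i) \<le> 0" and "m \<le> n" and "0 < \<eta>"
  shows "V {\<omega> \<in> space M. \<eta> \<le> T m n \<omega>} \<le> ereal ((\<Sum>i\<in>{m..<n}. R (\<lambda>\<omega>. (\<xi> i \<omega>)\<^sup>2)) / \<eta>\<^sup>2)"
proof -
  define B where "B = real (n - m) * K"
  have "clamp B (T m n \<omega>) = T m n \<omega>" for \<omega>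
    unfolding B_def by (intro clamp_id abs_T_le[OF K])
  moreover have "(\<lambda>\<omega>. (max 0 (clamp B (T m n \<omega>)))\<^sup>2) \<in> bounded_rv"
    by (rule T_bounded_rv[OF bounded_lipschitz_power[OF bounded_lipschitz_pos_part[OF real_BL_clamp]]])
  ultimately have sq: "(\<lambda>\<omega>. (max 0 (T m n \<omega>))\<^sup>2) \<in> bounded_rv" by simp
  have "V {\<omega> \<in> space M. \<eta> \<le> T m n \<omega>} \<le> ereal (R (\<lambda>\<omega>. (1 / \<eta>\<^sup>2) * (max 0 (T m n \<omega>))\<^sup>2))"
  proof (rule capacity_le_R[OF bounded_rv_scale[OF sq]])
    show "indicator {\<omega> \<in> space M. \<eta> \<le> T m n \<omega>} \<omega> \<le> (1 / \<eta>\<^sup>2) * (max 0 (T m n \<omega>))\<^sup>2" for \<omega>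
    proof (cases "\<eta> \<le> T m n \<omega>")
      case True
      then have "\<eta>\<^sup>2 \<le> (max 0 (T m n \<omega>))\<^sup>2" using \<open>0 < \<eta>\<close> by (intro power_mono) auto
      then have "1 \<le> (1 / \<eta>\<^sup>2) * (max 0 (T m n \<omega>))\<^sup>2" using \<open>0 < \<eta>\<close> by (simp add: field_simps)
      then show ?thesis using indicator_le_1 order_trans by blast
    qed simp
  qed
  also have "R (\<lambda>\<omega>. (1 / \<eta>\<^sup>2) * (max 0 (T m n \<omega>))\<^sup>2) = (1 / \<eta>\<^sup>2) * R (\<lambda>\<omega>. (max 0 (T m n \<omega>))\<^sup>2)"
    by (intro R_scale sq) simp
  also have "\<dots> \<le> (1 / \<eta>\<^sup>2) * (\<Sum>i\<in>{m..<n}. R (\<lambda>\<omega>. (\<xi> i \<omega>)\<^sup>2))"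
    by (intro mult_left_mono pos_part_square_sum_le[OF K mean \<open>m \<le> n\<close>]) simp
  finally show ?thesis by simp
qed

text \<open>
  The upper tail of the sums is that of \<open>\<xi> i - R (\<xi> i)\<close> and the lower tail is the upper tail of
  \<open>- \<xi> i - R (- \<xi> i)\<close>; both have upper mean \<open>0\<close>, and the removed means have small sums.
\<close>

lemma sums_Cauchy_of_series:
  assumes c: "\<And>i \<omega>. \<bar>\<xi> i \<omega>\<bar> \<le> c"
    and up: "summable (\<lambda>i. R (\<xi> i))" and low: "summable (\<lambda>i. R (\<lambda>\<omega>. - \<xi> i \<omega>))"
    and up_sq: "summable (\<lambda>i. R (\<lambda>\<omega>. (\<xi> i \<omega> - R (\<xi> i))\<^sup>2))"
    and low_sq: "summable (\<lambda>i. R (\<lambda>\<omega>. (\<xi> i \<omega> - - R (\<lambda>\<omega>'. - \<xi> i \<omega>'))\<^sup>2))"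
  shows "sums_Cauchy \<xi>"
proof -
  define a where "a i = R (\<xi> i)" for i
  define b where "b i = R (\<lambda>\<omega>. - \<xi> i \<omega>)" for i
  have \<xi>b: "\<xi> i \<in> bounded_rv" for i by (rule bounded_rvI[OF \<xi>_H c])
  interpret Z: independent_sequence M H E "\<lambda>i \<omega>. \<xi> i \<omega> - a i"
    by (rule independent_sequence_lipschitz[where h = "\<lambda>i x. x - a i"]) simp
  interpret W: independent_sequence M H E "\<lambda>i \<omega>. - \<xi> i \<omega> - b i"
    by (rule independent_sequence_lipschitz[where h = "\<lambda>i x. - x - b i"]) simp
  have a_le: "\<bar>a i\<bar> \<le> c" for i unfolding a_def by (rule abs_R_le[OF \<xi>b c])
  have b_le: "\<bar>b i\<bar> \<le> c" for i
    unfolding b_def by (rule abs_R_le[OF bounded_rv_uminus[OF \<xi>b]]) (simp add: c)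
  have Z: "\<bar>\<xi> i \<omega> - a i\<bar> \<le> 2 * c" "R (\<lambda>\<omega>. \<xi> i \<omega> - a i) \<le> 0" for i \<omega>
  proof -
    show "\<bar>\<xi> i \<omega> - a i\<bar> \<le> 2 * c" using c[of i \<omega>] a_le[of i] by linarith
    show "R (\<lambda>\<omega>. \<xi> i \<omega> - a i) \<le> 0"
      using R_translate[OF \<xi>b, of "- a i" i] by (simp add: a_def)
  qed
  have W: "\<bar>- \<xi> i \<omega> - b i\<bar> \<le> 2 * c" "R (\<lambda>\<omega>. - \<xi> i \<omega> - b i) \<le> 0" for i \<omega>
  proof -
    show "\<bar>- \<xi> i \<omega> - b i\<bar> \<le> 2 * c" using c[of i \<omega>] b_le[of i] by linarith
    have "R (\<lambda>\<omega>. - b i + - \<xi> i \<omega>) = - b i + R (\<lambda>\<omega>. - \<xi> i \<omega>)"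
      by (rule R_translate[OF bounded_rv_uminus[OF \<xi>b]])
    moreover have "(\<lambda>\<omega>. - \<xi> i \<omega> - b i) = (\<lambda>\<omega>. - b i + - \<xi> i \<omega>)" by auto
    ultimately show "R (\<lambda>\<omega>. - \<xi> i \<omega> - b i) \<le> 0" by (simp add: b_def)
  qed
  show ?thesis
    unfolding sums_Cauchy_def
  proof (intro allI impI)
    fix \<epsilon> \<delta> :: real assume "0 < \<epsilon>" "0 < \<delta>"
    define e where "e = \<delta> / 2 * (\<epsilon> / 2)\<^sup>2"
    have "0 < e" using \<open>0 < \<epsilon>\<close> \<open>0 < \<delta>\<close> by (simp add: e_def)
    have "summable a" unfolding a_def[abs_def] by (rule up)
    have "summable b" unfolding b_def[abs_def] by (rule low)
    obtain N1 where N1: "\<And>m n. N1 \<le> m \<Longrightarrow> \<bar>\<Sum>i\<in>{m..<n}. a i\<bar> < \<epsilon> / 2"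
      using summable_tail_small[OF \<open>summable a\<close>, of "\<epsilon> / 2"] \<open>0 < \<epsilon>\<close> by auto
    obtain N2 where N2: "\<And>m n. N2 \<le> m \<Longrightarrow> \<bar>\<Sum>i\<in>{m..<n}. b i\<bar> < \<epsilon> / 2"
      using summable_tail_small[OF \<open>summable b\<close>, of "\<epsilon> / 2"] \<open>0 < \<epsilon>\<close> by auto
    obtain N3 where N3: "\<And>m n. N3 \<le> m \<Longrightarrow> \<bar>\<Sum>i\<in>{m..<n}. R (\<lambda>\<omega>. (\<xi> i \<omega> - a i)\<^sup>2)\<bar> < e"
      using summable_tail_small[OF up_sq \<open>0 < e\<close>] unfolding a_def by auto
    have flip: "(\<xi> i \<omega> - - R (\<lambda>\<omega>'. - \<xi> i \<omega>'))\<^sup>2 = (- \<xi> i \<omega> - b i)\<^sup>2" for i \<omega>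
      by (simp add: b_def power2_eq_square algebra_simps)
    obtain N4 where N4: "\<And>m n. N4 \<le> m \<Longrightarrow> \<bar>\<Sum>i\<in>{m..<n}. R (\<lambda>\<omega>. (- \<xi> i \<omega> - b i)\<^sup>2)\<bar> < e"
      using summable_tail_small[OF low_sq \<open>0 < e\<close>] unfolding flip by auto
    have "V {\<omega> \<in> space M. \<epsilon> \<le> \<bar>T m n \<omega>\<bar>} < ereal \<delta>"
      if mn: "Max {N1, N2, N3, N4} \<le> m" "m \<le> n" for m n
    proof -
      let ?A = "{\<omega> \<in> space M. \<epsilon> / 2 \<le> (\<Sum>i\<in>{m..<n}. \<xi> i \<omega> - a i)}"
      let ?B = "{\<omega> \<in> space M. \<epsilon> / 2 \<le> (\<Sum>i\<in>{m..<n}. - \<xi> i \<omega> - b i)}"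
      have "V {\<omega> \<in> space M. \<epsilon> \<le> \<bar>T m n \<omega>\<bar>} \<le> V ?A + V ?B"
      proof (rule capacity_subadd)
        fix \<omega> assume \<omega>: "\<omega> \<in> space M" "\<omega> \<in> {\<omega> \<in> space M. \<epsilon> \<le> \<bar>T m n \<omega>\<bar>}"
        have "(\<Sum>i\<in>{m..<n}. \<xi> i \<omega> - a i) = T m n \<omega> - (\<Sum>i\<in>{m..<n}. a i)"
          and "(\<Sum>i\<in>{m..<n}. - \<xi> i \<omega> - b i) = - T m n \<omega> - (\<Sum>i\<in>{m..<n}. b i)"
          by (simp_all add: sum_subtractf sum_negf)
        then show "\<omega> \<in> ?A \<or> \<omega> \<in> ?B"
          using \<omega> N1[of m n] N2[of m n] mn by auto
      qed
      also have "\<dots> < ereal (\<delta> / 2) + ereal (\<delta> / 2)"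
      proof (rule ereal_add_strict_mono2)
        have small: "x / (\<epsilon> / 2)\<^sup>2 < \<delta> / 2" if "\<bar>x\<bar> < e" for x
          using that \<open>0 < \<epsilon>\<close> by (simp add: e_def divide_less_eq)
        have "0 < \<epsilon> / 2" using \<open>0 < \<epsilon>\<close> by simp
        have "V ?A \<le> ereal ((\<Sum>i\<in>{m..<n}. R (\<lambda>\<omega>. (\<xi> i \<omega> - a i)\<^sup>2)) / (\<epsilon> / 2)\<^sup>2)"
          by (rule Z.capacity_upper_tail_le[OF Z mn(2) \<open>0 < \<epsilon> / 2\<close>])
        also have "\<dots> < ereal (\<delta> / 2)" using small[OF N3[of m n]] mn by simp
        finally show "V ?A < ereal (\<delta> / 2)" .
        have "V ?B \<le> ereal ((\<Sum>i\<in>{m..<n}. R (\<lambda>\<omega>. (- \<xi> i \<omega> - b i)\<^sup>2)) / (\<epsilon> / 2)\<^sup>2)"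
          by (rule W.capacity_upper_tail_le[OF W mn(2) \<open>0 < \<epsilon> / 2\<close>])
        also have "\<dots> < ereal (\<delta> / 2)" using small[OF N4[of m n]] mn by simp
        finally show "V ?B < ereal (\<delta> / 2)" .
      qed
      finally show ?thesis by simp
    qed
    then show "\<exists>N. \<forall>m n. N \<le> m \<longrightarrow> m \<le> n \<longrightarrow> V {\<omega> \<in> space M. \<epsilon> \<le> \<bar>T m n \<omega>\<bar>} < ereal \<delta>"
      by blast
  qed
qed

section \<open>Necessity of the three series\<close>

text \<open>
  A large summand makes one of two consecutive partial sums large, so the maximal inequality
  bounds \<open>R (1 - \<Prod>(1 - g (\<xi> i)))\<close> by \<open>1 / 2\<close>, where \<open>g\<close> approximates the indicator of
  \<open>\<bar>x\<bar> > c\<close>. By independence the product comes out of \<open>R\<close>, and \<open>\<Prod>(1 - R (g (\<xi> i))) \<ge> 1 / 2\<close>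
  forces \<open>\<Sum>R (g (\<xi> i)) \<le> 1\<close>.
\<close>

lemma summable_capacity_exceed:
  assumes "sums_Cauchy \<xi>" and "0 < c"
  shows "summable (\<lambda>i. real_of_ereal (V {\<omega> \<in> space M. c < \<bar>\<xi> i \<omega>\<bar>}))"
proof -
  \<comment> \<open>A summand beyond \<open>c / 2 = 10 * \<epsilon>\<close> puts one of two consecutive partial sums beyond \<open>5 * \<epsilon>\<close>.\<close>
  define \<epsilon> where "\<epsilon> = c / 20"
  have "0 < \<epsilon>" and c: "c / 2 = 10 * \<epsilon>" using \<open>0 < c\<close> by (auto simp: \<epsilon>_def)
  obtain N where N: "\<And>m n. N \<le> m \<Longrightarrow> m \<le> n \<Longrightarrow>
      V {\<omega> \<in> space M. \<epsilon> \<le> \<bar>T m n \<omega>\<bar>} < ereal (1 / 8)"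
    using sums_CauchyD[OF assms(1) \<open>0 < \<epsilon>\<close>, of "1 / 8"] by auto
  define g where "g = ramp (c / 2) c"
  have g: "real_BL g" "0 \<le> g x" "g x \<le> 1" for x
    unfolding g_def using \<open>0 < c\<close> by (auto intro: real_BL_ramp simp: ramp_ge_0 ramp_le_1)
  have g\<xi>: "(\<lambda>\<omega>. g (\<xi> i \<omega>)) \<in> bounded_rv" for i by (rule bounded_rv_real_BL[OF g(1) \<xi>_H])
  have "(\<Sum>i\<in>{N..<n}. R (\<lambda>\<omega>. g (\<xi> i \<omega>))) \<le> 1" if "N \<le> n" for n
  proof (rule sum_le_1_of_prod_ge_half)
    let ?\<psi> = "ramp (4 * \<epsilon>) (5 * \<epsilon>)"
    have BL: "real_BL ?\<psi>" "real_BL (ramp \<epsilon> (2 * \<epsilon>))" "real_BL (\<lambda>x. 1 - ?\<psi> x)" "real_BL (\<lambda>x. 1 - g x)"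
      using \<open>0 < \<epsilon>\<close> by (intro bounded_lipschitz_diff bounded_lipschitz_const real_BL_ramp g; simp)+
    have "R (\<lambda>\<omega>. ramp \<epsilon> (2 * \<epsilon>) (T k n \<omega>)) \<le> 0 + 1 * (1 / 8)" if "N \<le> k" "k \<le> n" for k
    proof (rule R_le_capacity[OF T_bounded_rv[OF BL(2)] _ N[OF that]])
      show "ramp \<epsilon> (2 * \<epsilon>) (T k n \<omega>) \<le> 0 + 1 * indicator {\<omega> \<in> space M. \<epsilon> \<le> \<bar>T k n \<omega>\<bar>} \<omega>"
        if "\<omega> \<in> space M" for \<omega>
        using that ramp_le_1[of \<epsilon> "2 * \<epsilon>" "T k n \<omega>"] ramp_eq_0[of \<epsilon> "2 * \<epsilon>" "T k n \<omega>"] \<open>0 < \<epsilon>\<close>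
        by (simp add: indicator_def)
    qed simp
    then have max_small: "R (\<lambda>\<omega>. 1 - (\<Prod>k\<in>{N..<n}. 1 - ?\<psi> (T N (Suc k) \<omega>))) \<le> 2 * (1 / 8)"
      using \<open>N \<le> n\<close> \<open>0 < \<epsilon>\<close> by (intro ottaviani) auto
    have prod_g: "(\<lambda>\<omega>. - (\<Prod>i\<in>{N..<n}. 1 - g (\<xi> i \<omega>))) \<in> bounded_rv"
    proof -
      have "(\<lambda>\<omega>. 1 - g (\<xi> i \<omega>)) \<in> past n" if "i \<in> {N..<n}" for i
        using past_sum[OF BL(4), of "{i}" n] that by simp
      then show ?thesis by (intro bounded_rv_uminus past_bounded_rv[OF past_prod])
    qed
    have prod_\<psi>: "(\<lambda>\<omega>. 1 - (\<Prod>k\<in>{N..<n}. 1 - ?\<psi> (T N (Suc k) \<omega>))) \<in> bounded_rv"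
      by (intro bounded_rv_diff bounded_rv_const past_bounded_rv[of _ n] past_prod past_T[OF BL(3)]) auto
    have "1 + - (\<Prod>i\<in>{N..<n}. 1 - g (\<xi> i \<omega>)) \<le> 1 - (\<Prod>k\<in>{N..<n}. 1 - ?\<psi> (T N (Suc k) \<omega>))" for \<omega>
    proof (cases "\<exists>i\<in>{N..<n}. g (\<xi> i \<omega>) \<noteq> 0")
      case False
      have "(\<Prod>k\<in>{N..<n}. 1 - ?\<psi> (T N (Suc k) \<omega>)) \<le> 1"
        by (intro prod_le_1) (simp add: ramp_ge_0 ramp_le_1)
      then show ?thesis using False by simp
    next
      case True
      then obtain i where i: "i \<in> {N..<n}" "g (\<xi> i \<omega>) \<noteq> 0" by blast
      have "10 * \<epsilon> < \<bar>\<xi> i \<omega>\<bar>"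
        using ramp_eq_0[of "c / 2" c "\<xi> i \<omega>"] i(2) \<open>0 < c\<close> unfolding g_def c[symmetric]
        by linarith
      moreover have "T N (Suc i) \<omega> = T N i \<omega> + \<xi> i \<omega>" using i(1) by simp
      ultimately have large: "5 * \<epsilon> \<le> \<bar>T N (Suc i) \<omega>\<bar> \<or> 5 * \<epsilon> \<le> \<bar>T N i \<omega>\<bar>" by linarith
      have "\<exists>k\<in>{N..<n}. 5 * \<epsilon> \<le> \<bar>T N (Suc k) \<omega>\<bar>"
      proof (cases "5 * \<epsilon> \<le> \<bar>T N (Suc i) \<omega>\<bar>")
        case False
        then have "5 * \<epsilon> \<le> \<bar>T N i \<omega>\<bar>" using large by simp
        moreover have "i \<noteq> N" using calculation \<open>0 < \<epsilon>\<close> by auto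
        ultimately show ?thesis using i(1) by (intro bexI[of _ "i - 1"]) auto
      qed (use i in blast)
      then obtain k where "k \<in> {N..<n}" "?\<psi> (T N (Suc k) \<omega>) = 1"
        using ramp_eq_1[of "4 * \<epsilon>" "5 * \<epsilon>"] \<open>0 < \<epsilon>\<close> by auto
      then have "(\<Prod>k\<in>{N..<n}. 1 - ?\<psi> (T N (Suc k) \<omega>)) = 0"
        by (intro prod_zero) auto
      moreover have "0 \<le> (\<Prod>i\<in>{N..<n}. 1 - g (\<xi> i \<omega>))"
        using g(3) by (intro prod_nonneg) simp
      ultimately show ?thesis by linarith
    qed
    then have "R (\<lambda>\<omega>. 1 + - (\<Prod>i\<in>{N..<n}. 1 - g (\<xi> i \<omega>)))
        \<le> R (\<lambda>\<omega>. 1 - (\<Prod>k\<in>{N..<n}. 1 - ?\<psi> (T N (Suc k) \<omega>)))"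
      by (rule R_mono[OF bounded_rv_add[OF bounded_rv_const prod_g] prod_\<psi>])
    also have "R (\<lambda>\<omega>. 1 + - (\<Prod>i\<in>{N..<n}. 1 - g (\<xi> i \<omega>)))
        = 1 - (\<Prod>i\<in>{N..<n}. 1 - R (\<lambda>\<omega>. g (\<xi> i \<omega>)))"
      unfolding R_translate[OF prod_g] R_uminus_prod[OF g \<open>N \<le> n\<close>] by simp
    finally show "1 / 2 \<le> (\<Prod>i\<in>{N..<n}. 1 - R (\<lambda>\<omega>. g (\<xi> i \<omega>)))"
      using max_small by simp
    show "R (\<lambda>\<omega>. g (\<xi> i \<omega>)) \<le> 1" for i by (rule R_le_const[OF g\<xi> g(3)])
  qed simp
  then have sum_g: "summable (\<lambda>i. R (\<lambda>\<omega>. g (\<xi> i \<omega>)))"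
    by (intro summable_of_bounded_tail_sums const_le_R[OF g\<xi> g(2)])
  have "real_of_ereal (V {\<omega> \<in> space M. c < \<bar>\<xi> i \<omega>\<bar>}) \<le> R (\<lambda>\<omega>. g (\<xi> i \<omega>))" for i
  proof -
    have "V {\<omega> \<in> space M. c < \<bar>\<xi> i \<omega>\<bar>} \<le> ereal (R (\<lambda>\<omega>. g (\<xi> i \<omega>)))"
    proof (rule capacity_le_R[OF g\<xi>])
      show "indicator {\<omega> \<in> space M. c < \<bar>\<xi> i \<omega>\<bar>} \<omega> \<le> g (\<xi> i \<omega>)" for \<omega>
        using ramp_eq_1[of "c / 2" c "\<xi> i \<omega>"] \<open>0 < c\<close> g(2)[of "\<xi> i \<omega>"]
        by (simp add: g_def indicator_def)
    qed
    then show ?thesis using capacity_real by (metis ereal_less_eq(3))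
  qed
  then show ?thesis
    by (intro summable_comparison_test'[OF sum_g])
       (simp add: real_of_ereal_pos capacity_nonneg)
qed

text \<open>
  Since \<open>T N n\<close> stays near \<open>0\<close>, so does \<open>1 - cos (t * T N n)\<close>, and the factorisation of the
  characteristic function keeps \<open>\<Prod>\<rho> i\<close> away from \<open>0\<close>. Means only change the phases, so they do
  not interfere and no symmetrisation is called for.
\<close>

lemma summable_variances:
  assumes Cauchy: "sums_Cauchy \<xi>" and "0 < c" and t: "t = 1 / (2 * c)"
    and \<sigma>: "\<And>i. 0 \<le> \<sigma> i" and \<rho>: "\<And>i. 0 \<le> \<rho> i" "\<And>i. \<rho> i \<le> 1 - t\<^sup>2 * \<sigma> i / 8"
    and char: "\<And>i \<theta>. 1 - \<rho> i * cos (\<theta> + \<alpha> i) \<le> R (\<lambda>\<omega>. 1 - cos (\<theta> + t * \<xi> i \<omega>))"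
  shows "summable \<sigma>"
proof -
  have "0 < t" using \<open>0 < c\<close> t by simp
  obtain N where N: "\<And>m n. N \<le> m \<Longrightarrow> m \<le> n \<Longrightarrow>
      V {\<omega> \<in> space M. c \<le> \<bar>T m n \<omega>\<bar>} < ereal (1 / 8)"
    using sums_CauchyD[OF Cauchy \<open>0 < c\<close>, of "1 / 8"] by auto
  have "(\<Sum>i\<in>{N..<n}. t\<^sup>2 * \<sigma> i / 8) \<le> 1" if "N \<le> n" for n
  proof (rule sum_le_1_of_prod_ge_half)
    have cos_rv: "(\<lambda>\<omega>. 1 - cos (0 + t * T N n \<omega>)) \<in> bounded_rv"
      by (rule T_bounded_rv[where g = "\<lambda>x. 1 - cos (0 + t * x)"])
         (intro bounded_lipschitz_diff bounded_lipschitz_const real_BL_cos)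
    have "R (\<lambda>\<omega>. 1 - cos (0 + t * T N n \<omega>)) \<le> 1 / 8 + 2 * (1 / 8)"
    proof (rule R_le_capacity[OF cos_rv _ N[OF order_refl that]])
      fix \<omega> assume "\<omega> \<in> space M"
      show "1 - cos (0 + t * T N n \<omega>)
          \<le> 1 / 8 + 2 * indicator {\<omega> \<in> space M. c \<le> \<bar>T N n \<omega>\<bar>} \<omega>"
      proof (cases "c \<le> \<bar>T N n \<omega>\<bar>")
        case True
        then show ?thesis
          using \<open>\<omega> \<in> space M\<close> cos_ge_minus_one[of "0 + t * T N n \<omega>"]
          by (simp del: cos_ge_minus_one)
      next
        case False
        define x where "x = t * T N n \<omega>"
        have "\<bar>x\<bar> = t * \<bar>T N n \<omega>\<bar>" using \<open>0 < t\<close> by (simp add: x_def abs_mult)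
        also have "\<dots> \<le> t * c" using False \<open>0 < t\<close> by (intro mult_left_mono) auto
        also have "\<dots> = 1 / 2" using \<open>0 < c\<close> t by simp
        finally have "\<bar>sin (x / 2)\<bar> \<le> 1 / 4"
          using abs_sin_x_le_abs_x[of "x / 2"] by simp
        then have "\<bar>sin (x / 2)\<bar>\<^sup>2 \<le> (1 / 4)\<^sup>2" by (intro power_mono) auto
        moreover have "cos x = 1 - 2 * (sin (x / 2))\<^sup>2"
        proof -
          have "cos x = cos (2 * (x / 2))" by simp
          then show ?thesis unfolding cos_double sin_squared_eq by simp
        qed
        ultimately show ?thesis using False by (simp add: x_def power2_eq_square)
      qed
    qed simp
    moreover have "1 - (\<Prod>i\<in>{N..<n}. \<rho> i) \<le> R (\<lambda>\<omega>. 1 - cos (0 + t * T N n \<omega>))"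
      by (rule one_minus_cos_sum_ge[OF \<rho>(1) char that])
    moreover have "(\<Prod>i\<in>{N..<n}. \<rho> i) \<le> (\<Prod>i\<in>{N..<n}. 1 - t\<^sup>2 * \<sigma> i / 8)"
      by (intro prod_mono) (simp add: \<rho>)
    ultimately show "1 / 2 \<le> (\<Prod>i\<in>{N..<n}. 1 - t\<^sup>2 * \<sigma> i / 8)" by linarith
    show "t\<^sup>2 * \<sigma> i / 8 \<le> 1" for i using \<rho>[of i] by linarith
  qed simp
  then have "summable (\<lambda>i. t\<^sup>2 * \<sigma> i / 8)"
    by (intro summable_of_bounded_tail_sums) (simp add: \<sigma>)
  then have "summable (\<lambda>i. 8 / t\<^sup>2 * (t\<^sup>2 * \<sigma> i / 8))" by (rule summable_mult)
  then show ?thesis using \<open>0 < t\<close> by simp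
qed

text \<open>
  For functionals attaining the upper means, the variances are summable, so \<open>T m n\<close> can be
  placed within \<open>\<epsilon>\<close> of \<open>\<Sum>R (\<xi> i)\<close>. As \<open>T m n\<close> is itself small, \<open>\<Sum>R (\<xi> i)\<close> must be small.
\<close>

lemma summable_upper_means:
  assumes Cauchy: "sums_Cauchy \<xi>" and "0 < c" and c: "\<And>i \<omega>. \<bar>\<xi> i \<omega>\<bar> \<le> c"
  shows "summable (\<lambda>i. R (\<xi> i))"
proof -
  define t where "t = 1 / (2 * c)"
  have t: "0 < t" "t * c \<le> 1 / 2" using \<open>0 < c\<close> by (auto simp: t_def)
  have "\<exists>\<sigma> \<rho> \<alpha>. 0 \<le> \<sigma> \<and> 0 \<le> \<rho> \<and> \<rho> \<le> 1 - t\<^sup>2 * \<sigma> / 8 \<and>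
      (\<forall>\<theta>. 1 - \<rho> * cos (\<theta> + \<alpha>) \<le> R (\<lambda>\<omega>. 1 - cos (\<theta> + t * \<xi> i \<omega>))) \<and>
      (\<forall>s. - s\<^sup>2 - \<sigma> \<le> R (\<lambda>\<omega>. - (s + \<xi> i \<omega> - R (\<xi> i))\<^sup>2))" for i
  proof (rule extremal_moments[OF \<xi>_H[of i] c[of i] t, where a = 0 and b = 1])
    fix \<mu> \<sigma> \<rho> \<alpha>
    assume "R (\<lambda>\<omega>. 0 * (\<xi> i \<omega>)\<^sup>2 + 1 * \<xi> i \<omega>) = 0 * (\<sigma> + \<mu>\<^sup>2) + 1 * \<mu>"
    then have \<mu>: "\<mu> = R (\<xi> i)" by simp
    assume "0 \<le> \<sigma>" "0 \<le> \<rho>" "\<rho> \<le> 1 - t\<^sup>2 * \<sigma> / 8"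
      "\<And>\<theta>. 1 - \<rho> * cos (\<theta> + \<alpha>) \<le> R (\<lambda>\<omega>. 1 - cos (\<theta> + t * \<xi> i \<omega>))"
      "\<And>s. - s\<^sup>2 - \<sigma> \<le> R (\<lambda>\<omega>. - (s + \<xi> i \<omega> - \<mu>)\<^sup>2)"
    then show ?thesis unfolding \<mu> by blast
  qed
  then obtain \<sigma> \<rho> \<alpha> where mom: "\<And>i. 0 \<le> \<sigma> i" "\<And>i. 0 \<le> \<rho> i" "\<And>i. \<rho> i \<le> 1 - t\<^sup>2 * \<sigma> i / 8"
      "\<And>i \<theta>. 1 - \<rho> i * cos (\<theta> + \<alpha> i) \<le> R (\<lambda>\<omega>. 1 - cos (\<theta> + t * \<xi> i \<omega>))"
      "\<And>i s. - s\<^sup>2 - \<sigma> i \<le> R (\<lambda>\<omega>. - (s + \<xi> i \<omega> - R (\<xi> i))\<^sup>2)"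
    by metis
  have \<sigma>: "summable \<sigma>" by (rule summable_variances[OF Cauchy \<open>0 < c\<close> t_def mom(1-4)])
  show ?thesis
    unfolding summable_Cauchy real_norm_def
  proof (intro allI impI)
    fix e :: real assume "0 < e"
    define \<epsilon> where "\<epsilon> = e / 2"
    have "0 < \<epsilon>" using \<open>0 < e\<close> by (simp add: \<epsilon>_def)
    obtain N1 where N1: "\<And>m n. N1 \<le> m \<Longrightarrow> \<bar>\<Sum>i\<in>{m..<n}. \<sigma> i\<bar> < \<epsilon>\<^sup>2 / 2"
      using summable_tail_small[OF \<sigma>, of "\<epsilon>\<^sup>2 / 2"] \<open>0 < \<epsilon>\<close> by auto
    obtain N2 where N2: "\<And>m n. N2 \<le> m \<Longrightarrow> m \<le> n \<Longrightarrow>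
        V {\<omega> \<in> space M. \<epsilon> \<le> \<bar>T m n \<omega>\<bar>} < ereal (1 / 4)"
      using sums_CauchyD[OF Cauchy \<open>0 < \<epsilon>\<close>, of "1 / 4"] by auto
    have "\<bar>\<Sum>i\<in>{m..<n}. R (\<xi> i)\<bar> < e" if m: "max N1 N2 \<le> m" for m n
    proof (cases "m \<le> n")
      case True
      define a where "a = (\<Sum>i\<in>{m..<n}. R (\<xi> i))"
      define B where "B = real (n - m) * c + \<bar>a\<bar>"
      have "clamp B (T m n \<omega> + - a) = T m n \<omega> - a" for \<omega>
        using abs_T_le[where m = m and n = n and \<omega> = \<omega>, OF c] clamp_id[of "T m n \<omega> + - a" B]
        by (simp add: B_def)
      moreover have "(\<lambda>\<omega>. - (clamp B (T m n \<omega> + - a))\<^sup>2) \<in> bounded_rv"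
        by (rule T_bounded_rv[OF bounded_lipschitz_uminus[OF bounded_lipschitz_power[OF
              real_BL_shift[OF real_BL_clamp]]]])
      ultimately have sq: "(\<lambda>\<omega>. - (T m n \<omega> - a)\<^sup>2) \<in> bounded_rv" by simp
      have lower: "- (\<Sum>i\<in>{m..<n}. \<sigma> i) \<le> R (\<lambda>\<omega>. - (T m n \<omega> - a)\<^sup>2)"
        unfolding a_def by (rule centred_square_sum_ge[OF c mom(5) True])
      show ?thesis
      proof (rule ccontr)
        assume "\<not> ?thesis"
        then have "2 * \<epsilon> \<le> \<bar>a\<bar>" by (simp add: a_def \<epsilon>_def)
        have "R (\<lambda>\<omega>. - (T m n \<omega> - a)\<^sup>2) \<le> - \<epsilon>\<^sup>2 + \<epsilon>\<^sup>2 * (1 / 4)"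
        proof (rule R_le_capacity[OF sq _ N2[OF _ True]])
          fix \<omega> assume "\<omega> \<in> space M"
          show "- (T m n \<omega> - a)\<^sup>2 \<le> - \<epsilon>\<^sup>2 + \<epsilon>\<^sup>2 * indicator {\<omega> \<in> space M. \<epsilon> \<le> \<bar>T m n \<omega>\<bar>} \<omega>"
          proof (cases "\<epsilon> \<le> \<bar>T m n \<omega>\<bar>")
            case False
            then have "\<bar>\<epsilon>\<bar> \<le> \<bar>T m n \<omega> - a\<bar>" using \<open>2 * \<epsilon> \<le> \<bar>a\<bar>\<close> \<open>0 < \<epsilon>\<close> by linarith
            then have "\<epsilon>\<^sup>2 \<le> (T m n \<omega> - a)\<^sup>2" by (simp add: abs_le_square_iff)
            then show ?thesis using False by simp
          qed (use \<open>\<omega> \<in> space M\<close> in simp)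
        qed (use m in auto)
        then have "\<epsilon>\<^sup>2 * 3 / 4 \<le> (\<Sum>i\<in>{m..<n}. \<sigma> i)" using lower by linarith
        moreover have "(\<Sum>i\<in>{m..<n}. \<sigma> i) < \<epsilon>\<^sup>2 / 2" using N1[of m n] m by simp
        moreover have "0 < \<epsilon>\<^sup>2" using \<open>0 < \<epsilon>\<close> by simp
        ultimately show False by linarith
      qed
    qed (use \<open>0 < e\<close> in simp)
    then show "\<exists>N. \<forall>m\<ge>N. \<forall>n. \<bar>\<Sum>i\<in>{m..<n}. R (\<xi> i)\<bar> < e" by blast
  qed
qed

text \<open>
  The functional attaining the upper second moment about \<open>R (\<xi> i)\<close> splits it into a variance and
  the squared distance of its mean from \<open>R (\<xi> i)\<close>; the latter is at most the gap between the
  upper and the lower mean.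
\<close>

lemma summable_centred_squares:
  assumes Cauchy: "sums_Cauchy \<xi>" and "0 < c" and c: "\<And>i \<omega>. \<bar>\<xi> i \<omega>\<bar> \<le> c"
    and up: "summable (\<lambda>i. R (\<xi> i))" and low: "summable (\<lambda>i. R (\<lambda>\<omega>. - \<xi> i \<omega>))"
  shows "summable (\<lambda>i. R (\<lambda>\<omega>. (\<xi> i \<omega> - R (\<xi> i))\<^sup>2))"
proof -
  define t where "t = 1 / (2 * c)"
  have t: "0 < t" "t * c \<le> 1 / 2" using \<open>0 < c\<close> by (auto simp: t_def)
  define gap where "gap i = R (\<xi> i) + R (\<lambda>\<omega>. - \<xi> i \<omega>)" for i
  have "\<exists>\<sigma> \<rho> \<alpha>. 0 \<le> \<sigma> \<and> 0 \<le> \<rho> \<and> \<rho> \<le> 1 - t\<^sup>2 * \<sigma> / 8 \<and>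
      (\<forall>\<theta>. 1 - \<rho> * cos (\<theta> + \<alpha>) \<le> R (\<lambda>\<omega>. 1 - cos (\<theta> + t * \<xi> i \<omega>))) \<and>
      R (\<lambda>\<omega>. (\<xi> i \<omega> - R (\<xi> i))\<^sup>2) \<le> \<sigma> + (gap i)\<^sup>2" for i
  proof (rule extremal_moments[OF \<xi>_H[of i] c[of i] t, where a = 1 and b = "- 2 * R (\<xi> i)"])
    let ?a = "R (\<xi> i)"
    fix \<mu> \<sigma> \<rho> \<alpha>
    assume moment: "R (\<lambda>\<omega>. 1 * (\<xi> i \<omega>)\<^sup>2 + (- 2 * ?a) * \<xi> i \<omega>) = 1 * (\<sigma> + \<mu>\<^sup>2) + (- 2 * ?a) * \<mu>"
    assume \<mu>: "- R (\<lambda>\<omega>. - \<xi> i \<omega>) \<le> \<mu>" "\<mu> \<le> ?a"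
    have "(\<lambda>\<omega>. (\<xi> i \<omega> - 0)\<^sup>2) \<in> bounded_rv"
      by (rule R_square_shift_le(1)[OF \<xi>_H c])
    then have quad: "(\<lambda>\<omega>. 1 * (\<xi> i \<omega>)\<^sup>2 + (- 2 * ?a) * \<xi> i \<omega>) \<in> bounded_rv"
      by (intro bounded_rv_add bounded_rv_scale bounded_rvI[OF \<xi>_H c]) simp
    have "(\<lambda>\<omega>. (\<xi> i \<omega> - ?a)\<^sup>2) = (\<lambda>\<omega>. ?a\<^sup>2 + (1 * (\<xi> i \<omega>)\<^sup>2 + (- 2 * ?a) * \<xi> i \<omega>))"
      by (simp add: fun_eq_iff power2_eq_square algebra_simps)
    then have "R (\<lambda>\<omega>. (\<xi> i \<omega> - ?a)\<^sup>2) = ?a\<^sup>2 + (1 * (\<sigma> + \<mu>\<^sup>2) + (- 2 * ?a) * \<mu>)"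
      using R_translate[OF quad, of "?a\<^sup>2"] moment by simp
    also have "\<dots> = \<sigma> + (?a - \<mu>)\<^sup>2"
      by (simp add: power2_eq_square algebra_simps)
    also have "\<dots> \<le> \<sigma> + (gap i)\<^sup>2"
      using \<mu> by (intro add_left_mono power_mono) (auto simp: gap_def)
    finally have "R (\<lambda>\<omega>. (\<xi> i \<omega> - ?a)\<^sup>2) \<le> \<sigma> + (gap i)\<^sup>2" .
    moreover assume "0 \<le> \<sigma>" "0 \<le> \<rho>" "\<rho> \<le> 1 - t\<^sup>2 * \<sigma> / 8"
      "\<And>\<theta>. 1 - \<rho> * cos (\<theta> + \<alpha>) \<le> R (\<lambda>\<omega>. 1 - cos (\<theta> + t * \<xi> i \<omega>))"
    ultimately show ?thesis by blast
  qed
  then obtain \<sigma> \<rho> \<alpha> where mom: "\<And>i. 0 \<le> \<sigma> i" "\<And>i. 0 \<le> \<rho> i" "\<And>i. \<rho> i \<le> 1 - t\<^sup>2 * \<sigma> i / 8"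
      "\<And>i \<theta>. 1 - \<rho> i * cos (\<theta> + \<alpha> i) \<le> R (\<lambda>\<omega>. 1 - cos (\<theta> + t * \<xi> i \<omega>))"
      "\<And>i. R (\<lambda>\<omega>. (\<xi> i \<omega> - R (\<xi> i))\<^sup>2) \<le> \<sigma> i + (gap i)\<^sup>2"
    by metis
  have "summable (\<lambda>i. \<sigma> i + (gap i)\<^sup>2)"
    unfolding gap_def
    by (intro summable_add summable_variances[OF Cauchy \<open>0 < c\<close> t_def mom(1-4)]
        summable_mean_gap_square[OF \<xi>_H c up low])
  then show ?thesis
  proof (rule summable_comparison_test')
    show "norm (R (\<lambda>\<omega>. (\<xi> i \<omega> - R (\<xi> i))\<^sup>2)) \<le> \<sigma> i + (gap i)\<^sup>2" for i
    proof -
      have "0 \<le> R (\<lambda>\<omega>. (\<xi> i \<omega> - R (\<xi> i))\<^sup>2)"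
        by (rule const_le_R[OF R_square_shift_le(1)[OF \<xi>_H c]]) simp
      then show ?thesis unfolding real_norm_def using mom(5)[of i] by linarith
    qed
  qed
qed

end

section \<open>The three series theorem\<close>

lemma suminf_ereal_less_PInf_iff:
  assumes "\<And>i. 0 \<le> f i"
  shows "(\<Sum>i. ereal (f i)) < \<infinity> \<longleftrightarrow> summable f"
  using assms summable_ereal[of f] suminf_ereal' [of f] by auto

context sublinear_expectation_space
begin

lemma Cauchy_in_capacity_iff_sums_Cauchy:
  assumes S: "\<And>n. S n = (\<lambda>\<omega>. \<Sum>k=1..n. X k \<omega>)"
  shows "Cauchy_in_capacity M H E S \<longleftrightarrow> sums_Cauchy (\<lambda>i. X (Suc i))"
proof -
  let ?A = "\<lambda>\<epsilon> n m. {\<omega> \<in> space M. \<bar>S n \<omega> - S m \<omega>\<bar> \<ge> \<epsilon>}"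
  have A: "?A \<epsilon> n m = {\<omega> \<in> space M. \<epsilon> \<le> \<bar>\<Sum>i\<in>{m..<n}. X (Suc i) \<omega>\<bar>}" if "m \<le> n" for \<epsilon> m n
  proof -
    have "S n \<omega> = (\<Sum>i\<in>{0..<n}. X (Suc i) \<omega>)" for n \<omega>
      unfolding S by (induction n) simp_all
    moreover have "(\<Sum>i\<in>{0..<n}. X (Suc i) \<omega>) = (\<Sum>i\<in>{0..<m}. X (Suc i) \<omega>) + (\<Sum>i\<in>{m..<n}. X (Suc i) \<omega>)" for \<omega>
      using that by (simp add: sum.atLeastLessThan_concat)
    ultimately have "S n \<omega> - S m \<omega> = (\<Sum>i\<in>{m..<n}. X (Suc i) \<omega>)" for \<omega> by simp
    then show ?thesis by simp
  qed
  have A_sym: "?A \<epsilon> n m = ?A \<epsilon> m n" for \<epsilon> m n by (simp add: abs_minus_commute)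
  show ?thesis
  proof
    assume Cauchy: "Cauchy_in_capacity M H E S"
    show "sums_Cauchy (\<lambda>i. X (Suc i))"
      unfolding sums_Cauchy_def
    proof (intro allI impI)
      fix \<epsilon> \<delta> :: real assume "0 < \<epsilon>" "0 < \<delta>"
      have "((\<lambda>(n, m). V (?A \<epsilon> n m)) \<longlongrightarrow> 0) (sequentially \<times>\<^sub>F sequentially)"
        using Cauchy \<open>0 < \<epsilon>\<close> unfolding Cauchy_in_capacity_def by blast
      then have "\<forall>\<^sub>F p in sequentially \<times>\<^sub>F sequentially. (\<lambda>(n, m). V (?A \<epsilon> n m)) p < ereal \<delta>"
        by (rule order_tendstoD(2)) (use \<open>0 < \<delta>\<close> in \<open>simp add: zero_ereal_def\<close>)
      then obtain N where "\<And>m n. N \<le> n \<Longrightarrow> N \<le> m \<Longrightarrow> V (?A \<epsilon> n m) < ereal \<delta>"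
        unfolding eventually_prod_sequentially by auto
      then have "V {\<omega> \<in> space M. \<epsilon> \<le> \<bar>\<Sum>i\<in>{m..<n}. X (Suc i) \<omega>\<bar>} < ereal \<delta>"
        if "N \<le> m" "m \<le> n" for m n
        using A[OF that(2)] that by (metis order_trans)
      then show "\<exists>N. \<forall>m n. N \<le> m \<longrightarrow> m \<le> n \<longrightarrow>
          V {\<omega> \<in> space M. \<epsilon> \<le> \<bar>\<Sum>i\<in>{m..<n}. X (Suc i) \<omega>\<bar>} < ereal \<delta>"
        by blast
    qed
  next
    assume Cauchy: "sums_Cauchy (\<lambda>i. X (Suc i))"
    show "Cauchy_in_capacity M H E S"
      unfolding Cauchy_in_capacity_def
    proof (intro allI impI order_tendstoI)
      fix \<epsilon> :: real and a :: ereal assume "0 < \<epsilon>" "a < 0"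
      then have "a < V (?A \<epsilon> n m)" for n m using capacity_nonneg less_le_trans by blast
      then show "\<forall>\<^sub>F p in sequentially \<times>\<^sub>F sequentially. a < (case p of (n, m) \<Rightarrow> V (?A \<epsilon> n m))"
        by (auto simp: split_beta)
    next
      fix \<epsilon> :: real and a :: ereal assume "0 < \<epsilon>" "0 < a"
      obtain \<delta> where \<delta>: "0 < \<delta>" "ereal \<delta> < a"
        using ereal_dense2[OF \<open>0 < a\<close>] by (auto simp: zero_ereal_def)
      obtain N where N: "\<And>m n. N \<le> m \<Longrightarrow> m \<le> n \<Longrightarrow>
          V {\<omega> \<in> space M. \<epsilon> \<le> \<bar>\<Sum>i\<in>{m..<n}. X (Suc i) \<omega>\<bar>} < ereal \<delta>"
        using sums_CauchyD[OF Cauchy \<open>0 < \<epsilon>\<close> \<delta>(1)] by metis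
      have "V (?A \<epsilon> n m) < a" if "N \<le> n" "N \<le> m" for n m
      proof (cases "m \<le> n")
        case True
        show ?thesis unfolding A[OF True] using N[OF that(2) True] \<delta>(2) by (rule less_trans)
      next
        case False
        then have "n \<le> m" by simp
        show ?thesis
          unfolding A_sym[of \<epsilon> n m] A[OF \<open>n \<le> m\<close>] using N[OF that(1) \<open>n \<le> m\<close>] \<delta>(2) by (rule less_trans)
      qed
      then show "\<forall>\<^sub>F p in sequentially \<times>\<^sub>F sequentially. (case p of (n, m) \<Rightarrow> V (?A \<epsilon> n m)) < a"
        unfolding eventually_prod_sequentially by auto
    qed
  qed
qed

lemma cond_S1_iff:
  "cond_S1 M H E X c \<longleftrightarrow>
     summable (\<lambda>n. real_of_ereal (V {\<omega> \<in> space M. c < \<bar>X (Suc n) \<omega>\<bar>}))"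
proof -
  let ?v = "\<lambda>n. real_of_ereal (V {\<omega> \<in> space M. c < \<bar>X (Suc n) \<omega>\<bar>})"
  have "(\<lambda>n. V {\<omega> \<in> space M. c < \<bar>X (Suc n) \<omega>\<bar>}) = (\<lambda>n. ereal (?v n))"
    by (rule ext) (rule capacity_real)
  then have "cond_S1 M H E X c \<longleftrightarrow> (\<Sum>n. ereal (?v n)) < \<infinity>"
    unfolding cond_S1_def by (rule arg_cong[where f = "\<lambda>f. suminf f < \<infinity>"])
  also have "\<dots> \<longleftrightarrow> summable ?v"
    by (rule suminf_ereal_less_PInf_iff) (simp add: real_of_ereal_pos capacity_nonneg)
  finally show ?thesis .
qed

lemma suminf_E_square_iff:
  assumes "\<And>n. Y n \<in> H" and "\<And>n \<omega>. \<bar>Y n \<omega>\<bar> \<le> c"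
  shows "(\<Sum>n. E (\<lambda>\<omega>. (Y n \<omega> - y n)\<^sup>2)) < \<infinity> \<longleftrightarrow> summable (\<lambda>n. R (\<lambda>\<omega>. (Y n \<omega> - y n)\<^sup>2))"
proof -
  have sq: "(\<lambda>\<omega>. (Y n \<omega> - y n)\<^sup>2) \<in> bounded_rv" for n
    by (rule R_square_shift_le(1)[OF assms])
  have "(\<lambda>n. E (\<lambda>\<omega>. (Y n \<omega> - y n)\<^sup>2)) = (\<lambda>n. ereal (R (\<lambda>\<omega>. (Y n \<omega> - y n)\<^sup>2)))"
    by (rule ext) (rule E_eq_R[OF sq])
  then have "(\<Sum>n. E (\<lambda>\<omega>. (Y n \<omega> - y n)\<^sup>2)) < \<infinity>
      \<longleftrightarrow> (\<Sum>n. ereal (R (\<lambda>\<omega>. (Y n \<omega> - y n)\<^sup>2))) < \<infinity>"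
    by (rule arg_cong[where f = "\<lambda>f. suminf f < \<infinity>"])
  also have "\<dots> \<longleftrightarrow> summable (\<lambda>n. R (\<lambda>\<omega>. (Y n \<omega> - y n)\<^sup>2))"
    by (rule suminf_ereal_less_PInf_iff) (rule const_le_R[OF sq], simp)
  finally show ?thesis .
qed

end

theorem theorem3p3:
  fixes M :: "'a measure"
    and H :: "('a \<Rightarrow> real) set"
    and E :: "('a \<Rightarrow> real) \<Rightarrow> ereal"
    and X S :: "nat \<Rightarrow> 'a \<Rightarrow> real"
  assumes "sublinear_expectation_space M H E"
    and "\<And>n. n \<ge> 1 \<Longrightarrow> X n \<in> H"
    and "indep_seq E X"
    and "\<And>n. S n = (\<lambda>\<omega>. \<Sum>k=1..n. X k \<omega>)"
  shows "((\<exists>c>0. cond_S1 M H E X c \<and> cond_S2 E X c \<and> cond_S3 E X c) \<longrightarrow> Cauchy_in_capacity M H E S) \<and>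
         (Cauchy_in_capacity M H E S \<longrightarrow> (\<forall>c>0. cond_S1 M H E X c \<and> cond_S2 E X c \<and> cond_S3 E X c))"
proof -
  interpret sublinear_expectation_space M H E by (rule assms(1))
  interpret X: independent_sequence M H E "\<lambda>i. X (Suc i)"
    by (rule independent_sequence_of_indep_seq[OF assms(2,3)])
  define Y where "Y c i = trunc c (X (Suc i))" for c i
  have Y_clamp: "Y c i = (\<lambda>\<omega>. clamp c (X (Suc i) \<omega>))" for c i
    by (simp add: Y_def trunc_def clamp_def)
  have Y_indep: "independent_sequence M H E (Y c)" for c
    unfolding Y_clamp[abs_def] by (rule X.independent_sequence_lipschitz[OF clamp_lipschitz])
  have Y_H: "Y c i \<in> H" for c i
    by (rule independent_sequence.\<xi>_H[OF Y_indep])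
  have Y_le: "\<bar>Y c i \<omega>\<bar> \<le> c" if "0 < c" for c i \<omega>
    unfolding Y_clamp using that by (intro abs_clamp_le) simp
  have Y_eq: "X (Suc i) \<omega> = Y c i \<omega>"
    if "\<omega> \<in> space M" "\<omega> \<notin> {\<omega> \<in> space M. c < \<bar>X (Suc i) \<omega>\<bar>}" for c i \<omega>
    unfolding Y_clamp using that clamp_id[of "X (Suc i) \<omega>" c] by auto
  have S2_iff: "cond_S2 E X c \<longleftrightarrow>
      summable (\<lambda>i. R (Y c i)) \<and> summable (\<lambda>i. R (\<lambda>\<omega>. - Y c i \<omega>))" for c
    unfolding cond_S2_def Y_def ..
  have S3_iff: "cond_S3 E X c \<longleftrightarrow>
      summable (\<lambda>i. R (\<lambda>\<omega>. (Y c i \<omega> - R (Y c i))\<^sup>2)) \<or>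
      summable (\<lambda>i. R (\<lambda>\<omega>. (Y c i \<omega> - - R (\<lambda>\<omega>'. - Y c i \<omega>'))\<^sup>2))" if "0 < c" for c
    unfolding cond_S3_def Y_def[symmetric] suminf_E_square_iff[OF Y_H Y_le[OF that], symmetric]
    by simp
  have "sums_Cauchy (\<lambda>i. X (Suc i))"
    if "0 < c" and "cond_S1 M H E X c" and "cond_S2 E X c" and "cond_S3 E X c" for c
  proof -
    have up: "summable (\<lambda>i. R (Y c i))" and low: "summable (\<lambda>i. R (\<lambda>\<omega>. - Y c i \<omega>))"
      using that(3) unfolding S2_iff by auto
    have gap: "summable (\<lambda>i. (R (Y c i) - - R (\<lambda>\<omega>. - Y c i \<omega>))\<^sup>2)"
      using summable_mean_gap_square[OF Y_H Y_le[OF that(1)] up low] by simp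
    then have gap': "summable (\<lambda>i. (- R (\<lambda>\<omega>. - Y c i \<omega>) - R (Y c i))\<^sup>2)"
      by (simp only: power2_commute)
    \<comment> \<open>The two centres differ by the gap, so either half of the third condition gives the other.\<close>
    have sq: "summable (\<lambda>i. R (\<lambda>\<omega>. (Y c i \<omega> - R (Y c i))\<^sup>2)) \<and>
        summable (\<lambda>i. R (\<lambda>\<omega>. (Y c i \<omega> - - R (\<lambda>\<omega>'. - Y c i \<omega>'))\<^sup>2))"
      using that(4) unfolding S3_iff[OF that(1)]
    proof
      assume *: "summable (\<lambda>i. R (\<lambda>\<omega>. (Y c i \<omega> - R (Y c i))\<^sup>2))"
      with summable_R_square_shift[OF Y_H Y_le[OF that(1)] * gap'] show ?thesis by simp
    next
      assume *: "summable (\<lambda>i. R (\<lambda>\<omega>. (Y c i \<omega> - - R (\<lambda>\<omega>'. - Y c i \<omega>'))\<^sup>2))"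
      with summable_R_square_shift[OF Y_H Y_le[OF that(1)] * gap] show ?thesis by simp
    qed
    have "sums_Cauchy (Y c)"
      using independent_sequence.sums_Cauchy_of_series[OF Y_indep Y_le[OF that(1)] up low] sq by blast
    from sums_Cauchy_cong[OF that(2)[unfolded cond_S1_iff] Y_eq this] show ?thesis .
  qed
  moreover have "cond_S1 M H E X c \<and> cond_S2 E X c \<and> cond_S3 E X c"
    if Cauchy: "sums_Cauchy (\<lambda>i. X (Suc i))" and "0 < c" for c
  proof -
    have exceed: "summable (\<lambda>i. real_of_ereal (V {\<omega> \<in> space M. c < \<bar>X (Suc i) \<omega>\<bar>}))"
      by (rule X.summable_capacity_exceed[OF that])
    have Y_Cauchy: "sums_Cauchy (Y c)"
      by (rule sums_Cauchy_cong[OF exceed Y_eq[symmetric] Cauchy])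
    interpret Y: independent_sequence M H E "Y c" by (rule Y_indep)
    have neg: "independent_sequence M H E (\<lambda>i \<omega>. - Y c i \<omega>)"
      by (rule Y.independent_sequence_lipschitz) simp
    have up: "summable (\<lambda>i. R (Y c i))"
      by (rule Y.summable_upper_means[OF Y_Cauchy \<open>0 < c\<close> Y_le[OF \<open>0 < c\<close>]])
    have low: "summable (\<lambda>i. R (\<lambda>\<omega>. - Y c i \<omega>))"
      by (rule independent_sequence.summable_upper_means[OF neg sums_Cauchy_uminus[OF Y_Cauchy] \<open>0 < c\<close>])
         (simp add: Y_le \<open>0 < c\<close>)
    have "summable (\<lambda>i. R (\<lambda>\<omega>. (Y c i \<omega> - R (Y c i))\<^sup>2))"
      by (rule Y.summable_centred_squares[OF Y_Cauchy \<open>0 < c\<close> Y_le[OF \<open>0 < c\<close>] up low])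
    then show ?thesis
      unfolding cond_S1_iff S2_iff S3_iff[OF \<open>0 < c\<close>] using exceed up low by blast
  qed
  ultimately show ?thesis
    unfolding Cauchy_in_capacity_iff_sums_Cauchy[OF assms(4)] by blast
qed

end
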